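(* Irreducible trinoids (minimal ones in $\mathbb E^3$, respectively CMC $1$ ones in $\mathbb H^3$, considered modulo rigid motions) are parametrized by their weights.
   Context: Hyperbolic space $\mathbb H^3$ is the set of $2\times2$ Hermitian matrices with determinant $1$ and positive trace; Euclidean space $\mathbb E^3=T_{\mathrm I}\mathbb H^3$ is the space of trace-free $2\times2$ Hermitian matrices; both carry the metric induced by $\langle x,y\rangle=-\frac12\operatorname{tr}(x\widehat y)$ ($\widehat y$ the adjugate). A rigid motion of an immersion $f$ is $\mathcal J\circ f$ with $\mathcal J$ an orientation-preserving isometry of the ambient space. CMC 1 means constant mean curvature $1$. LWR potential on a Riemann surface: family $\xi_\lambda$ ($\lambda\in\mathbb C$) of meromorphic $\mathrm{sl}_2\mathbb C$-valued 1-forms, locally away from poles $\xi_\lambda=(A\lambda+B)dz$ with $A,B$ holomorphic in $z$ and $A$ nilpotent. LWR frame: $\mathrm{SL}_2\mathbb C$-valued solution $\Phi_\lambda$ of $\Phi^{-1}d\Phi=\xi$ on the universal cover, holomorphic in $\lambda\in\mathbb C$. With evaluation points $(\lambda_0,\lambda_1)=(0,1)$ the induced immersions are $f^{\mathbb E}=\psi+\psi^*$, $\psi=(\lambda_1-\lambda_0)(\dot\Phi\Phi^{-1})_{\lambda_0}$ (minimal in $\mathbb E^3$; dot $=\partial_\lambda$), and $f^{\mathbb H}=\Psi^*\Psi$, $\Psi=\Phi_{\lambda_1}\Phi_{\lambda_0}^{-1}$ (CMC 1 in $\mathbb H^3$). An LWR gauge is a $\lambda$-independent meromorphic map $g$ into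 $\mathrm{SL}_2\mathbb C$, acting by $\xi\cdot g=g^{-1}\xi g+g^{-1}dg$. A (genus zero) trinoid is a conformal minimal (in $\mathbb E^3$) or CMC 1 (in $\mathbb H^3$) immersion of the three-punctured sphere, with punctures normalized to $(p_0,p_1,p_2)=(0,1,\infty)$, obtained from an LWR potential $\xi$ such that around each puncture $p_k$ there is an LWR gauge $g_k$ for which $\xi\cdot g_k$ has a simple pole at $p_k$ whose residue has eigenvalues $\pm\sqrt{q_k\lambda+1/4}$; the parameter $q_k\in\mathbb C^*$ is the weight of the puncture $p_k$. The weights of the trinoid are $(q_0,q_1,q_2)$. Let $M_0,M_1,M_2$ be the monodromy matrices of the frame $\Phi$ around $0,1,\infty$ (i.e. $\tau^*\Phi=M_k\Phi$ for the corresponding deck transformation $\tau$; they depend holomorphically on $\lambda$). A set of matrices is irreducible if its elements have no common eigenline. The trinoid is irreducible if: for minimal trinoids in $\mathbb E^3$, $\{\dot M_0,\dot M_1,\dot M_2\}|_{\lambda=\lambda_0}$ is irreducible; for CMC 1 trinoids in $\mathbb H^3$, $\{M_0,M_1,M_2\}|_{\lambda=\lambda_1}$ is irreducible. *)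

theory Defs
  imports "HOL-Complex_Analysis.Complex_Analysis"
begin

type_synonym cmat = "complex^2^2"

section \<open>Matrix calculus\<close>

definition adjugate :: "cmat \<Rightarrow> cmat" where
  "adjugate x = vector [vector [x$2$2, - x$1$2], vector [- x$2$1, x$1$1]]"

definition ctransp :: "cmat \<Rightarrow> cmat" where
  "ctransp x = (\<chi> i j. cnj (x$j$i))"

definition smul :: "complex \<Rightarrow> cmat \<Rightarrow> cmat" where
  "smul c x = (\<chi> i j. c * x$i$j)"

definition holo_mat :: "(complex \<Rightarrow> cmat) \<Rightarrow> complex set \<Rightarrow> bool" where
  "holo_mat F S \<longleftrightarrow> (\<forall>i j. (\<lambda>z. F z$i$j) holomorphic_on S)"

definition mero_mat :: "(complex \<Rightarrow> cmat) \<Rightarrow> complex set \<Rightarrow> bool" where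
  "mero_mat F S \<longleftrightarrow> (\<forall>i j. (\<lambda>z. F z$i$j) meromorphic_on S)"

definition analytic_mat_at :: "(complex \<Rightarrow> cmat) \<Rightarrow> complex \<Rightarrow> bool" where
  "analytic_mat_at F z \<longleftrightarrow> (\<forall>i j. (\<lambda>w. F w$i$j) analytic_on {z})"

definition deriv_mat :: "(complex \<Rightarrow> cmat) \<Rightarrow> complex \<Rightarrow> cmat" where
  "deriv_mat F z = (\<chi> i j. deriv (\<lambda>w. F w$i$j) z)"

definition irreducible_mats :: "cmat set \<Rightarrow> bool" where
  "irreducible_mats S \<longleftrightarrow> \<not> (\<exists>v. v \<noteq> 0 \<and> (\<forall>M\<in>S. \<exists>c. M *v v = c *s v))"


section \<open>The two ambient spaces\<close>

definition hermitian :: "cmat set" where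
  "hermitian = {x. ctransp x = x}"

text \<open>The trace below is real whenever both arguments are Hermitian.\<close>

definition form :: "cmat \<Rightarrow> cmat \<Rightarrow> real" where
  "form x y = Re (- (1/2) * trace (x ** adjugate y))"

datatype ambient = Euclidean | Hyperbolic

fun space_of :: "ambient \<Rightarrow> cmat set" where
  "space_of Euclidean = {x \<in> hermitian. trace x = 0}"
| "space_of Hyperbolic = {x \<in> hermitian. det x = 1 \<and> Re (trace x) > 0}"

fun tangent :: "ambient \<Rightarrow> cmat \<Rightarrow> cmat set" where
  "tangent Euclidean x = {y \<in> hermitian. trace y = 0}"
| "tangent Hyperbolic x = {y \<in> hermitian. form x y = 0}"

text \<open>The geodesic distance of the Riemannian metric that \<^const>\<open>form\<close> induces.\<close>

fun ambient_dist :: "ambient \<Rightarrow> cmat \<Rightarrow> cmat \<Rightarrow> real" where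
  "ambient_dist Euclidean x y = sqrt (form (x - y) (x - y))"
| "ambient_dist Hyperbolic x y = arcosh (- form x y)"

text \<open>Coordinates of a Hermitian matrix with respect to the identity and the three Pauli matrices.\<close>

definition pauli_coords :: "cmat \<Rightarrow> real^4" where
  "pauli_coords x = vector
     [Re (x$1$1 + x$2$2) / 2, Re (x$1$2), - Im (x$1$2), Re (x$1$1 - x$2$2) / 2]"

definition vol4 :: "cmat \<Rightarrow> cmat \<Rightarrow> cmat \<Rightarrow> cmat \<Rightarrow> real" where
  "vol4 a b c d = det (vector [pauli_coords a, pauli_coords b, pauli_coords c, pauli_coords d] :: real^4^4)"

text \<open>
  Orientation of the geodesic simplex with ordered vertices a, b, c, d. A basis u, v, w of the
  tangent space at x is positive if vol4 n u v w > 0, where n = x in the hyperbolic case and n is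
  the identity in the Euclidean case (Euclidean space is the tangent space of hyperbolic space at
  the identity).
\<close>

fun positive_simplex :: "ambient \<Rightarrow> cmat \<Rightarrow> cmat \<Rightarrow> cmat \<Rightarrow> cmat \<Rightarrow> bool" where
  "positive_simplex Euclidean a b c d \<longleftrightarrow> vol4 (mat 1) (b - a) (c - a) (d - a) > 0"
| "positive_simplex Hyperbolic a b c d \<longleftrightarrow> vol4 a b c d > 0"

text \<open>Only the values of J on the ambient space matter.\<close>

definition rigid_motion :: "ambient \<Rightarrow> (cmat \<Rightarrow> cmat) \<Rightarrow> bool" where
  "rigid_motion X J \<longleftrightarrow>
     bij_betw J (space_of X) (space_of X) \<and>
     (\<forall>x\<in>space_of X. \<forall>y\<in>space_of X. ambient_dist X (J x) (J y) = ambient_dist X x y) \<and>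
     (\<forall>a\<in>space_of X. \<forall>b\<in>space_of X. \<forall>c\<in>space_of X. \<forall>d\<in>space_of X.
        positive_simplex X a b c d \<longrightarrow> positive_simplex X (J a) (J b) (J c) (J d))"


section \<open>Surfaces\<close>

text \<open>The sphere punctured at 0, 1 and infinity.\<close>

definition punctured_sphere :: "complex set" where
  "punctured_sphere = - {0, 1}"

definition partial :: "complex \<Rightarrow> (complex \<Rightarrow> cmat) \<Rightarrow> complex \<Rightarrow> cmat" where
  "partial v f z = frechet_derivative f (at z) v"

text \<open>Real differentiability; the surface parameter z = x + i y runs through an open set.\<close>

fun C_k_on :: "nat \<Rightarrow> (complex \<Rightarrow> cmat) \<Rightarrow> complex set \<Rightarrow> bool" where
  "C_k_on 0 f S \<longleftrightarrow> continuous_on S f"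
| "C_k_on (Suc k) f S \<longleftrightarrow> (\<forall>z\<in>S. f differentiable (at z)) \<and>
     C_k_on k (partial 1 f) S \<and> C_k_on k (partial \<i> f) S"

definition conformal_immersion :: "ambient \<Rightarrow> (complex \<Rightarrow> cmat) \<Rightarrow> bool" where
  "conformal_immersion X f \<longleftrightarrow>
     f ` punctured_sphere \<subseteq> space_of X \<and>
     (\<forall>k. C_k_on k f punctured_sphere) \<and>
     (\<forall>z\<in>punctured_sphere. inj (frechet_derivative f (at z))) \<and>
     (\<forall>z\<in>punctured_sphere. \<exists>c>0. \<forall>v w. form (partial v f z) (partial w f z) = c * (v \<bullet> w))"

definition unit_normal_field :: "ambient \<Rightarrow> (complex \<Rightarrow> cmat) \<Rightarrow> (complex \<Rightarrow> cmat) \<Rightarrow> bool" where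
  "unit_normal_field X f N \<longleftrightarrow> continuous_on punctured_sphere N \<and>
     (\<forall>z\<in>punctured_sphere. N z \<in> tangent X (f z) \<and> form (N z) (N z) = 1 \<and>
        form (partial 1 f z) (N z) = 0 \<and> form (partial \<i> f z) (N z) = 0)"

text \<open>
  Half the trace of the second fundamental form with respect to the first. In the hyperbolic case
  the second derivatives are taken in the linear space of Hermitian matrices; they differ from the
  covariant ones by multiples of the point f z, which is orthogonal to N z.
\<close>

definition mean_curvature :: "(complex \<Rightarrow> cmat) \<Rightarrow> (complex \<Rightarrow> cmat) \<Rightarrow> complex \<Rightarrow> real" where
  "mean_curvature f N z =
     (let E = form (partial 1 f z) (partial 1 f z);
          F = form (partial 1 f z) (partial \<i> f z);
          G = form (partial \<i> f z) (partial \<i> f z);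
          l = form (partial 1 (partial 1 f) z) (N z);
          m = form (partial 1 (partial \<i> f) z) (N z);
          n = form (partial \<i> (partial \<i> f) z) (N z)
      in (E * n - 2 * F * m + G * l) / (2 * (E * G - F^2)))"

fun required_curvature :: "ambient \<Rightarrow> real" where
  "required_curvature Euclidean = 0"
| "required_curvature Hyperbolic = 1"

definition cmc_immersion :: "ambient \<Rightarrow> (complex \<Rightarrow> cmat) \<Rightarrow> bool" where
  "cmc_immersion X f \<longleftrightarrow> conformal_immersion X f \<and>
     (\<exists>N. unit_normal_field X f N \<and>
        (\<forall>z\<in>punctured_sphere. mean_curvature f N z = required_curvature X))"

definition same_up_to_rigid_motion :: "ambient \<Rightarrow> (complex \<Rightarrow> cmat) \<Rightarrow> (complex \<Rightarrow> cmat) \<Rightarrow> bool" where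
  "same_up_to_rigid_motion X f g \<longleftrightarrow> (\<exists>J. rigid_motion X J \<and> (\<forall>z\<in>punctured_sphere. g z = J (f z)))"


section \<open>LWR potentials and frames\<close>

text \<open>A pair (A, B) of matrix functions stands for the potential (A l + B) dz.\<close>

definition potential :: "(complex \<Rightarrow> cmat) \<Rightarrow> (complex \<Rightarrow> cmat) \<Rightarrow> complex \<Rightarrow> complex \<Rightarrow> cmat" where
  "potential A B l z = smul l (A z) + B z"

definition poles :: "(complex \<Rightarrow> cmat) \<Rightarrow> (complex \<Rightarrow> cmat) \<Rightarrow> complex set" where
  "poles A B = {z \<in> punctured_sphere. \<not> (analytic_mat_at A z \<and> analytic_mat_at B z)}"

definition LWR_potential :: "(complex \<Rightarrow> cmat) \<Rightarrow> (complex \<Rightarrow> cmat) \<Rightarrow> bool" where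
  "LWR_potential A B \<longleftrightarrow> mero_mat A punctured_sphere \<and> mero_mat B punctured_sphere \<and>
     (\<forall>z \<in> punctured_sphere - poles A B.
        (\<forall>l. trace (potential A B l z) = 0) \<and> A z ** A z = 0)"

text \<open>By uniformization the universal cover can be realized as a plane domain U.\<close>

definition universal_cover :: "complex set \<Rightarrow> (complex \<Rightarrow> complex) \<Rightarrow> bool" where
  "universal_cover U p \<longleftrightarrow> open U \<and> U \<noteq> {} \<and> simply_connected U \<and>
     p holomorphic_on U \<and> covering_space U p punctured_sphere"

text \<open>
  The frame is single-valued on the universal cover of the three-punctured sphere, with the
  preimages of poles of the potential removed.
\<close>

definition regular_part ::
  "(complex \<Rightarrow> cmat) \<Rightarrow> (complex \<Rightarrow> cmat) \<Rightarrow> complex set \<Rightarrow> (complex \<Rightarrow> complex) \<Rightarrow> complex set" where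
  "regular_part A B U p = {u \<in> U. p u \<notin> poles A B}"

definition LWR_frame ::
  "(complex \<Rightarrow> cmat) \<Rightarrow> (complex \<Rightarrow> cmat) \<Rightarrow> complex set \<Rightarrow> (complex \<Rightarrow> complex)
     \<Rightarrow> (complex \<Rightarrow> complex \<Rightarrow> cmat) \<Rightarrow> bool" where
  "LWR_frame A B U p \<Phi> \<longleftrightarrow>
     (\<forall>u \<in> regular_part A B U p.
        holo_mat (\<Phi> u) UNIV \<and>
        (\<forall>l. det (\<Phi> u l) = 1 \<and>
           (\<forall>i j. ((\<lambda>w. \<Phi> w l $ i $ j) has_field_derivative
              (\<Phi> u l ** smul (deriv p u) (potential A B l (p u))) $ i $ j) (at u))))"

text \<open>Evaluation points l0, l1; the second argument of the frame is the spectral parameter.\<close>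

fun induced :: "ambient \<Rightarrow> complex \<Rightarrow> complex \<Rightarrow> (complex \<Rightarrow> complex \<Rightarrow> cmat) \<Rightarrow> complex \<Rightarrow> cmat" where
  "induced Euclidean l0 l1 \<Phi> u =
     (let \<psi> = smul (l1 - l0) (deriv_mat (\<Phi> u) l0 ** matrix_inv (\<Phi> u l0)) in \<psi> + ctransp \<psi>)"
| "induced Hyperbolic l0 l1 \<Phi> u =
     (let \<Psi> = \<Phi> u l1 ** matrix_inv (\<Phi> u l0) in ctransp \<Psi> ** \<Psi>)"


section \<open>Punctures, weights and monodromy\<close>

datatype puncture = P0 | P1 | PInf

text \<open>Inverse of a local coordinate of the sphere that vanishes at the puncture.\<close>

fun chart :: "puncture \<Rightarrow> complex \<Rightarrow> complex" where
  "chart P0 w = w"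
| "chart P1 w = 1 + w"
| "chart PInf w = 1 / w"

definition has_simple_pole :: "(complex \<Rightarrow> cmat) \<Rightarrow> complex \<Rightarrow> cmat \<Rightarrow> bool" where
  "has_simple_pole \<eta> p R \<longleftrightarrow> R \<noteq> 0 \<and>
     (\<exists>r>0. \<exists>H. holo_mat H (ball p r) \<and>
        (\<forall>w \<in> ball p r - {p}. \<eta> w = smul (1 / (w - p)) R + H w))"

text \<open>
  Gauges act through conjugation and the logarithmic derivative, so they are taken up to sign:
  g is meromorphic in t, where w = t^2 is the local coordinate at the puncture, and even
  (single-valued in w) or odd (for instance diag (t, 1/t)). Odd gauges are indispensable: even ones
  at all three punctures would force trace -2 on each of the three monodromies at l = 0, hence
  (each being plus or minus the identity there) a product different from the identity.
  The potential after gauging is \<eta> l w dw, which in terms of t is \<eta> l (t^2) 2 t dt.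
\<close>

definition gauged_potential_at ::
  "(complex \<Rightarrow> cmat) \<Rightarrow> (complex \<Rightarrow> cmat) \<Rightarrow> puncture \<Rightarrow> (complex \<Rightarrow> complex \<Rightarrow> cmat) \<Rightarrow> bool" where
  "gauged_potential_at A B k \<eta> \<longleftrightarrow>
     (\<exists>r>0. \<exists>g. holo_mat g (ball 0 r - {0}) \<and> mero_mat g {0} \<and>
        (\<forall>t \<in> ball 0 r - {0}. det (g t) = 1) \<and>
        ((\<forall>t \<in> ball 0 r - {0}. g (- t) = g t) \<or> (\<forall>t \<in> ball 0 r - {0}. g (- t) = - g t)) \<and>
        (\<forall>l. \<forall>t \<in> ball 0 r - {0}.
           smul (2 * t) (\<eta> l (t^2)) =
             matrix_inv (g t) **
               smul (deriv (\<lambda>s. chart k (s^2)) t) (potential A B l (chart k (t^2))) ** g t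
             + matrix_inv (g t) ** deriv_mat g t))"

text \<open>The eigenvalues are counted with multiplicity.\<close>

definition has_weight :: "(complex \<Rightarrow> cmat) \<Rightarrow> (complex \<Rightarrow> cmat) \<Rightarrow> puncture \<Rightarrow> complex \<Rightarrow> bool" where
  "has_weight A B k q \<longleftrightarrow> q \<noteq> 0 \<and>
     (\<exists>\<eta>. gauged_potential_at A B k \<eta> \<and>
        (\<forall>l. \<exists>R. has_simple_pole (\<eta> l) 0 R \<and>
           (\<forall>x. det (mat x - R) = (x - csqrt (q * l + 1/4)) * (x + csqrt (q * l + 1/4)))))"

text \<open>
  Generators of the fundamental group based at 1/2, with trivial product: the circles through 1/2
  around 0 and around 1, and the inverse of their concatenation, which is a simple loop around
  infinity.
\<close>

fun puncture_loop :: "puncture \<Rightarrow> real \<Rightarrow> complex" where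
  "puncture_loop P0 = circlepath 0 (1/2)"
| "puncture_loop P1 = circlepath 1 (-1/2)"
| "puncture_loop PInf = reversepath (circlepath 0 (1/2) +++ circlepath 1 (-1/2))"

text \<open>The deck transformation that moves u0 to the end point of the lift of \<gamma> starting at u0.\<close>

definition deck_of_loop ::
  "complex set \<Rightarrow> (complex \<Rightarrow> complex) \<Rightarrow> complex \<Rightarrow> (real \<Rightarrow> complex) \<Rightarrow> (complex \<Rightarrow> complex) \<Rightarrow> bool" where
  "deck_of_loop U p u0 \<gamma> \<tau> \<longleftrightarrow>
     (\<exists>\<tau>'. homeomorphism U U \<tau> \<tau>') \<and> (\<forall>u\<in>U. p (\<tau> u) = p u) \<and>
     (\<exists>c. path c \<and> path_image c \<subseteq> U \<and> pathstart c = u0 \<and> pathfinish c = \<tau> u0 \<and>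
        (\<forall>s\<in>{0..1}. p (c s) = \<gamma> s))"

definition monodromy ::
  "(complex \<Rightarrow> cmat) \<Rightarrow> (complex \<Rightarrow> cmat) \<Rightarrow> complex set \<Rightarrow> (complex \<Rightarrow> complex)
     \<Rightarrow> (complex \<Rightarrow> complex \<Rightarrow> cmat) \<Rightarrow> (puncture \<Rightarrow> complex \<Rightarrow> cmat) \<Rightarrow> bool" where
  "monodromy A B U p \<Phi> M \<longleftrightarrow>
     (\<exists>u0\<in>U. p u0 = 1/2 \<and>
        (\<forall>k. \<exists>\<tau>. deck_of_loop U p u0 (puncture_loop k) \<tau> \<and>
           (\<forall>u \<in> regular_part A B U p. \<forall>l. \<Phi> (\<tau> u) l = M k l ** \<Phi> u l)))"

fun irreducible_monodromy :: "ambient \<Rightarrow> complex \<Rightarrow> complex \<Rightarrow> (puncture \<Rightarrow> complex \<Rightarrow> cmat) \<Rightarrow> bool" where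
  "irreducible_monodromy Euclidean l0 l1 M \<longleftrightarrow> irreducible_mats (range (\<lambda>k. deriv_mat (M k) l0))"
| "irreducible_monodromy Hyperbolic l0 l1 M \<longleftrightarrow> irreducible_mats (range (\<lambda>k. M k l1))"


section \<open>Trinoids\<close>

definition trinoid_from ::
  "ambient \<Rightarrow> (complex \<Rightarrow> cmat) \<Rightarrow> (complex \<Rightarrow> cmat) \<Rightarrow> complex set \<Rightarrow> (complex \<Rightarrow> complex)
     \<Rightarrow> (complex \<Rightarrow> complex \<Rightarrow> cmat) \<Rightarrow> (complex \<Rightarrow> cmat) \<Rightarrow> (puncture \<Rightarrow> complex) \<Rightarrow> bool" where
  "trinoid_from X A B U p \<Phi> f q \<longleftrightarrow>
     cmc_immersion X f \<and>
     LWR_potential A B \<and> universal_cover U p \<and> LWR_frame A B U p \<Phi> \<and>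
     (\<forall>u \<in> regular_part A B U p. f (p u) = induced X 0 1 \<Phi> u) \<and>
     (\<forall>k. has_weight A B k (q k))"

definition irreducible_trinoid ::
  "ambient \<Rightarrow> (complex \<Rightarrow> cmat) \<Rightarrow> (puncture \<Rightarrow> complex) \<Rightarrow> bool" where
  "irreducible_trinoid X f q \<longleftrightarrow>
     (\<exists>A B U p \<Phi> M. trinoid_from X A B U p \<Phi> f q \<and>
        monodromy A B U p \<Phi> M \<and> irreducible_monodromy X 0 1 M)"

end

theory Submission
  imports Defs "HOL-Computational_Algebra.Fundamental_Theorem_Algebra"
begin

text \<open>
  Both kinds of surface are governed by one holomorphic matrix form \<alpha> dz on the
  three-punctured sphere, the null form: \<alpha> is the derivative of f with respect to z for a minimal
  surface, and that derivative multiplied from the left by the inverse of f for a CMC 1 surface. On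
  the universal cover it is the conjugate of A by the frame at the spectral value 0
  (null_form_frame). So \<alpha> is single-valued, nilpotent and nowhere zero, and it has no poles on the
  punctured sphere because f is smooth there. Since the square of \<alpha> vanishes, the product of \<alpha> and
  its derivative is a scalar multiple Q \<alpha>; the scalar Q is the coefficient of the Hopf differential.

  The weights are read off at the punctures. In the gauge of the definition, and at the spectral
  value 0, the frame solves an equation with a simple pole whose residue has eigenvalues 1/2 and -1/2.
  Hence the frame grows at most like the power -1/2 of the local coordinate w, the null form has at
  most a double pole, and Q has a double pole with leading coefficient q
  (weighted_end_null_form).

  Consequently the null form is a nilpotent polynomial matrix of degree
  at most 4 divided by the square of z (z - 1). A nilpotent matrix is built from a
  spinor, and here the two components s and t of the spinor are quadratic polynomials whose Wronskian
  is Q times the square of z (z - 1). The weights determine this quadratic Wronskian, and the three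
  coefficients of the Wronskian are, up to a factor 2, the Pluecker coordinates of the pair (s, t) in the
  three-dimensional space of quadratic polynomials. So trinoids with equal weights have
  null forms that are conjugate by one constant matrix S of determinant 1
  (weighted_null_curves_conjugate).

  It remains to pass from null forms to surfaces. The monodromy at the spectral value 0 commutes with
  \<alpha>, hence it is plus or minus the identity. For CMC 1 surfaces, transporting the second surface by
  S and pulling it back by the frame of the first gives a constant matrix, which commutes with
  the monodromy at 1; by irreducibility it is scalar, so S induces the congruence
  (congruent_hyperbolic). For minimal surfaces the positive matrix P, the adjoint of S times S, makes
  the difference of f conjugated by P and of the second surface conjugated by S a holomorphic
  function; comparing it with the Sym formula shows that P commutes with the derivatives of
  the monodromy at 0, so S is unitary (congruent_euclidean).

  Conversely, Q is a congruence invariant: its real and imaginary parts are volumes spanned by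
  derivatives of f, divided by the metric (hopf_geometric). A rigid motion preserves
  the indefinite form and one oriented simplex, and by Gram determinants this is enough to
  preserve these volumes (rigid_motion_hopf). Orientation matters here: the form alone determines Q
  only up to sign.
\<close>

(* With two meanings of the infix dollar sign, the number of parses grows exponentially with
   the number of matrix entries in a formula. *)
no_notation fps_nth (infixl \<open>$\<close> 75)

section \<open>Matrices with complex entries\<close>

lemma cmat_eq_iff: "(A :: cmat) = B \<longleftrightarrow> A$1$1 = B$1$1 \<and> A$1$2 = B$1$2 \<and> A$2$1 = B$2$1 \<and> A$2$2 = B$2$2"
  unfolding vec_eq_iff forall_2 by (rule conj_assoc)

lemma mult_entry: "((A :: cmat) ** B)$i$j = A$i$1 * B$1$j + A$i$2 * B$2$j"
  by (simp add: matrix_matrix_mult_def sum_2)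

lemma smul_entry [simp]: "smul c A $ i $ j = c * A$i$j"
  by (simp add: smul_def)

lemma ctransp_entry [simp]: "ctransp A $ i $ j = cnj (A$j$i)"
  by (simp add: ctransp_def)

lemma adjugate_entry [simp]:
  "adjugate A $ 1 $ 1 = A$2$2" "adjugate A $ 1 $ 2 = - A$1$2"
  "adjugate A $ 2 $ 1 = - A$2$1" "adjugate A $ 2 $ 2 = A$1$1"
  by (simp_all add: adjugate_def)

lemma one_entry [simp]:
  "(mat 1 :: cmat) $ 1 $ 1 = 1" "(mat 1 :: cmat) $ 1 $ 2 = 0"
  "(mat 1 :: cmat) $ 2 $ 1 = 0" "(mat 1 :: cmat) $ 2 $ 2 = 1"
  by (simp_all add: mat_def)

lemma trace_entry: "trace (A :: cmat) = A$1$1 + A$2$2"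
  by (simp add: trace_def sum_2)

lemmas cmat_expand = cmat_eq_iff mult_entry trace_entry det_2

lemma smul_simps [simp]:
  "smul 1 A = A" "smul 0 A = 0" "smul c 0 = 0" "smul c (smul d A) = smul (c * d) A"
  by (simp_all add: cmat_eq_iff)

lemma smul_mult_left [simp]: "smul c A ** B = smul c (A ** B)"
  and smul_mult_right [simp]: "A ** smul c B = smul c (A ** B)"
  by (simp_all add: cmat_expand algebra_simps)

lemma scaleR_smul: "r *\<^sub>R A = smul (of_real r) A"
  by (simp only: cmat_eq_iff vector_scaleR_component smul_entry) (simp add: scaleR_conv_of_real)

lemma smul_add: "smul c (A + B) = smul c A + smul c B"
  and smul_diff: "smul c (A - B) = smul c A - smul c B"
  and smul_minus: "smul c (- A) = - smul c A"
  and smul_minus_left: "smul (- c) A = - smul c A"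
  by (simp_all add: cmat_eq_iff algebra_simps)

lemma norm_cmat: "(norm (A :: cmat))\<^sup>2 = (cmod (A$1$1))\<^sup>2 + (cmod (A$1$2))\<^sup>2 + (cmod (A$2$1))\<^sup>2 + (cmod (A$2$2))\<^sup>2"
  by (simp add: norm_vec_def L2_set_def sum_2)

lemma norm_smul: "norm (smul c A) = cmod c * norm A"
  by (rule power2_eq_imp_eq) (simp_all add: power_mult_distrib norm_cmat norm_mult distrib_left)

lemma norm_adjugate: "norm (adjugate A) = norm A"
  by (rule power2_eq_imp_eq) (simp_all add: norm_cmat)

lemma norm_mult_le: "norm (A ** (B :: cmat)) \<le> norm A * norm (B :: cmat)" for A :: cmat
proof (rule power2_le_imp_le)
  have e: "(cmod ((A ** B)$i$j))\<^sup>2 \<le> ((cmod (A$i$1))\<^sup>2 + (cmod (A$i$2))\<^sup>2) * ((cmod (B$1$j))\<^sup>2 + (cmod (B$2$j))\<^sup>2)" for i j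
  proof -
    define p q r s where "p = cmod (A$i$1)" "q = cmod (A$i$2)" "r = cmod (B$1$j)" "s = cmod (B$2$j)"
    have "cmod ((A ** B)$i$j) \<le> p * r + q * s"
      unfolding mult_entry p_q_r_s_def by (rule order_trans[OF norm_triangle_ineq]) (simp add: norm_mult)
    then have "(cmod ((A ** B)$i$j))\<^sup>2 \<le> (p * r + q * s)\<^sup>2" by (rule power_mono) simp
    also have "\<dots> = (p\<^sup>2 + q\<^sup>2) * (r\<^sup>2 + s\<^sup>2) - (p * s - q * r)\<^sup>2"
      by (simp add: power2_eq_square algebra_simps)
    also have "\<dots> \<le> (p\<^sup>2 + q\<^sup>2) * (r\<^sup>2 + s\<^sup>2)" by simp
    finally show ?thesis by (simp add: p_q_r_s_def)
  qed
  show "(norm (A ** B))\<^sup>2 \<le> (norm A * norm B)\<^sup>2"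
    using e[of 1 1] e[of 1 2] e[of 2 1] e[of 2 2]
    unfolding power_mult_distrib norm_cmat by (simp add: algebra_simps)
qed simp

lemma bounded_bilinear_mult: "bounded_bilinear ((**) :: cmat \<Rightarrow> cmat \<Rightarrow> cmat)"
  unfolding bilinear_conv_bounded_bilinear[symmetric] bilinear_def
  by (auto intro!: linearI simp: cmat_expand algebra_simps)

interpretation mm: bounded_bilinear "(**) :: cmat \<Rightarrow> cmat \<Rightarrow> cmat"
  by (rule bounded_bilinear_mult)

lemma bounded_bilinear_smul: "bounded_bilinear smul"
  unfolding bilinear_conv_bounded_bilinear[symmetric] bilinear_def
  by (auto intro!: linearI simp: cmat_eq_iff algebra_simps)

interpretation sm: bounded_bilinear smul
  by (rule bounded_bilinear_smul)

lemma bounded_linear_ctransp: "bounded_linear ctransp"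
  unfolding linear_conv_bounded_linear[symmetric] by (auto intro!: linearI simp: cmat_eq_iff)

lemma ctransp_linear:
  "ctransp (A + B) = ctransp A + ctransp B" "ctransp (A - B) = ctransp A - ctransp B"
  "ctransp (- A) = - ctransp A" "ctransp 0 = 0"
  by (simp_all add: cmat_eq_iff)

lemma bounded_linear_adjugate: "bounded_linear adjugate"
  unfolding linear_conv_bounded_linear[symmetric] by (auto intro!: linearI simp: cmat_eq_iff)

lemma adjugate_linear:
  "adjugate (A + B) = adjugate A + adjugate B" "adjugate (A - B) = adjugate A - adjugate B"
  "adjugate (- A) = - adjugate A" "adjugate 0 = 0"
  by (simp_all add: cmat_eq_iff)

lemma bounded_linear_entry: "bounded_linear (\<lambda>A :: cmat. A $ i $ j)"
  unfolding linear_conv_bounded_linear[symmetric] by (auto intro!: linearI)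

lemma ctransp_simps [simp]:
  "ctransp (ctransp A) = A" "ctransp (A ** B) = ctransp B ** ctransp A"
  "ctransp (smul c A) = smul (cnj c) (ctransp A)" "ctransp (mat 1) = mat 1"
  by (simp_all add: cmat_expand mult.commute)

lemma adjugate_simps [simp]:
  "adjugate (adjugate A) = A" "adjugate (A ** B) = adjugate B ** adjugate A"
  "adjugate (smul c A) = smul c (adjugate A)" "adjugate (mat 1) = mat 1"
  "det (adjugate A) = det A" "ctransp (adjugate A) = adjugate (ctransp A)"
  by (simp_all add: cmat_expand algebra_simps)

lemma det_ctransp [simp]: "det (ctransp A) = cnj (det (A :: cmat))"
  by (simp add: det_2 mult.commute)

lemma trace_ctransp [simp]: "trace (ctransp A) = cnj (trace A)"
  by (simp add: trace_entry)

lemma mult_adjugate: "A ** adjugate A = smul (det A) (mat 1)" "adjugate A ** A = smul (det A) (mat 1)"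
  by (simp_all add: cmat_expand algebra_simps)

lemma mult_adjugate_cancel:
  assumes "det A = 1"
  shows "A ** adjugate A = mat 1" "adjugate A ** A = mat 1"
    "B ** A ** adjugate A = B" "B ** adjugate A ** A = B"
  using assms by (simp_all add: mult_adjugate matrix_mul_assoc[symmetric])

lemma matrix_inv_eq_adjugate:
  assumes "det (A :: cmat) = 1"
  shows "matrix_inv A = adjugate A"
proof -
  have inv: "\<exists>B. A ** B = mat 1 \<and> B ** A = mat 1"
    using mult_adjugate_cancel(1,2)[OF assms] by blast
  have *: "matrix_inv A ** A = mat 1"
    unfolding matrix_inv_def using someI_ex[OF inv] by blast
  have "matrix_inv A = matrix_inv A ** (A ** adjugate A)"
    by (simp add: mult_adjugate_cancel[OF assms])
  also have "\<dots> = adjugate A"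
    unfolding matrix_mul_assoc * by simp
  finally show ?thesis .
qed

lemma det_smul: "det (smul c A) = c\<^sup>2 * det A"
  by (simp add: det_2 power2_eq_square algebra_simps)

lemma trace_commute: "trace (A ** B) = trace (B ** (A :: cmat))"
  by (simp add: cmat_expand)

lemma trace_linear:
  "trace (A + B) = trace A + trace (B :: cmat)" "trace (A - B) = trace A - trace (B :: cmat)"
  "trace (- A) = - trace (A :: cmat)" "trace (smul c A) = c * trace A"
  by (simp_all add: trace_entry algebra_simps)

text \<open>
  Complex differentiability is phrased as a Frechet derivative that is complex linear in the direction.
  So the product rule for bounded bilinear maps applies, and holomorphic factors mix freely with
  transposed conjugates, which are differentiable over the reals only.
\<close>

definition has_mderiv :: "(complex \<Rightarrow> cmat) \<Rightarrow> cmat \<Rightarrow> complex \<Rightarrow> bool" where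
  "has_mderiv F D z \<longleftrightarrow> (F has_derivative (\<lambda>h. smul h D)) (at z)"

lemma Basis_cmat: "(Basis :: cmat set) = {axis i (axis j c) | i j c. c \<in> {1, \<i>}}"
  by (auto simp: Basis_vec_def Basis_complex_def) 

lemma has_derivative_cmat_iff:
  "(F has_derivative D) (at z) \<longleftrightarrow>
     (\<forall>i j. ((\<lambda>w. (F w :: cmat) $ i $ j) has_derivative (\<lambda>h. D h $ i $ j)) (at z))"
proof (intro iffI allI)
  fix i j assume "(F has_derivative D) (at z)"
  from bounded_linear.has_derivative[OF bounded_linear_entry this]
  show "((\<lambda>w. F w $ i $ j) has_derivative (\<lambda>h. D h $ i $ j)) (at z)" .
next
  assume *: "\<forall>i j. ((\<lambda>w. F w $ i $ j) has_derivative (\<lambda>h. D h $ i $ j)) (at z)"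
  show "(F has_derivative D) (at z)"
  proof (subst has_derivative_componentwise_within, rule ballI)
    fix b :: cmat assume "b \<in> Basis"
    then obtain i j c where b: "b = axis i (axis j c)"
      by (auto simp: Basis_cmat)
    have eq: "(M :: cmat) \<bullet> b = M $ i $ j \<bullet> c" for M
      by (simp add: b inner_axis)
    show "((\<lambda>x. F x \<bullet> b) has_derivative (\<lambda>x. D x \<bullet> b)) (at z)"
      unfolding eq using * by (intro has_derivative_inner_left) auto
  qed
qed

lemma has_mderiv_iff:
  "has_mderiv F D z \<longleftrightarrow> (\<forall>i j. ((\<lambda>w. F w $ i $ j) has_field_derivative D $ i $ j) (at z))"
  by (simp add: has_mderiv_def has_derivative_cmat_iff has_field_derivative_def mult_commute_abs)

lemma has_mderiv_const: "has_mderiv (\<lambda>_. C) 0 z"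
  by (simp add: has_mderiv_iff)

lemma has_mderiv_diff: "has_mderiv F D z \<Longrightarrow> has_mderiv G E z \<Longrightarrow> has_mderiv (\<lambda>w. F w - G w) (D - E) z"
  by (auto simp: has_mderiv_iff intro!: derivative_eq_intros)

lemma has_mderiv_mult:
  "has_mderiv F D z \<Longrightarrow> has_mderiv G E z \<Longrightarrow> has_mderiv (\<lambda>w. F w ** G w) (F z ** E + D ** G z) z"
  unfolding has_mderiv_def
  by (drule (1) mm.FDERIV) (simp add: smul_add)

lemma has_mderiv_smul:
  "(c has_field_derivative d) (at z) \<Longrightarrow> has_mderiv F D z \<Longrightarrow>
     has_mderiv (\<lambda>w. smul (c w) (F w)) (smul (c z) D + smul d (F z)) z"
  by (auto simp: has_mderiv_iff intro!: derivative_eq_intros)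

lemma has_mderiv_adjugate: "has_mderiv F D z \<Longrightarrow> has_mderiv (\<lambda>w. adjugate (F w)) (adjugate D) z"
  unfolding has_mderiv_def by (drule bounded_linear.has_derivative[OF bounded_linear_adjugate]) simp

lemma has_mderiv_compose:
  assumes "has_mderiv F D (g z)" and "(g has_field_derivative d) (at z)"
  shows "has_mderiv (\<lambda>w. F (g w)) (smul d D) z"
  unfolding has_mderiv_iff
proof (intro allI)
  fix i j
  from assms(1) have "((\<lambda>w. F w $ i $ j) has_field_derivative D $ i $ j) (at (g z))"
    by (simp add: has_mderiv_iff)
  from DERIV_chain2[OF this assms(2)]
  show "((\<lambda>w. F (g w) $ i $ j) has_field_derivative smul d D $ i $ j) (at z)"
    by (simp add: mult.commute)
qed

lemma has_mderiv_deriv_mat: "has_mderiv F D z \<Longrightarrow> deriv_mat F z = D"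
  by (auto simp: has_mderiv_iff deriv_mat_def vec_eq_iff intro!: DERIV_imp_deriv)

lemma has_mderiv_unique: "has_mderiv F D z \<Longrightarrow> has_mderiv F E z \<Longrightarrow> D = E"
  using has_mderiv_deriv_mat by metis

lemma has_mderiv_cong:
  assumes "has_mderiv F D z" and "open S" and "z \<in> S" and "\<And>w. w \<in> S \<Longrightarrow> F w = G w"
  shows "has_mderiv G D z"
  using assms unfolding has_mderiv_def by (auto intro: has_derivative_transform_within_open)

lemma holo_mat_has_mderiv:
  assumes "holo_mat F S" and "open S" and "z \<in> S"
  shows "has_mderiv F (deriv_mat F z) z"
  using assms by (auto simp: has_mderiv_iff deriv_mat_def holo_mat_def intro!: holomorphic_derivI)

lemma has_mderiv_imp_continuous: "has_mderiv F D z \<Longrightarrow> isCont F z"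
  unfolding has_mderiv_def by (rule has_derivative_continuous)

lemma holo_mat_continuous_on:
  assumes "holo_mat F S" and "open S"
  shows "continuous_on S F"
  using holo_mat_has_mderiv[OF assms] has_mderiv_imp_continuous
  by (intro continuous_at_imp_continuous_on) blast

lemma holo_mat_subset: "holo_mat F S \<Longrightarrow> T \<subseteq> S \<Longrightarrow> holo_mat F T"
  by (auto simp: holo_mat_def intro: holomorphic_on_subset)

lemma has_mderiv_constant:
  assumes "open S" "connected S" "\<And>z. z \<in> S \<Longrightarrow> has_mderiv F 0 z" "x \<in> S" "y \<in> S"
  shows "F x = F y"
  using has_derivative_zero_unique_connected[OF assms(1,2) _ assms(4,5), of F] assms(3)
  by (simp add: has_mderiv_def)

section \<open>Frames\<close>

lemma continuous_mult:
  "continuous_on S F \<Longrightarrow> continuous_on S G \<Longrightarrow> continuous_on S (\<lambda>x. (F x :: cmat) ** (G x :: cmat))"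
  "continuous_on S c \<Longrightarrow> continuous_on S G \<Longrightarrow> continuous_on S (\<lambda>x. smul (c x) (G x))"
  "continuous_on S G \<Longrightarrow> continuous_on S (\<lambda>x. adjugate (G x))"
  "continuous_on S G \<Longrightarrow> continuous_on S (\<lambda>x. ctransp (G x))"
  "continuous_on S G \<Longrightarrow> continuous_on S (\<lambda>x. (G x :: cmat) $ i $ j)"
  by (auto intro: mm.continuous_on sm.continuous_on
    bounded_linear.continuous_on[OF bounded_linear_adjugate]
    bounded_linear.continuous_on[OF bounded_linear_ctransp]
    bounded_linear.continuous_on[OF bounded_linear_entry])

lemma norm_entry_le: "cmod ((M :: cmat) $ i $ j) \<le> norm M"
  by (rule order_trans[OF Finite_Cartesian_Product.norm_nth_le Finite_Cartesian_Product.norm_nth_le])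

text \<open>
  The derivative of the Sym formula. The family Y solves dY = l Y a with Y = 1 at l = 0, and it is
  assumed differentiable in each variable separately, so the mixed derivative needs an argument. The
  difference quotients (Y - 1) / l have the derivative Y a in w; the equation itself forces Y to tend to 1
  uniformly near u as l tends to 0, so these derivatives converge uniformly and the limit may be differentiated.
\<close>

lemma spectral_derivative_of_frame:
  fixes Y :: "complex \<Rightarrow> complex \<Rightarrow> cmat"
  assumes S: "open S" "u \<in> S"
    and Y: "\<And>w l. w \<in> S \<Longrightarrow> has_mderiv (\<lambda>w. Y w l) (smul l (Y w l ** a w)) w"
    and a: "continuous_on S a"
    and \<psi>: "\<And>w. w \<in> S \<Longrightarrow> has_mderiv (Y w) (\<psi> w) 0"
    and Y0: "\<And>w. w \<in> S \<Longrightarrow> Y w 0 = mat 1"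
  shows "has_mderiv \<psi> (a u) u"
proof -
  obtain R where R: "R > 0" "cball u R \<subseteq> S"
    using S open_contains_cball by blast
  have "compact (a ` cball u R)"
    using R a by (intro compact_continuous_image) (auto intro: continuous_on_subset)
  then obtain K0 where K0: "\<And>w. w \<in> cball u R \<Longrightarrow> norm (a w) \<le> K0"
    using compact_imp_bounded[of "a ` cball u R"] unfolding bounded_iff by blast
  define K where "K = max K0 1"
  have K: "K > 0" "\<And>w. w \<in> cball u R \<Longrightarrow> norm (a w) \<le> K"
    using K0 by (force simp: K_def)+
  \<comment> \<open>On a disc of this radius the right hand side of the equation contributes at most a quarter of the
    supremum of Y, which can therefore be absorbed.\<close>
  define r where "r = min R (1 / (4 * K))"
  have r: "r > 0" "r \<le> R" "r * K \<le> 1/4"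
    using R K by (auto simp: r_def min_def field_simps)
  define B where "B = cball u r"
  have BS: "B \<subseteq> S" "B \<subseteq> cball u R" "u \<in> B" using R r by (auto simp: B_def)
  define one where "one = (mat 1 :: cmat)"
  define l :: "nat \<Rightarrow> complex" where "l n = of_real (inverse (real (Suc n)))" for n
  have l: "norm (l n) \<le> 1" "l n \<noteq> 0" for n
    unfolding l_def norm_of_real by (simp_all add: divide_simps del: of_nat_Suc)
  have l0: "l \<longlonglongrightarrow> 0"
    unfolding l_def using LIMSEQ_inverse_real_of_nat tendsto_of_real_iff[of _ 0] by (metis of_real_0)
  have key: "norm (Y w (l n) - one) \<le> 2 * (norm (Y u (l n) - one) + norm (l n) * norm one)"
    if w: "w \<in> B" for w n
  proof -
    have cont: "continuous_on B (\<lambda>w. Y w (l n) - one)"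
      using BS Y has_mderiv_imp_continuous 
      by (intro continuous_intros continuous_at_imp_continuous_on ballI) blast
    have "compact B" "B \<noteq> {}" using r by (auto simp: B_def)
    from continuous_attains_sup[OF this continuous_on_norm[OF cont]]
    obtain m where m: "m \<in> B" "\<And>w. w \<in> B \<Longrightarrow> norm (Y w (l n) - one) \<le> norm (Y m (l n) - one)"
      by blast
    define s where "s = norm (Y m (l n) - one)"
    have s0: "s \<ge> 0" by (simp add: s_def)
    have Yb: "norm (Y w (l n)) \<le> s + norm one" if "w \<in> B" for w
      using m(2)[OF that] norm_triangle_ineq[of "Y w (l n) - one" one] by (simp add: s_def)
    have deriv: "((\<lambda>w. Y w (l n)) has_derivative (\<lambda>h. smul h (smul (l n) (Y w (l n) ** a w)))) (at w within B)"
      if "w \<in> B" for w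
      using Y[of w "l n"] BS that unfolding has_mderiv_def by (auto intro: has_derivative_at_withinI)
    have bd: "onorm (\<lambda>h. smul h (smul (l n) (Y w (l n) ** a w))) \<le> norm (l n) * (s + norm one) * K" if "w \<in> B" for w
    proof (rule onorm_bound)
      show "0 \<le> norm (l n) * (s + norm one) * K" using s0 K by simp
      fix h :: complex
      have "norm (Y w (l n) ** a w) \<le> (s + norm one) * K"
        by (rule order_trans[OF norm_mult_le], intro mult_mono Yb K(2)) (use that BS s0 in auto)
      then have "norm h * (norm (l n) * norm (Y w (l n) ** a w)) \<le> norm h * (norm (l n) * ((s + norm one) * K))"
        by (intro mult_left_mono) auto
      then show "norm (smul h (smul (l n) (Y w (l n) ** a w))) \<le> norm (l n) * (s + norm one) * K * norm h"
        by (simp add: norm_smul norm_mult mult_ac)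
    qed
    have "norm (Y m (l n) - Y u (l n)) \<le> norm (l n) * (s + norm one) * K * norm (m - u)"
      by (rule differentiable_bound[OF _ deriv bd]) (use m BS in \<open>auto simp: B_def\<close>)
    also have "\<dots> \<le> norm (l n) * (s + norm one) * K * r"
      using m(1) K s0 by (intro mult_left_mono) (auto simp: B_def dist_norm norm_minus_commute)
    also have "\<dots> \<le> norm (l n) * (s + norm one) * (1/4)"
      using r(3) s0 by (simp only: mult.assoc, intro mult_left_mono) (auto simp: mult.commute)
    finally have "s \<le> norm (Y u (l n) - one) + norm (l n) * (s + norm one) * (1/4)"
      using norm_triangle_ineq[of "Y m (l n) - Y u (l n)" "Y u (l n) - one"] by (simp add: s_def)
    moreover have "norm (l n) * s \<le> s" using l s0 mult_right_mono[of "norm (l n)" 1 s] by simp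
    moreover have "norm (l n) * norm one \<ge> 0" "norm (Y u (l n) - one) \<ge> 0" by simp_all
    ultimately have "s \<le> 2 * (norm (Y u (l n) - one) + norm (l n) * norm one)"
      by (simp only: distrib_left distrib_right)
    with m(2)[OF w] show ?thesis by (simp add: s_def)
  qed
  define M where "M n = 2 * (norm (Y u (l n) - one) + norm (l n) * norm one)" for n
  have M0: "M \<longlonglongrightarrow> 0"
  proof -
    have "isCont (Y u) 0" using \<psi>[OF S(2)] by (rule has_mderiv_imp_continuous)
    then have "(\<lambda>n. Y u (l n)) \<longlonglongrightarrow> Y u 0" using l0 by (rule isCont_tendsto_compose)
    then have "(\<lambda>n. 2 * (norm (Y u (l n) - one) + norm (l n) * norm one)) \<longlonglongrightarrow> 2 * (norm (Y u 0 - one) + norm (0::complex) * norm one)"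
      by (intro tendsto_intros l0)
    then show ?thesis using Y0[OF S(2)] by (simp add: M_def[abs_def] one_def)
  qed
  show ?thesis
    unfolding has_mderiv_iff
  proof (intro allI)
    fix i j
    define f where "f n w = (Y w (l n) $ i $ j - one $ i $ j) / l n" for n w
    have lim: "(\<lambda>n. f n w) \<longlonglongrightarrow> \<psi> w $ i $ j" if "w \<in> B" for w
    proof -
      have "((\<lambda>x. Y w x $ i $ j) has_field_derivative \<psi> w $ i $ j) (at 0)"
        using \<psi>[of w] that BS by (auto simp: has_mderiv_iff)
      then have "((\<lambda>x. (Y w x $ i $ j - Y w 0 $ i $ j) / x) \<longlongrightarrow> \<psi> w $ i $ j) (at 0)"
        by (simp add: has_field_derivative_iff)
      moreover have "filterlim l (at 0) sequentially"
        using l0 l(2) by (simp add: filterlim_at)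
      ultimately have "(\<lambda>n. (Y w (l n) $ i $ j - Y w 0 $ i $ j) / l n) \<longlonglongrightarrow> \<psi> w $ i $ j"
        by (rule filterlim_compose)
      then show ?thesis using Y0[of w] that BS by (auto simp: f_def one_def)
    qed
    have "\<exists>g. \<forall>x \<in> B. (\<lambda>n. f n x) \<longlonglongrightarrow> g x \<and> (g has_field_derivative (a x $ i $ j)) (at x within B)"
    proof (rule has_complex_derivative_sequence)
      show "convex B" by (simp add: B_def)
      fix n x assume x: "x \<in> B"
      have "((\<lambda>w. Y w (l n) $ i $ j) has_field_derivative smul (l n) (Y x (l n) ** a x) $ i $ j) (at x)"
        using Y[of x "l n"] x BS unfolding has_mderiv_iff by blast
      then have "((\<lambda>w. (Y w (l n) $ i $ j - one $ i $ j) / l n) has_field_derivative (smul (l n) (Y x (l n) ** a x) $ i $ j - 0) / l n) (at x)"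
        by (intro DERIV_cdivide DERIV_diff) auto
      then show "(f n has_field_derivative (Y x (l n) ** a x) $ i $ j) (at x within B)"
        using l by (simp add: f_def[abs_def] has_field_derivative_at_within)
    next
      fix e :: real assume e: "e > 0"
      have "\<forall>\<^sub>F n in sequentially. M n < e / K"
        by (rule order_tendstoD(2)[OF M0]) (use e K in simp)
      then obtain N where N: "\<And>n. n \<ge> N \<Longrightarrow> M n < e / K" unfolding eventually_sequentially by blast
      show "\<exists>N. \<forall>n x. n \<ge> N \<longrightarrow> x \<in> B \<longrightarrow> cmod ((Y x (l n) ** a x) $ i $ j - a x $ i $ j) \<le> e"
      proof (intro exI[of _ N] allI impI)
        fix n x assume n: "n \<ge> N" and x: "x \<in> B"
        have "Y x (l n) ** a x - a x = (Y x (l n) - one) ** a x"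
          by (simp add: mm.diff_left one_def)
        then have "cmod ((Y x (l n) ** a x) $ i $ j - a x $ i $ j) \<le> norm ((Y x (l n) - one) ** a x)"
          using norm_entry_le[of "(Y x (l n) - one) ** a x" i j] by (metis vector_minus_component)
        also have "\<dots> \<le> norm (Y x (l n) - one) * norm (a x)" by (rule norm_mult_le)
        also have "\<dots> \<le> M n * K"
          using key[OF x, of n] K(2)[of x] x BS by (intro mult_mono) (auto simp: M_def)
        also have "\<dots> \<le> e" using N[OF n] K by (simp add: field_simps)
        finally show "cmod ((Y x (l n) ** a x) $ i $ j - a x $ i $ j) \<le> e" .
      qed
    next
      show "\<exists>x l. x \<in> B \<and> (\<lambda>n. f n x) \<longlonglongrightarrow> l" using lim BS by blast
    qed
    then obtain g where g: "\<And>x. x \<in> B \<Longrightarrow> (\<lambda>n. f n x) \<longlonglongrightarrow> g x"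
      "\<And>x. x \<in> B \<Longrightarrow> (g has_field_derivative (a x $ i $ j)) (at x within B)" by blast
    have "g x = \<psi> x $ i $ j" if "x \<in> B" for x
      by (rule LIMSEQ_unique[OF g(1)[OF that] lim[OF that]])
    moreover have "(g has_field_derivative (a u $ i $ j)) (at u within ball u r)"
      using g(2)[OF BS(3)] by (rule has_field_derivative_subset) (auto simp: B_def)
    then have "(g has_field_derivative (a u $ i $ j)) (at u)"
      using r by (simp add: at_within_open[of u "ball u r"])
    ultimately show "((\<lambda>w. \<psi> w $ i $ j) has_field_derivative a u $ i $ j) (at u)"
      using r by (auto intro!: has_field_derivative_transform_within_open[of g _ u "ball u r"] simp: B_def)
  qed
qed


lemma adjugate_tracefree: "trace A = 0 \<Longrightarrow> adjugate A = - A"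
  by (auto simp: cmat_expand add_eq_0_iff)

lemma open_punctured_sphere: "open punctured_sphere"
  by (simp add: punctured_sphere_def open_Compl finite_imp_closed)

lemma connected_punctured_sphere: "connected punctured_sphere"
  unfolding punctured_sphere_def
  by (intro connected_open_diff_countable[of UNIV, simplified Compl_eq_Diff_UNIV[symmetric]]) auto

text \<open>
  A covering map is locally injective, and an injective holomorphic map is biholomorphic onto its image.
\<close>

lemma universal_cover_local_inverse:
  assumes "universal_cover U p" and "u \<in> U"
  obtains V q where "open V" "u \<in> V" "V \<subseteq> U" "open (p ` V)" "inj_on p V"
    "q holomorphic_on (p ` V)" "\<And>v. v \<in> V \<Longrightarrow> q (p v) = v" "deriv p u \<noteq> 0"
proof -
  from assms have U: "open U" "p holomorphic_on U" "covering_space U p punctured_sphere"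
    by (auto simp: universal_cover_def)
  obtain V W g where V: "u \<in> V" "openin (top_of_set U) V" "homeomorphism V W p g"
    using covering_space_local_homeomorphism[OF U(3) assms(2)] by metis
  have V': "open V" "V \<subseteq> U" using V(2) U(1) by (auto simp: openin_open_eq)
  have inj: "inj_on p V" using V(3) by (metis homeomorphism_def inj_on_inverseI)
  have hol: "p holomorphic_on V" using U(2) V'(2) by (rule holomorphic_on_subset)
  obtain q where "q holomorphic_on (p ` V)" "\<And>v. v \<in> V \<Longrightarrow> q (p v) = v"
    using holomorphic_has_inverse[OF hol V'(1) inj] by metis
  moreover have "open (p ` V)" by (rule open_mapping_thm3[OF hol V'(1) inj])
  moreover have "deriv p u \<noteq> 0"
    using holomorphic_injective_imp_regular[OF hol V'(1) inj V(1)] .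
  ultimately show thesis using that V V' inj by blast
qed

locale lwr_frame =
  fixes A B :: "complex \<Rightarrow> cmat" and U :: "complex set" and p :: "complex \<Rightarrow> complex"
    and \<Phi> :: "complex \<Rightarrow> complex \<Rightarrow> cmat"
  assumes pot: "LWR_potential A B" and cov: "universal_cover U p" and frame: "LWR_frame A B U p \<Phi>"
begin

definition regular_base :: "complex set" where "regular_base = punctured_sphere - poles A B"

abbreviation reg :: "complex set" where "reg \<equiv> regular_part A B U p"

lemma U_facts: "open U" "connected U" "p holomorphic_on U" "covering_space U p punctured_sphere" "p ` U = punctured_sphere"
  using cov covering_space_imp_surjective[of U p punctured_sphere] simply_connected_imp_connected[of U]
  unfolding universal_cover_def by simp_all

lemma sparse_poles: "poles A B sparse_in punctured_sphere"
proof -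
  have "eventually (\<lambda>z. \<forall>i j. (\<lambda>w. A w $ i $ j) analytic_on {z} \<and> (\<lambda>w. B w $ i $ j) analytic_on {z})
          (cosparse punctured_sphere)"
    unfolding eventually_all_finite
    by (intro eventually_all_finite eventually_conj meromorphic_on_imp_analytic_cosparse)
       (use pot in \<open>auto simp: LWR_potential_def mero_mat_def\<close>)
  then have "{z. \<not> (\<forall>i j. (\<lambda>w. A w $ i $ j) analytic_on {z} \<and> (\<lambda>w. B w $ i $ j) analytic_on {z})} sparse_in punctured_sphere"
    by (simp only: eventually_cosparse)
  then show ?thesis
    by (rule sparse_in_subset2) (auto simp: poles_def analytic_mat_at_def)
qed

lemma open_regular_base: "open regular_base"
  unfolding regular_base_def by (rule open_diff_sparse_pts[OF open_punctured_sphere sparse_poles])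

lemma reg_iff: "u \<in> reg \<longleftrightarrow> u \<in> U \<and> p u \<in> regular_base"
  using U_facts by (auto simp: regular_part_def regular_base_def)

lemma image_reg: "p ` reg = regular_base"
  using U_facts(5) by (force simp: reg_iff regular_base_def image_iff)

lemma open_reg: "open reg"
proof -
  have "reg = U \<inter> p -` regular_base" by (auto simp: reg_iff)
  then show ?thesis
    using continuous_open_preimage[OF holomorphic_on_imp_continuous_on U_facts(1) open_regular_base] U_facts by simp
qed

text \<open>
  The frame exists only off the preimage of the poles. Every comparison of two frames is an argument that
  a function with vanishing derivative is constant, so this set has to be connected; it is a plane
  domain without a sparse set, since p is locally injective.
\<close>

lemma connected_reg: "connected reg"
proof -
  define T where "T = {u \<in> U. p u \<in> poles A B}"
  have "\<forall>\<^sub>F v in at u. v \<notin> T" if uU: "u \<in> U" for u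
  proof -
    have pu: "p u \<in> punctured_sphere" using that U_facts by blast
    obtain V where V: "open V" "u \<in> V" "inj_on p V"
      using universal_cover_local_inverse[OF cov uU] by metis
    have "\<forall>\<^sub>F v in at u. v \<in> V" using V(1,2) by (rule eventually_at_in_open')
    moreover have "\<forall>\<^sub>F v in at u. v \<noteq> u" by (simp add: eventually_at_filter)
    ultimately have "\<forall>\<^sub>F v in at u. p v \<noteq> p u"
      by eventually_elim (use V in \<open>auto dest: inj_onD\<close>)
    moreover have "isCont p u"
      using U_facts that by (meson continuous_on_eq_continuous_at holomorphic_on_imp_continuous_on)
    ultimately have "filterlim p (at (p u)) (at u)"
      by (simp add: filterlim_at isCont_def)
    moreover have "\<forall>\<^sub>F z in at (p u). z \<notin> poles A B"
      using sparse_poles pu open_punctured_sphere by (simp add: sparse_in_eventually_iff)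
    ultimately have "\<forall>\<^sub>F v in at u. p v \<notin> poles A B"
      by (auto simp: filterlim_iff)
    then show ?thesis by eventually_elim (auto simp: T_def)
  qed
  then have "T sparse_in U" using U_facts by (simp add: sparse_in_eventually_iff)
  then have "connected (U - T)"
    using U_facts by (intro sparse_imp_connected) auto
  also have "U - T = reg" by (auto simp: T_def regular_part_def)
  finally show ?thesis .
qed

lemma reg_imp_U: "u \<in> reg \<Longrightarrow> u \<in> U" and reg_imp_base: "u \<in> reg \<Longrightarrow> p u \<in> regular_base"
  by (auto simp: reg_iff)

lemma potential_regular:
  assumes "z \<in> regular_base"
  shows "has_mderiv A (deriv_mat A z) z" "has_mderiv B (deriv_mat B z) z"
    "trace (A z) = 0" "trace (B z) = 0" "A z ** A z = 0"
proof -
  have an: "analytic_mat_at A z" "analytic_mat_at B z" using assms by (auto simp: regular_base_def poles_def)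
  have *: "has_mderiv F (deriv_mat F z) z" if "analytic_mat_at F z" for F
    unfolding has_mderiv_iff deriv_mat_def
  proof (intro allI)
    fix i j
    have "(\<lambda>w. F w $ i $ j) field_differentiable at z"
      using that by (auto simp: analytic_mat_at_def intro: analytic_on_imp_differentiable_at)
    then show "((\<lambda>w. F w $ i $ j) has_field_derivative (\<chi> i j. deriv (\<lambda>w. F w $ i $ j) z) $ i $ j) (at z)"
      by (simp add: DERIV_deriv_iff_field_differentiable)
  qed
  show "has_mderiv A (deriv_mat A z) z" "has_mderiv B (deriv_mat B z) z" using an * by auto
  have tr: "l * trace (A z) + trace (B z) = 0" for l
    using pot assms unfolding LWR_potential_def regular_base_def potential_def by (auto simp: trace_linear)
  from tr[of 0] tr[of 1] show "trace (A z) = 0" "trace (B z) = 0" by auto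
  show "A z ** A z = 0" using pot assms unfolding LWR_potential_def regular_base_def by auto
qed

lemma deriv_p: "u \<in> U \<Longrightarrow> (p has_field_derivative deriv p u) (at u)"
  using U_facts by (auto intro: holomorphic_derivI)

lemma frame_facts:
  assumes "u \<in> reg"
  shows "det (\<Phi> u l) = 1"
    "has_mderiv (\<lambda>w. \<Phi> w l) (smul (deriv p u) (\<Phi> u l ** potential A B l (p u))) u"
    "has_mderiv (\<Phi> u) (deriv_mat (\<Phi> u) l) l"
proof -
  from frame assms have h: "holo_mat (\<Phi> u) UNIV" and d: "det (\<Phi> u l) = 1"
    and m: "\<forall>i j. ((\<lambda>w. \<Phi> w l $ i $ j) has_field_derivative
              (\<Phi> u l ** smul (deriv p u) (potential A B l (p u))) $ i $ j) (at u)"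
    by (auto simp: LWR_frame_def)
  show "det (\<Phi> u l) = 1" by (rule d)
  show "has_mderiv (\<lambda>w. \<Phi> w l) (smul (deriv p u) (\<Phi> u l ** potential A B l (p u))) u"
    using m unfolding has_mderiv_iff smul_mult_right .
  show "has_mderiv (\<Phi> u) (deriv_mat (\<Phi> u) l) l" using holo_mat_has_mderiv[OF h] by simp
qed

text \<open>
  The null form in terms of the frame.
\<close>

definition frame_form :: "complex \<Rightarrow> cmat" where
  "frame_form u = \<Phi> u 0 ** A (p u) ** adjugate (\<Phi> u 0)"

text \<open>
  Dividing by the frame at 0 removes B from the equation: only the part l A of the potential is left.
\<close>

lemma frame_quotient_at:
  assumes u: "u \<in> reg"
  shows "has_mderiv (\<lambda>w. \<Phi> w l ** adjugate (\<Phi> w 0))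
           (smul l (\<Phi> u l ** adjugate (\<Phi> u 0) ** smul (deriv p u) (frame_form u))) u"
proof -
  let ?F = "\<Phi> u l" and ?G = "\<Phi> u 0" and ?c = "deriv p u"
  have adjB: "adjugate (B (p u)) = - B (p u)"
    using potential_regular(4)[OF reg_imp_base[OF u]] by (rule adjugate_tracefree)
  have "has_mderiv (\<lambda>w. \<Phi> w l ** adjugate (\<Phi> w 0))
     (?F ** adjugate (smul ?c (?G ** potential A B 0 (p u))) + smul ?c (?F ** potential A B l (p u)) ** adjugate ?G) u"
    by (intro has_mderiv_mult has_mderiv_adjugate frame_facts u)
  also have "?F ** adjugate (smul ?c (?G ** potential A B 0 (p u))) + smul ?c (?F ** potential A B l (p u)) ** adjugate ?G
     = smul (l * ?c) (?F ** A (p u) ** adjugate ?G)"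
    by (simp add: potential_def adjB mm.add_left mm.add_right mm.minus_left mm.minus_right smul_add smul_minus
        matrix_mul_assoc mult.commute)
  also have "\<dots> = smul l (?F ** adjugate ?G ** smul ?c (frame_form u))"
    by (simp add: frame_form_def matrix_mul_assoc mult_adjugate_cancel[OF frame_facts(1)[OF u]])
  finally show ?thesis .
qed

lemma continuous_frame_form: "continuous_on reg (\<lambda>u. smul (deriv p u) (frame_form u))"
proof -
  have "continuous_on reg (deriv p)"
    by (rule continuous_on_subset[OF holomorphic_on_imp_continuous_on[OF holomorphic_deriv[OF U_facts(3,1)]]])
      (auto simp: reg_iff)
  moreover have "continuous_on reg (\<lambda>u. \<Phi> u 0)"
    using frame_facts(2) has_mderiv_imp_continuous by (intro continuous_at_imp_continuous_on) blast
  moreover have "continuous_on reg (\<lambda>u. A (p u))"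
    using has_mderiv_compose[OF potential_regular(1)[OF reg_imp_base] deriv_p[OF reg_imp_U]] has_mderiv_imp_continuous
    by (intro continuous_at_imp_continuous_on) blast
  ultimately show ?thesis unfolding frame_form_def by (intro continuous_mult)
qed

lemma sym_formula_deriv:
  assumes u: "u \<in> reg"
  shows "has_mderiv (\<lambda>w. deriv_mat (\<Phi> w) 0 ** adjugate (\<Phi> w 0)) (smul (deriv p u) (frame_form u)) u"
proof (rule spectral_derivative_of_frame[OF open_reg u frame_quotient_at continuous_frame_form])
  fix w assume w: "w \<in> reg"
  show "\<Phi> w 0 ** adjugate (\<Phi> w 0) = mat 1"
    by (rule mult_adjugate_cancel[OF frame_facts(1)[OF w]])
  have "has_mderiv (\<lambda>l. \<Phi> w l ** adjugate (\<Phi> w 0)) (\<Phi> w 0 ** 0 + deriv_mat (\<Phi> w) 0 ** adjugate (\<Phi> w 0)) 0"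
    by (intro has_mderiv_mult has_mderiv_const frame_facts w)
  then show "has_mderiv (\<lambda>l. \<Phi> w l ** adjugate (\<Phi> w 0)) (deriv_mat (\<Phi> w) 0 ** adjugate (\<Phi> w 0)) 0"
    by simp
qed

lemma frame_form_deriv:
  assumes u: "u \<in> reg"
  shows "has_mderiv frame_form (smul (deriv p u) (\<Phi> u 0 ** (deriv_mat A (p u) + B (p u) ** A (p u) - A (p u) ** B (p u)) ** adjugate (\<Phi> u 0))) u"
proof -
  let ?G = "\<Phi> u 0" and ?c = "deriv p u"
  have adjB: "adjugate (B (p u)) = - B (p u)"
    using potential_regular(4)[OF reg_imp_base[OF u]] by (rule adjugate_tracefree)
  have "has_mderiv frame_form
     ((?G ** A (p u)) ** adjugate (smul ?c (?G ** potential A B 0 (p u)))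
      + (?G ** smul ?c (deriv_mat A (p u)) + smul ?c (?G ** potential A B 0 (p u)) ** A (p u)) ** adjugate ?G) u"
    unfolding frame_form_def[abs_def]
    by (intro has_mderiv_mult has_mderiv_adjugate frame_facts u has_mderiv_compose potential_regular
       deriv_p reg_imp_base reg_imp_U)
  also have "(?G ** A (p u)) ** adjugate (smul ?c (?G ** potential A B 0 (p u)))
      + (?G ** smul ?c (deriv_mat A (p u)) + smul ?c (?G ** potential A B 0 (p u)) ** A (p u)) ** adjugate ?G
     = smul ?c (?G ** (deriv_mat A (p u) + B (p u) ** A (p u) - A (p u) ** B (p u)) ** adjugate ?G)"
    by (simp add: potential_def adjB mm.add_left mm.add_right mm.diff_left mm.diff_right mm.minus_left mm.minus_right smul_add smul_diff smul_minus
        matrix_mul_assoc)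
  finally show ?thesis .
qed

end

section \<open>The holomorphic null form of a surface\<close>

text \<open>
  The matrix that turns the null form into the derivative of f with respect to z, and the reference
  normal of the orientation form: Euclidean space is the tangent space at the identity.
\<close>

definition base :: "ambient \<Rightarrow> (complex \<Rightarrow> cmat) \<Rightarrow> complex \<Rightarrow> cmat" where
  "base X f z = (case X of Euclidean \<Rightarrow> mat 1 | Hyperbolic \<Rightarrow> f z)"

text \<open>
  The derivative of f with respect to z, carried to the identity by the inverse of the base matrix.
\<close>

definition null_form :: "ambient \<Rightarrow> (complex \<Rightarrow> cmat) \<Rightarrow> complex \<Rightarrow> cmat" where
  "null_form X f z = adjugate (base X f z) ** smul (1/2) (partial 1 f z - smul \<i> (partial \<i> f z))"

text \<open>
  Twice the Hermitian part of the complex linear map that K defines: for a Hermitian matrix function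
  this is the shape of a real differential with dz-part K.
\<close>

definition real_part_form :: "cmat \<Rightarrow> complex \<Rightarrow> cmat" where
  "real_part_form K v = smul v K + ctransp (smul v K)"

lemma real_part_form_inject:
  assumes "\<And>v. real_part_form K v = real_part_form L v"
  shows "K = L"
proof -
  have rec: "real_part_form M 1 - smul \<i> (real_part_form M \<i>) = smul 2 M" for M
    by (simp add: real_part_form_def cmat_eq_iff right_diff_distrib distrib_left)
  have "smul 2 K = smul 2 L" by (simp only: rec[symmetric] assms)
  then show ?thesis by (simp add: cmat_eq_iff)
qed

lemma base_facts:
  assumes "f z \<in> space_of X"
  shows "det (base X f z) = 1" "ctransp (base X f z) = base X f z"
  using assms by (cases X; simp add: base_def hermitian_def det_2)+

context
  fixes X f assumes imm: "conformal_immersion X f"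
begin

lemma immersion_in_space: "z \<in> punctured_sphere \<Longrightarrow> f z \<in> space_of X"
  using imm by (auto simp: conformal_immersion_def)

lemma immersion_hermitian: "z \<in> punctured_sphere \<Longrightarrow> ctransp (f z) = f z"
  using immersion_in_space[of z] by (cases X) (auto simp: hermitian_def)

lemma immersion_C_k: "C_k_on k f punctured_sphere"
  using imm by (auto simp: conformal_immersion_def)

lemma immersion_differentiable:
  "z \<in> punctured_sphere \<Longrightarrow> f differentiable (at z)"
  "z \<in> punctured_sphere \<Longrightarrow> partial 1 f differentiable (at z)"
  "z \<in> punctured_sphere \<Longrightarrow> partial \<i> f differentiable (at z)"
  using immersion_C_k[of "Suc (Suc 0)"] by auto

lemma immersion_continuous:
  "continuous_on punctured_sphere f"
  "continuous_on punctured_sphere (partial 1 f)" "continuous_on punctured_sphere (partial \<i> f)"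
  using immersion_C_k[of 0] immersion_C_k[of "Suc 0"] by auto

text \<open>
  A Hermitian matrix function has a Hermitian differential, which is determined by its dz-part.
\<close>

lemma immersion_derivative:
  assumes z: "z \<in> punctured_sphere"
  shows "(f has_derivative real_part_form (base X f z ** null_form X f z)) (at z)"
proof -
  let ?D = "frechet_derivative f (at z)"
  have D: "(f has_derivative ?D) (at z)"
    using immersion_differentiable(1)[OF z] frechet_derivative_works by blast
  then have lin: "linear ?D" by (simp add: has_derivative_linear)
  have "((\<lambda>w. ctransp (f w)) has_derivative (\<lambda>v. ctransp (?D v))) (at z)"
    by (rule bounded_linear.has_derivative[OF bounded_linear_ctransp D])
  then have "(f has_derivative (\<lambda>v. ctransp (?D v))) (at z)"
    by (rule has_derivative_transform_within_open[OF _ open_punctured_sphere z]) (rule immersion_hermitian)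
  from has_derivative_unique[OF this D] have herm: "ctransp (?D v) = ?D v" for v by metis
  have K: "base X f z ** null_form X f z = smul (1/2) (?D 1 - smul \<i> (?D \<i>))"
    using base_facts(1)[where f = f, OF immersion_in_space[OF z]]
    by (simp add: null_form_def partial_def mult_adjugate_cancel matrix_mul_assoc smul_diff)
  have "real_part_form (base X f z ** null_form X f z) v = ?D v" for v
  proof -
    have "?D v = ?D (Re v *\<^sub>R 1 + Im v *\<^sub>R \<i>)"
      by (rule arg_cong[of _ _ ?D]) (simp add: complex_eq_iff)
    also have "\<dots> = smul (of_real (Re v)) (?D 1) + smul (of_real (Im v)) (?D \<i>)"
      by (simp only: linear_add[OF lin] linear_scale[OF lin] scaleR_smul)
    also have "\<dots> = real_part_form (base X f z ** null_form X f z) v"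
    proof -
      have h: "ctransp (?D 1) = ?D 1" "ctransp (?D \<i>) = ?D \<i>" by (rule herm)+
      have "real_part_form (smul (1/2) (E - smul \<i> F)) v = smul (of_real (Re v)) E + smul (of_real (Im v)) F"
        if E: "ctransp E = E" "ctransp F = F" for E F
      proof -
        have c: "v + cnj v = 2 * of_real (Re v)" "cnj v * \<i> - v * \<i> = 2 * of_real (Im v)"
          by (simp_all add: complex_eq_iff)
        have "real_part_form (smul (1/2) (E - smul \<i> F)) v
            = smul (v/2) (E - smul \<i> F) + smul (cnj v/2) (E + smul \<i> F)"
          by (simp add: real_part_form_def ctransp_linear smul_minus_left E)
        also have "\<dots> = smul ((v + cnj v) / 2) E + smul ((cnj v * \<i> - v * \<i>) / 2) F"
          by (simp add: cmat_eq_iff algebra_simps add_divide_distrib diff_divide_distrib)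
        finally show ?thesis unfolding c by simp
      qed
      from this[OF h] show ?thesis unfolding K by simp
    qed
    finally show ?thesis by simp
  qed
  then have "real_part_form (base X f z ** null_form X f z) = ?D" by blast
  with D show ?thesis by simp
qed

lemma partial_immersion:
  assumes z: "z \<in> punctured_sphere"
  shows "partial v f z = real_part_form (base X f z ** null_form X f z) v"
  unfolding partial_def using frechet_derivative_at[OF immersion_derivative[OF z]] by simp

lemma null_form_nonzero:
  assumes z: "z \<in> punctured_sphere"
  shows "null_form X f z \<noteq> 0"
proof
  assume "null_form X f z = 0"
  then have "partial 1 f z = partial 0 f z"
    by (simp add: partial_immersion[OF z] real_part_form_def)
  moreover have "inj (frechet_derivative f (at z))" using imm z by (auto simp: conformal_immersion_def)
  ultimately show False unfolding partial_def by (auto dest: injD)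
qed

lemma continuous_null_form: "continuous_on punctured_sphere (null_form X f)"
proof -
  have "continuous_on punctured_sphere (base X f)"
    using immersion_continuous(1) by (cases X) (auto simp: base_def[abs_def])
  then show ?thesis
    unfolding null_form_def[abs_def]
    by (intro continuous_mult continuous_on_diff continuous_on_const immersion_continuous)
qed

end

locale trinoid_frame = lwr_frame +
  fixes X :: ambient and f :: "complex \<Rightarrow> cmat" and q :: "puncture \<Rightarrow> complex"
  assumes trinoid: "trinoid_from X A B U p \<Phi> f q"
begin

lemma immersion: "conformal_immersion X f"
  using trinoid by (simp add: trinoid_from_def cmc_immersion_def)

abbreviation \<alpha> :: "complex \<Rightarrow> cmat" where "\<alpha> \<equiv> null_form X f"

definition sym_formula :: "complex \<Rightarrow> cmat" where
  "sym_formula u = deriv_mat (\<Phi> u) 0 ** adjugate (\<Phi> u 0)"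

definition frame_quotient :: "complex \<Rightarrow> cmat" where
  "frame_quotient u = \<Phi> u 1 ** adjugate (\<Phi> u 0)"

lemma f_frame:
  assumes "u \<in> reg"
  shows "X = Euclidean \<Longrightarrow> f (p u) = sym_formula u + ctransp (sym_formula u)"
    "X = Hyperbolic \<Longrightarrow> f (p u) = ctransp (frame_quotient u) ** frame_quotient u"
  using trinoid assms frame_facts(1)[OF assms]
  by (auto simp: trinoid_from_def sym_formula_def frame_quotient_def Let_def matrix_inv_eq_adjugate)

lemma sym_formula_mderiv: "u \<in> reg \<Longrightarrow> has_mderiv sym_formula (smul (deriv p u) (frame_form u)) u"
  using sym_formula_deriv by (simp add: sym_formula_def[abs_def])

lemma frame_quotient_mderiv: "u \<in> reg \<Longrightarrow> has_mderiv frame_quotient (smul (deriv p u) (frame_quotient u ** frame_form u)) u"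
  using frame_quotient_at[of u 1] by (simp add: frame_quotient_def[abs_def])

text \<open>
  For minimal surfaces this is the derivative of the Sym formula. For CMC 1 surfaces the quotient F of the
  frames at 1 and 0 satisfies dF = F frame_form dp, and f is the product of the adjoint of F with F.
\<close>

lemma null_form_frame:
  assumes u: "u \<in> reg"
  shows "\<alpha> (p u) = frame_form u"
proof -
  have pu: "p u \<in> punctured_sphere" using reg_imp_base[OF u] by (simp add: regular_base_def)
  obtain dp: "deriv p u \<noteq> 0" 
    using universal_cover_local_inverse[OF cov reg_imp_U[OF u]] by metis
  let ?P = "base X f (p u)"
  have 1: "((\<lambda>w. f (p w)) has_derivative (\<lambda>v. real_part_form (?P ** \<alpha> (p u)) (deriv p u * v))) (at u)"
    using has_derivative_compose[OF deriv_p[OF reg_imp_U[OF u], unfolded has_field_derivative_def]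
        immersion_derivative[OF immersion pu]] .
  have 2: "((\<lambda>w. f (p w)) has_derivative (\<lambda>v. real_part_form (smul (deriv p u) (?P ** frame_form u)) v)) (at u)"
  proof (cases X)
    case Euclidean
    have "((\<lambda>w. sym_formula w + ctransp (sym_formula w)) has_derivative
        (\<lambda>v. smul v (smul (deriv p u) (frame_form u)) + ctransp (smul v (smul (deriv p u) (frame_form u))))) (at u)"
      using sym_formula_mderiv[OF u, unfolded has_mderiv_def]
      by (intro has_derivative_add bounded_linear.has_derivative[OF bounded_linear_ctransp])
    then have "((\<lambda>w. f (p w)) has_derivative
        (\<lambda>v. smul v (smul (deriv p u) (frame_form u)) + ctransp (smul v (smul (deriv p u) (frame_form u))))) (at u)"
      by (rule has_derivative_transform_within_open[OF _ open_reg u]) (simp add: f_frame Euclidean)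
    then show ?thesis by (simp add: real_part_form_def base_def Euclidean)
  next
    case Hyperbolic
    have "((\<lambda>w. ctransp (frame_quotient w) ** frame_quotient w) has_derivative
        (\<lambda>v. ctransp (frame_quotient u) ** smul v (smul (deriv p u) (frame_quotient u ** frame_form u))
            + ctransp (smul v (smul (deriv p u) (frame_quotient u ** frame_form u))) ** frame_quotient u)) (at u)"
      using frame_quotient_mderiv[OF u, unfolded has_mderiv_def]
      by (intro mm.FDERIV bounded_linear.has_derivative[OF bounded_linear_ctransp])
    then have "((\<lambda>w. f (p w)) has_derivative
        (\<lambda>v. ctransp (frame_quotient u) ** smul v (smul (deriv p u) (frame_quotient u ** frame_form u))
            + ctransp (smul v (smul (deriv p u) (frame_quotient u ** frame_form u))) ** frame_quotient u)) (at u)"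
      by (rule has_derivative_transform_within_open[OF _ open_reg u]) (simp add: f_frame Hyperbolic)
    then show ?thesis
      by (simp add: real_part_form_def base_def Hyperbolic f_frame[OF u] matrix_mul_assoc)
  qed
  have "real_part_form (?P ** \<alpha> (p u)) (deriv p u * v) = real_part_form (smul (deriv p u) (?P ** frame_form u)) v" for v
    using has_derivative_unique[OF 1 2] by metis
  then have "real_part_form (smul (deriv p u) (?P ** \<alpha> (p u))) v = real_part_form (smul (deriv p u) (?P ** frame_form u)) v" for v
    by (simp add: real_part_form_def mult.commute)
  then have "smul (deriv p u) (?P ** \<alpha> (p u)) = smul (deriv p u) (?P ** frame_form u)"
    by (rule real_part_form_inject)
  then have "smul (inverse (deriv p u)) (adjugate ?P ** smul (deriv p u) (?P ** \<alpha> (p u)))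
     = smul (inverse (deriv p u)) (adjugate ?P ** smul (deriv p u) (?P ** frame_form u))" by simp
  then show ?thesis
    using dp base_facts(1)[where f = f, OF immersion_in_space[OF immersion pu]]
    by (simp add: matrix_mul_assoc mult_adjugate_cancel)
qed

text \<open>
  Off the poles of the potential the null form descends from the universal cover through local inverses of p.
  At a pole it is continuous because f is continuously differentiable, so the singularity is removable.
\<close>

lemma holo_null_form: "holo_mat \<alpha> punctured_sphere"
proof -
  have R: "\<exists>D. has_mderiv \<alpha> D z" if z: "z \<in> regular_base" for z
  proof -
    obtain u where u: "u \<in> reg" "p u = z" using z image_reg by (metis imageE)
    obtain V q where V: "open V" "u \<in> V" "V \<subseteq> U" "open (p ` V)" "inj_on p V"
      "q holomorphic_on (p ` V)" "\<And>v. v \<in> V \<Longrightarrow> q (p v) = v"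
      using universal_cover_local_inverse[OF cov reg_imp_U[OF u(1)]] by metis
    let ?V = "V \<inter> reg"
    have op: "open (p ` ?V)"
      by (rule open_mapping_thm3[of p ?V]) (use V U_facts open_reg in \<open>auto intro: holomorphic_on_subset inj_on_subset\<close>)
    have "(q has_field_derivative deriv q z) (at z)"
      using V(2,4,6) u(2) by (intro holomorphic_derivI[where S = "p ` V"]) auto
    moreover have "q z = u" using V u by auto
    moreover obtain D where "has_mderiv frame_form D u" using frame_form_deriv[OF u(1)] by blast
    ultimately have "has_mderiv (\<lambda>w. frame_form (q w)) (smul (deriv q z) D) z"
      by (intro has_mderiv_compose[where F = frame_form and g = q]) auto
    moreover have "frame_form (q w) = \<alpha> w" if "w \<in> p ` ?V" for w
      using that V(7) null_form_frame by auto
    ultimately show ?thesis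
      using has_mderiv_cong[OF _ op, of "\<lambda>w. frame_form (q w)"] u V(2) by blast
  qed
  show ?thesis
    unfolding holo_mat_def
  proof (intro allI)
    fix i j
    have holR: "(\<lambda>z. \<alpha> z $ i $ j) holomorphic_on regular_base"
      unfolding holomorphic_on_open[OF open_regular_base] using R unfolding has_mderiv_iff by meson
    have "\<exists>D. ((\<lambda>z. \<alpha> z $ i $ j) has_field_derivative D) (at z)" if z: "z \<in> punctured_sphere" for z
    proof -
      have "\<forall>\<^sub>F w in at z. w \<notin> poles A B"
        using sparse_poles z open_punctured_sphere by (simp add: sparse_in_eventually_iff)
      moreover have "\<forall>\<^sub>F w in at z. w \<in> punctured_sphere"
        using open_punctured_sphere z by (rule eventually_at_in_open')
      ultimately have "\<forall>\<^sub>F w in at z. w \<in> regular_base"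
        by eventually_elim (simp add: regular_base_def)
      then obtain r where r: "r > 0" "\<And>w. w \<in> ball z r - {z} \<Longrightarrow> w \<in> regular_base"
        unfolding eventually_at by (auto simp: dist_commute)
      have sub: "ball z r \<subseteq> punctured_sphere" using r(2) z unfolding regular_base_def by (metis Diff_iff singletonD subsetI)
      have "(\<lambda>z. \<alpha> z $ i $ j) holomorphic_on ball z r"
      proof (rule no_isolated_singularity[where K = "{z}"])
        show "continuous_on (ball z r) (\<lambda>z. \<alpha> z $ i $ j)"
          by (intro continuous_mult continuous_on_subset[OF continuous_null_form[OF immersion] sub])
        show "(\<lambda>z. \<alpha> z $ i $ j) holomorphic_on ball z r - {z}"
          by (rule holomorphic_on_subset[OF holR]) (use r(2) in blast)
      qed auto
      then show ?thesis using r by (auto simp: holomorphic_on_open)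
    qed
    then show "(\<lambda>z. \<alpha> z $ i $ j) holomorphic_on punctured_sphere"
      by (auto simp: holomorphic_on_open[OF open_punctured_sphere])
  qed
qed

text \<open>
  The poles are isolated, so identities between continuous functions extend across them.
\<close>

lemma continuous_extension:
  fixes F :: "complex \<Rightarrow> 'b::t2_space"
  assumes "continuous_on punctured_sphere F" "continuous_on punctured_sphere G"
    and "\<And>w. w \<in> regular_base \<Longrightarrow> F w = G w" and z: "z \<in> punctured_sphere"
  shows "F z = G z"
proof -
  have F: "(F \<longlongrightarrow> F z) (at z)" "(G \<longlongrightarrow> G z) (at z)"
    using assms open_punctured_sphere by (auto simp: continuous_on_eq_continuous_at isCont_def)
  have "\<forall>\<^sub>F w in at z. w \<notin> poles A B"
    using sparse_poles z open_punctured_sphere by (simp add: sparse_in_eventually_iff)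
  moreover have "\<forall>\<^sub>F w in at z. w \<in> punctured_sphere"
    using open_punctured_sphere z by (rule eventually_at_in_open')
  ultimately have "\<forall>\<^sub>F w in at z. F w = G w"
    by eventually_elim (simp add: regular_base_def assms(3))
  with F(1) have "(G \<longlongrightarrow> F z) (at z)" using tendsto_cong by blast
  with F(2) show ?thesis using tendsto_unique[of "at z"] by simp
qed

lemma null_form_nilpotent:
  assumes "z \<in> punctured_sphere"
  shows "\<alpha> z ** \<alpha> z = 0" "trace (\<alpha> z) = 0"
proof -
  have R: "\<alpha> z ** \<alpha> z = 0" "trace (\<alpha> z) = 0" if z: "z \<in> regular_base" for z
  proof -
    obtain u where u: "u \<in> reg" "p u = z" using z image_reg by (metis imageE)
    have d: "det (\<Phi> u 0) = 1" by (rule frame_facts(1)[OF u(1)])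
    have a: "\<alpha> z = \<Phi> u 0 ** A z ** adjugate (\<Phi> u 0)"
      using null_form_frame[OF u(1)] u(2) by (simp add: frame_form_def)
    have "\<alpha> z ** \<alpha> z = \<Phi> u 0 ** (A z ** A z) ** adjugate (\<Phi> u 0)"
      unfolding a by (simp add: matrix_mul_assoc mult_adjugate_cancel[OF d])
    then show "\<alpha> z ** \<alpha> z = 0" using potential_regular[OF z] by simp
    have "trace (\<alpha> z) = trace (adjugate (\<Phi> u 0) ** (\<Phi> u 0 ** A z))"
      unfolding a by (rule trace_commute)
    then show "trace (\<alpha> z) = 0"
      using potential_regular[OF z] by (simp add: matrix_mul_assoc mult_adjugate_cancel[OF d])
  qed
  note c = continuous_null_form[OF immersion]
  show "\<alpha> z ** \<alpha> z = 0"
    by (rule continuous_extension[OF _ _ R(1) assms]) (intro continuous_mult c continuous_on_const)+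
  have "continuous_on punctured_sphere (\<lambda>z. trace (\<alpha> z))"
    unfolding trace_entry by (intro continuous_intros continuous_mult c)
  then show "trace (\<alpha> z) = 0"
    by (rule continuous_extension[OF _ continuous_on_const R(2) assms])
qed

end

section \<open>Null forms on the three-punctured sphere\<close>

text \<open>
  The coefficient of the Hopf differential. Equivalently, its negative is the eigenvalue of the derivative on the kernel
  of \<alpha> z, which is also the image of \<alpha> z.
\<close>

definition hopf :: "(complex \<Rightarrow> cmat) \<Rightarrow> complex \<Rightarrow> complex" where
  "hopf \<alpha> z = (THE Q. \<alpha> z ** deriv_mat \<alpha> z = smul Q (\<alpha> z))"

text \<open>
  If N is nilpotent and anticommutes with D, then D maps the kernel of N into itself; so N D vanishes there and has its
  image there as well, and N itself is the only such matrix up to scalars.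
\<close>

lemma nilpotent_square_scalar:
  assumes "N ** N = 0" "trace N = 0" "N \<noteq> 0" "N ** D + D ** N = 0" "trace D = 0"
  shows "\<exists>Q. N ** D = smul Q N"
proof -
  define a b c where abc: "a = N$1$1" "b = N$1$2" "c = N$2$1"
  have N: "N$1$1 = a" "N$1$2 = b" "N$2$1 = c" "N$2$2 = - a"
    using assms(2) by (auto simp: trace_entry add_eq_0_iff abc)
  define a' b' c' where abc': "a' = D$1$1" "b' = D$1$2" "c' = D$2$1"
  have D: "D$1$1 = a'" "D$1$2 = b'" "D$2$1 = c'" "D$2$2 = - a'"
    using assms(5) by (auto simp: trace_entry add_eq_0_iff abc')
  have sq: "a * a + b * c = 0" using assms(1) by (simp add: cmat_expand N)
  have lin: "2 * a * a' + b * c' + b' * c = 0" using assms(4) by (simp add: cmat_expand N D algebra_simps)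
  show ?thesis
  proof (cases "b = 0")
    case False
    define Q where "Q = (a * b' - b * a') / b"
    have Q: "Q * b = a * b' - b * a'" using False by (simp add: Q_def)
    have "b * (a * a' + b * c' - Q * a) = 0" "b * (c * a' - a * c' - Q * c) = 0" "b * (c * b' + a * a' + Q * a) = 0"
      using sq lin Q by algebra+
    with False have "a * a' + b * c' = Q * a" "c * a' - a * c' = Q * c" "c * b' + a * a' = - (Q * a)"
      by (auto simp: add_eq_0_iff2)
    then show ?thesis using Q by (intro exI[of _ Q]) (simp add: cmat_expand N D algebra_simps)
  next
    case True
    have a: "a = 0" using sq True by simp
    have c: "c \<noteq> 0" using assms(3) True a by (auto simp: cmat_eq_iff N)
    show ?thesis using lin by (intro exI[of _ a']) (auto simp: cmat_expand N D True a c algebra_simps)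
  qed
qed

definition null_curve :: "(complex \<Rightarrow> cmat) \<Rightarrow> bool" where
  "null_curve \<alpha> \<longleftrightarrow> holo_mat \<alpha> punctured_sphere \<and>
     (\<forall>z\<in>punctured_sphere. \<alpha> z ** \<alpha> z = 0 \<and> trace (\<alpha> z) = 0 \<and> \<alpha> z \<noteq> 0)"

lemma null_curve_deriv:
  assumes "null_curve \<alpha>" "z \<in> punctured_sphere"
  shows "has_mderiv \<alpha> (deriv_mat \<alpha> z) z"
  using assms holo_mat_has_mderiv open_punctured_sphere by (auto simp: null_curve_def)

lemma smul_cancel: "smul a N = smul b N \<longleftrightarrow> a = b \<or> N = 0"
  by (auto simp: cmat_eq_iff)

lemma hopf_unique:
  assumes "null_curve \<alpha>" "z \<in> punctured_sphere" "\<alpha> z ** deriv_mat \<alpha> z = smul Q (\<alpha> z)"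
  shows "hopf \<alpha> z = Q"
  unfolding hopf_def using assms by (intro the_equality) (auto simp: null_curve_def smul_cancel)

lemma null_curve_hopf:
  assumes "null_curve \<alpha>" "z \<in> punctured_sphere"
  shows "\<alpha> z ** deriv_mat \<alpha> z = smul (hopf \<alpha> z) (\<alpha> z)"
    "deriv_mat \<alpha> z ** \<alpha> z = smul (- hopf \<alpha> z) (\<alpha> z)" "trace (deriv_mat \<alpha> z) = 0"
proof -
  have \<alpha>: "\<alpha> w ** \<alpha> w = 0" "trace (\<alpha> w) = 0" "\<alpha> w \<noteq> 0" if "w \<in> punctured_sphere" for w
    using assms that by (auto simp: null_curve_def)
  let ?D = "deriv_mat \<alpha> z"
  have D: "has_mderiv \<alpha> ?D z" using assms by (rule null_curve_deriv)
  have "has_mderiv (\<lambda>w. \<alpha> w ** \<alpha> w) (\<alpha> z ** ?D + ?D ** \<alpha> z) z"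
    using D by (intro has_mderiv_mult)
  moreover have "has_mderiv (\<lambda>w. \<alpha> w ** \<alpha> w) 0 z"
    by (rule has_mderiv_cong[OF has_mderiv_const[of 0] open_punctured_sphere assms(2)]) (simp add: \<alpha>)
  ultimately have anti: "\<alpha> z ** ?D + ?D ** \<alpha> z = 0" by (rule has_mderiv_unique)
  have "((\<lambda>w. \<alpha> w $ 1 $ 1 + \<alpha> w $ 2 $ 2) has_field_derivative ?D $ 1 $ 1 + ?D $ 2 $ 2) (at z)"
    using D by (auto simp: has_mderiv_iff intro!: derivative_intros)
  then have "((\<lambda>w. 0) has_field_derivative ?D $ 1 $ 1 + ?D $ 2 $ 2) (at z)"
    by (rule has_field_derivative_transform_within_open[OF _ open_punctured_sphere assms(2)])
      (use \<alpha>(2) in \<open>simp add: trace_entry\<close>)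
  then have tr: "trace ?D = 0" using DERIV_unique[OF _ DERIV_const] by (auto simp: trace_entry)
  show "trace ?D = 0" by fact
  obtain Q where "\<alpha> z ** ?D = smul Q (\<alpha> z)"
    using nilpotent_square_scalar[OF \<alpha>[OF assms(2)] anti tr] by auto
  with hopf_unique[OF assms this] show *: "\<alpha> z ** ?D = smul (hopf \<alpha> z) (\<alpha> z)" by simp
  show "?D ** \<alpha> z = smul (- hopf \<alpha> z) (\<alpha> z)"
    using anti unfolding * by (simp add: smul_minus_left add_eq_0_iff)
qed

text \<open>
  The properties of the null form at a puncture of weight q, in the local coordinate w of the puncture: at most
  a double pole, and the Hopf differential has a double pole with leading coefficient q. The null
  form transforms like a differential and the Hopf coefficient like a quadratic differential.
\<close>

definition weighted_end :: "(complex \<Rightarrow> cmat) \<Rightarrow> puncture \<Rightarrow> complex \<Rightarrow> bool" where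
  "weighted_end \<alpha> k q \<longleftrightarrow>
     (\<exists>C. \<forall>\<^sub>F w in at 0. norm (smul (deriv (chart k) w) (\<alpha> (chart k w))) \<le> C / norm w ^ 2) \<and>
     ((\<lambda>w. w\<^sup>2 * (deriv (chart k) w)\<^sup>2 * hopf \<alpha> (chart k w)) \<longlongrightarrow> q) (at 0)"

lemma deriv_chart:
  "deriv (chart P0) w = 1" "deriv (chart P1) w = 1" "w \<noteq> 0 \<Longrightarrow> deriv (chart PInf) w = - (1 / w\<^sup>2)"
proof -
  have "chart P0 = (\<lambda>w. w)" "chart P1 = (\<lambda>w. 1 + w)" "chart PInf = (\<lambda>w. 1 / w)" by auto
  then show "deriv (chart P0) w = 1" "deriv (chart P1) w = 1" "w \<noteq> 0 \<Longrightarrow> deriv (chart PInf) w = - (1 / w\<^sup>2)"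
    by (auto intro!: DERIV_imp_deriv derivative_eq_intros simp: power2_eq_square)
qed

text \<open>
  Removing one root of b at a time: a root of b is a root of a, and either it is also a root of c and goes
  into the common factor e, or it is a double root of b and goes into s.
\<close>

lemma square_eq_mult_factorization:
  fixes a b c :: "complex poly"
  assumes "a\<^sup>2 = b * c"
  shows "\<exists>e s t. b = e * s\<^sup>2 \<and> c = e * t\<^sup>2 \<and> a = e * s * t"
  using assms
proof (induction "degree b" arbitrary: a b c rule: less_induct)
  case less
  show ?case
  proof (cases "degree b = 0")
    case True
    then obtain k where k: "b = [:k:]" by (metis degree_eq_zeroE)
    show ?thesis
    proof (cases "k = 0")
      case True
      with less.prems k have "a = 0" by simp
      then show ?thesis using True k by (intro exI[of _ c] exI[of _ 0] exI[of _ 1]) simp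
    next
      case False
      have "b * (smult (1/k) a)\<^sup>2 = smult (1/k) (a\<^sup>2)" 
        using False by (simp add: k power2_eq_square)
      also have "\<dots> = c" using less.prems False by (simp add: k)
      finally have "c = b * (smult (1/k) a)\<^sup>2" ..
      moreover have "a = b * 1 * smult (1/k) a" using False by (simp add: k)
      ultimately show ?thesis by (intro exI[of _ b] exI[of _ 1] exI[of _ "smult (1/k) a"]) simp
    qed
  next
    case False
    then obtain x where x: "poly b x = 0"
      using alg_closed_imp_poly_has_root[of b] by auto
    let ?L = "[:-x, 1:]"
    have L: "?L \<noteq> 0" by simp
    obtain b' where b': "b = ?L * b'" using x by (auto simp: poly_eq_0_iff_dvd)
    have b0: "b' \<noteq> 0" using False b' by auto
    then have db': "degree b' < degree b" unfolding b' by (subst degree_mult_eq) auto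
    have "poly (a\<^sup>2) x = 0" using x less.prems by simp
    then obtain a' where a': "a = ?L * a'" by (auto simp: poly_eq_0_iff_dvd)
    have "?L * (?L * a'\<^sup>2) = ?L * (b' * c)"
      using less.prems unfolding a' b' by (simp only: power2_eq_square mult_ac)
    then have eq: "?L * a'\<^sup>2 = b' * c" using L by (simp only: mult_left_cancel[OF L])
    show ?thesis
    proof (cases "poly c x = 0")
      case True
      then obtain c' where c': "c = ?L * c'" by (auto simp: poly_eq_0_iff_dvd)
      have "?L * a'\<^sup>2 = ?L * (b' * c')" using eq unfolding c' by (simp only: mult_ac)
      then have "a'\<^sup>2 = b' * c'" by (simp only: mult_left_cancel[OF L])
      from less.hyps[OF db' this] obtain e s t where "b' = e * s\<^sup>2" "c' = e * t\<^sup>2" "a' = e * s * t" by auto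
      then show ?thesis unfolding a' b' c'
        by (intro exI[of _ "?L * e"] exI[of _ s] exI[of _ t]) (simp only: mult_ac)
    next
      case False
      have "poly (?L * a'\<^sup>2) x = 0" by simp
      with False have "poly b' x = 0" unfolding eq by simp
      then obtain b'' where b'': "b' = ?L * b''" by (auto simp: poly_eq_0_iff_dvd)
      have "b'' \<noteq> 0" using b0 b'' by auto
      then have "degree b'' < degree b'" unfolding b'' by (subst degree_mult_eq) auto
      then have d: "degree b'' < degree b" using db' by simp
      have "?L * a'\<^sup>2 = ?L * (b'' * c)" using eq unfolding b'' by (simp only: mult_ac)
      then have "a'\<^sup>2 = b'' * c" by (simp only: mult_left_cancel[OF L])
      from less.hyps[OF d this] obtain e s t where "b'' = e * s\<^sup>2" "c = e * t\<^sup>2" "a' = e * s * t" by auto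
      then show ?thesis unfolding a' b' b''
        by (intro exI[of _ e] exI[of _ "?L * s"] exI[of _ t]) (simp only: mult_ac power2_eq_square)
    qed
  qed
qed

text \<open>
  The nilpotent matrix that a spinor (a, b) determines: the vector times its symplectic dual.
\<close>

definition spin :: "complex \<Rightarrow> complex \<Rightarrow> cmat" where
  "spin a b = vector [vector [- (a * b), a\<^sup>2], vector [- b\<^sup>2, a * b]]"

lemma spin_entry [simp]:
  "spin a b $ 1 $ 1 = - (a * b)" "spin a b $ 1 $ 2 = a\<^sup>2" "spin a b $ 2 $ 1 = - b\<^sup>2" "spin a b $ 2 $ 2 = a * b"
  by (simp_all add: spin_def)

lemma spin_transform:
  "spin (S$1$1 * a + S$1$2 * b) (S$2$1 * a + S$2$2 * b) = S ** spin a b ** adjugate S"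
  by (simp add: cmat_expand power2_eq_square algebra_simps)

text \<open>
  Derivatives of the factor c drop out because the square of the spinor matrix vanishes; what remains is the
  Wronskian of the spinor.
\<close>

lemma rational_null_curve_hopf:
  fixes s t :: "complex poly"
  assumes "null_curve \<alpha>" and z: "z \<in> punctured_sphere"
    and c: "\<And>z. z \<in> punctured_sphere \<Longrightarrow> (c has_field_derivative c' z) (at z)"
    and eq: "\<And>z. z \<in> punctured_sphere \<Longrightarrow> \<alpha> z = smul (c z) (spin (poly s z) (poly t z))"
  shows "hopf \<alpha> z = c z * (poly s z * poly (pderiv t) z - poly (pderiv s) z * poly t z)"
proof (rule hopf_unique[OF assms(1) z])
  let ?a = "poly s z" and ?b = "poly t z" and ?a' = "poly (pderiv s) z" and ?b' = "poly (pderiv t) z"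
  define N where "N = spin ?a ?b"
  define D where "D = (vector [vector [- (?a * ?b' + ?a' * ?b), 2 * ?a * ?a'], vector [- (2 * ?b * ?b'), ?a * ?b' + ?a' * ?b]] :: cmat)"
  have "has_mderiv (\<lambda>z. spin (poly s z) (poly t z)) D z"
    unfolding has_mderiv_iff forall_2 D_def spin_entry vector_2
    by (auto intro!: derivative_eq_intros poly_DERIV simp: algebra_simps)
  then have "has_mderiv (\<lambda>z. smul (c z) (spin (poly s z) (poly t z))) (smul (c z) D + smul (c' z) N) z"
    unfolding N_def by (intro has_mderiv_smul c z)
  then have "has_mderiv \<alpha> (smul (c z) D + smul (c' z) N) z"
    by (rule has_mderiv_cong[OF _ open_punctured_sphere z]) (simp add: eq)
  then have d: "deriv_mat \<alpha> z = smul (c z) D + smul (c' z) N" by (rule has_mderiv_deriv_mat)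
  have NN: "N ** N = 0" by (simp add: N_def cmat_expand power2_eq_square)
  have ND: "N ** D = smul (?a * ?b' - ?a' * ?b) N"
    by (simp add: N_def D_def cmat_expand power2_eq_square algebra_simps)
  show "\<alpha> z ** deriv_mat \<alpha> z = smul (c z * (?a * ?b' - ?a' * ?b)) (\<alpha> z)"
    unfolding d eq[OF z] N_def[symmetric] by (simp add: mm.add_right NN ND mult_ac)
qed


lemma infinite_punctured_sphere: "infinite punctured_sphere"
  unfolding punctured_sphere_def using infinite_UNIV_char_0 finite_Diff2[of "{0, 1 :: complex}" UNIV]
  by (simp add: Compl_eq_Diff_UNIV)

lemma poly_eq_on_punctured_sphere:
  fixes P Q :: "complex poly"
  assumes "\<And>z. z \<in> punctured_sphere \<Longrightarrow> poly P z = poly Q z"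
  shows "P = Q"
proof (rule ccontr)
  assume "P \<noteq> Q"
  then have "finite {z. poly (P - Q) z = 0}" by (intro poly_roots_finite) simp
  moreover have "punctured_sphere \<subseteq> {z. poly (P - Q) z = 0}" using assms by auto
  ultimately show False using infinite_punctured_sphere finite_subset by blast
qed

text \<open>
  Bounded singularities are removable, and an entire function of polynomial growth is a polynomial.
\<close>

lemma polynomial_extension:
  fixes h :: "complex \<Rightarrow> complex"
  assumes h: "h holomorphic_on punctured_sphere"
    and b0: "\<forall>\<^sub>F w in at 0. norm (h w) \<le> B0" and b1: "\<forall>\<^sub>F w in at 1. norm (h w) \<le> B1"
    and binf: "\<And>z. norm z \<ge> r \<Longrightarrow> norm (h z) \<le> B * norm z ^ n"
  shows "\<exists>P. degree P \<le> n \<and> (\<forall>z\<in>punctured_sphere. h z = poly P z)"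
proof -
  have "- {0, 1} = - {1} - {0 :: complex}" by auto
  then have 0: "h holomorphic_on (- {1}) - {0}" "0 \<in> interior (- {1 :: complex})"
    using h by (auto simp: punctured_sphere_def open_Compl interior_open[of "- {1}"])
  obtain g where g: "g holomorphic_on - {1}" "\<And>z. z \<in> (- {1}) - {0} \<Longrightarrow> g z = h z"
    using holomorphic_on_extend_bounded[OF 0] b0 by blast
  have 1: "g holomorphic_on UNIV - {1}" "1 \<in> interior (UNIV :: complex set)"
    using g(1) by (auto simp: Compl_eq_Diff_UNIV)
  have "\<forall>\<^sub>F w in at 1. w \<noteq> (1 :: complex) \<and> w \<noteq> 0"
    by (intro eventually_conj eventually_at_in_open'[of "- {0}" 1, simplified]) (auto simp: eventually_at_filter open_Compl)
  with b1 have "\<forall>\<^sub>F w in at 1. norm (g w) \<le> B1"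
    by eventually_elim (use g(2) in auto)
  then obtain k where k: "k holomorphic_on UNIV" "\<And>z. z \<in> UNIV - {1} \<Longrightarrow> k z = g z"
    using holomorphic_on_extend_bounded[OF 1] by blast
  have kh: "k z = h z" if "z \<in> punctured_sphere" for z
    using that k(2)[of z] g(2)[of z] by (auto simp: punctured_sphere_def)
  have "norm (k z) \<le> B * norm z ^ n" if "norm z \<ge> max r 2" for z
  proof -
    have "z \<noteq> 0" "z \<noteq> 1" using that by auto
    then show ?thesis using binf[of z] kh[of z] that by (simp add: punctured_sphere_def)
  qed
  from Liouville_polynomial[OF k(1) this]
  have k': "k z = (\<Sum>i\<le>n. (deriv ^^ i) k 0 / fact i * z ^ i)" for z .
  define P where "P = (\<Sum>i\<le>n. monom ((deriv ^^ i) k 0 / fact i) i)"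
  have "degree P \<le> n"
    unfolding P_def by (intro degree_sum_le) (auto intro: order_trans[OF degree_monom_le])
  moreover have "poly P z = k z" for z by (simp add: P_def poly_sum poly_monom k')
  ultimately show ?thesis using kh by metis
qed

lemma limit_at_0_unique:
  "(f \<longlongrightarrow> a) (at 0) \<Longrightarrow> (f \<longlongrightarrow> b) (at 0) \<Longrightarrow> a = b" for f :: "complex \<Rightarrow> complex"
  by (rule tendsto_unique[OF at_neq_bot])

lemma poly_degree_2:
  fixes s :: "complex poly"
  assumes "degree s \<le> 2"
  obtains a b c where "s = [:a, b, c:]"
proof -
  have "s = [:coeff s 0, coeff s 1, coeff s 2:]"
    using assms by (intro poly_eqI) (auto simp: coeff_pCons coeff_eq_0 numeral_2_eq_2 split: nat.splits)
  then show thesis by (rule that)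
qed

lemma punctured_sphere_iff: "z \<in> punctured_sphere \<longleftrightarrow> z \<noteq> 0 \<and> z \<noteq> 1"
  by (auto simp: punctured_sphere_def)

lemma eventually_chart_in_sphere: "\<forall>\<^sub>F w in at 0. chart k w \<in> punctured_sphere"
proof -
  have "\<forall>\<^sub>F w in at 0. w \<in> ball 0 1 - {0 :: complex}"
    by (rule eventually_at_in_open) auto
  then show ?thesis
    by eventually_elim (cases k; auto simp: punctured_sphere_iff add_eq_0_iff)
qed

text \<open>
  Double poles at 0 and 1 are cancelled by the factor. In the coordinate 1/z a double pole of the differential
  at infinity means that \<alpha> stays bounded, so the product grows like the fourth power of z.
\<close>

lemma weighted_null_curve_polynomial_entry:
  assumes \<alpha>: "null_curve \<alpha>" and ends: "\<And>k. weighted_end \<alpha> k (q k)"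
  shows "\<exists>P. degree P \<le> 4 \<and> (\<forall>z\<in>punctured_sphere. z\<^sup>2 * (z - 1)\<^sup>2 * \<alpha> z $ i $ j = poly P z)"
proof -
  have bound: "\<exists>C. \<forall>\<^sub>F w in at 0. norm (deriv (chart k) w) * norm (\<alpha> (chart k w) $ i $ j) * norm w ^ 2 \<le> C" for k
  proof -
    obtain C where "\<forall>\<^sub>F w in at 0. norm (smul (deriv (chart k) w) (\<alpha> (chart k w))) \<le> C / norm w ^ 2"
      using ends[of k] by (auto simp: weighted_end_def)
    moreover have "\<forall>\<^sub>F w in at (0::complex). w \<noteq> 0" by (simp add: eventually_at_filter)
    ultimately have "\<forall>\<^sub>F w in at 0. norm (deriv (chart k) w) * norm (\<alpha> (chart k w) $ i $ j) * norm w ^ 2 \<le> C"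
    proof eventually_elim
      case (elim w)
      have "norm (deriv (chart k) w) * norm (\<alpha> (chart k w) $ i $ j) \<le> C / norm w ^ 2"
        using order_trans[OF norm_entry_le[of "smul (deriv (chart k) w) (\<alpha> (chart k w))" i j] elim(1)]
        by (simp add: norm_mult)
      with elim(2) show ?case by (simp add: field_simps)
    qed
    then show ?thesis by blast
  qed
  have hol: "(\<lambda>z. z\<^sup>2 * (z - 1)\<^sup>2 * \<alpha> z $ i $ j) holomorphic_on punctured_sphere"
    using \<alpha> by (auto simp: null_curve_def holo_mat_def intro!: holomorphic_intros)
  have near: "norm (w - 1) \<le> 2" "norm (w + 1) \<le> 2" if "w \<in> ball 0 1 - {0}" for w :: complex
    using that norm_triangle_ineq4[of w 1] norm_triangle_ineq[of w 1] by auto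
  have ball: "\<forall>\<^sub>F w in at 0. w \<in> ball 0 1 - {0 :: complex}"
    by (rule eventually_at_in_open) auto
  obtain C0 where C0: "\<forall>\<^sub>F w in at 0. norm (deriv (chart P0) w) * norm (\<alpha> (chart P0 w) $ i $ j) * norm w ^ 2 \<le> C0"
    using bound by blast
  have b0: "\<forall>\<^sub>F w in at 0. norm (w\<^sup>2 * (w - 1)\<^sup>2 * \<alpha> w $ i $ j) \<le> C0 * 2\<^sup>2"
    using C0 ball
  proof eventually_elim
    case (elim w)
    have "norm (w\<^sup>2 * (w - 1)\<^sup>2 * \<alpha> w $ i $ j) = (norm (\<alpha> w $ i $ j) * norm w ^ 2) * norm (w - 1) ^ 2"
      by (simp add: norm_mult norm_power)
    also have "\<dots> \<le> C0 * 2\<^sup>2"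
      using elim near[of w] by (intro mult_mono power_mono) (auto simp: deriv_chart intro: order_trans[rotated])
    finally show ?case .
  qed
  obtain C1 where C1: "\<forall>\<^sub>F w in at 0. norm (deriv (chart P1) w) * norm (\<alpha> (chart P1 w) $ i $ j) * norm w ^ 2 \<le> C1"
    using bound by blast
  have "\<forall>\<^sub>F w in at 0. norm ((w + 1)\<^sup>2 * w\<^sup>2 * \<alpha> (w + 1) $ i $ j) \<le> C1 * 2\<^sup>2"
    using C1 ball
  proof eventually_elim
    case (elim w)
    have "norm ((w + 1)\<^sup>2 * w\<^sup>2 * \<alpha> (w + 1) $ i $ j) = (norm (\<alpha> (1 + w) $ i $ j) * norm w ^ 2) * norm (w + 1) ^ 2"
      by (simp add: norm_mult norm_power add.commute)
    also have "\<dots> \<le> C1 * 2\<^sup>2"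
      using elim near[of w] by (intro mult_mono power_mono) (auto simp: deriv_chart intro: order_trans[rotated])
    finally show ?case .
  qed
  then have b1: "\<forall>\<^sub>F w in at 1. norm (w\<^sup>2 * (w - 1)\<^sup>2 * \<alpha> w $ i $ j) \<le> C1 * 2\<^sup>2"
    by (subst at_to_0) (simp add: eventually_filtermap)
  obtain C where C: "\<forall>\<^sub>F w in at 0. norm (deriv (chart PInf) w) * norm (\<alpha> (chart PInf w) $ i $ j) * norm w ^ 2 \<le> C"
    using bound by blast
  then obtain d where d: "d > 0" "\<And>w. w \<noteq> 0 \<Longrightarrow> norm w < d \<Longrightarrow> norm (deriv (chart PInf) w) * norm (\<alpha> (chart PInf w) $ i $ j) * norm w ^ 2 \<le> C"
    unfolding eventually_at by (auto simp: dist_norm)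
  have binf: "norm (z\<^sup>2 * (z - 1)\<^sup>2 * \<alpha> z $ i $ j) \<le> (2\<^sup>2 * C) * norm z ^ 4" if z: "norm z \<ge> max 1 (2/d)" for z
  proof -
    have z1: "norm z \<ge> 1" "norm z \<ge> 2/d" using z by auto
    then have z0: "z \<noteq> 0" by auto
    have "norm (1 / z) < d" using z1 d(1) z0 by (simp add: norm_divide field_simps)
    then have "norm (\<alpha> z $ i $ j) \<le> C"
      using d(2)[of "1 / z"] z0 by (simp add: deriv_chart norm_divide norm_power power_divide)
    moreover have "norm (z - 1) \<le> 2 * norm z" using norm_triangle_ineq4[of z 1] z1 by simp
    then have "norm (z - 1) ^ 2 \<le> (2 * norm z)\<^sup>2" by (rule power_mono) simp
    ultimately have "norm z ^ 2 * norm (z - 1) ^ 2 * norm (\<alpha> z $ i $ j) \<le> norm z ^ 2 * (2 * norm z)\<^sup>2 * C"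
      by (intro mult_mono) auto
    also have "\<dots> = (2\<^sup>2 * C) * norm z ^ 4" by (simp add: power_mult_distrib power2_eq_square power4_eq_xxxx)
    finally show ?thesis by (simp add: norm_mult norm_power)
  qed
  show ?thesis using polynomial_extension[OF hol b0 b1 binf] .
qed

text \<open>
  The entries of the polynomial matrix satisfy the square relation of a nilpotent matrix, so
  it is a common factor e times the matrix of a polynomial spinor. The factor e has no zeros: at 0 and 1 because
  the weights there do not vanish, elsewhere because \<alpha> does not vanish. So e is constant and can be absorbed into the spinor, whose
  components have degree at most 2. The three equations compare the Wronskian with the Hopf
  differential at the three punctures.
\<close>

proposition weighted_null_curve_spinor:
  assumes \<alpha>: "null_curve \<alpha>" and ends: "\<And>k. weighted_end \<alpha> k (q k)" and q: "\<And>k. q k \<noteq> 0"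
  obtains a0 a1 a2 b0 b1 b2 where
    "\<And>z. z \<in> punctured_sphere \<Longrightarrow>
       \<alpha> z = smul (1 / (z\<^sup>2 * (z - 1)\<^sup>2)) (spin (a0 + a1 * z + a2 * z\<^sup>2) (b0 + b1 * z + b2 * z\<^sup>2))"
    "a0 * b1 - a1 * b0 = q P0" "a1 * b2 - a2 * b1 = q PInf"
    "(a0 * b1 - a1 * b0) + 2 * (a0 * b2 - a2 * b0) + (a1 * b2 - a2 * b1) = q P1"
proof -
  have nil: "\<alpha> z ** \<alpha> z = 0" "trace (\<alpha> z) = 0" "\<alpha> z \<noteq> 0" if "z \<in> punctured_sphere" for z
    using \<alpha> that by (auto simp: null_curve_def)
  have "\<forall>i j. \<exists>P. degree P \<le> 4 \<and> (\<forall>z\<in>punctured_sphere. z\<^sup>2 * (z - 1)\<^sup>2 * \<alpha> z $ i $ j = poly P z)"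
    using weighted_null_curve_polynomial_entry[OF \<alpha> ends] by blast
  then obtain P where P: "\<And>i j. degree (P i j) \<le> 4"
    "\<And>i j z. z \<in> punctured_sphere \<Longrightarrow> z\<^sup>2 * (z - 1)\<^sup>2 * \<alpha> z $ i $ j = poly (P i j) z"
    by metis
  have "(P 2 2)\<^sup>2 = P 1 2 * (- P 2 1)"
  proof (rule poly_eq_on_punctured_sphere)
    fix z assume z: "z \<in> punctured_sphere"
    have "\<alpha> z $ 2 $ 1 * \<alpha> z $ 1 $ 2 + \<alpha> z $ 2 $ 2 * \<alpha> z $ 2 $ 2 = 0"
      using nil(1)[OF z] by (simp add: cmat_expand)
    then show "poly ((P 2 2)\<^sup>2) z = poly (P 1 2 * (- P 2 1)) z"
      by (simp add: P(2)[OF z, symmetric]) algebra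
  qed
  then obtain e s0 t0 where est: "P 1 2 = e * s0\<^sup>2" "- P 2 1 = e * t0\<^sup>2" "P 2 2 = e * s0 * t0"
    using square_eq_mult_factorization by blast
  define c where "c z = 1 / (z\<^sup>2 * (z - 1)\<^sup>2)" for z :: complex
  define c' where "c' z = deriv c z" for z
  have c: "(c has_field_derivative c' z) (at z)" if "z \<in> punctured_sphere" for z
  proof -
    have "c holomorphic_on punctured_sphere"
      unfolding c_def[abs_def] by (auto intro!: holomorphic_intros simp: punctured_sphere_iff)
    then show ?thesis unfolding c'_def using holomorphic_derivI[OF _ open_punctured_sphere that] by blast
  qed
  have P21: "P 2 1 = - (e * t0\<^sup>2)" using est(2) by (metis minus_minus)
  have \<alpha>0: "\<alpha> z = smul (c z * poly e z) (spin (poly s0 z) (poly t0 z))" if z: "z \<in> punctured_sphere" for z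
  proof -
    have z0: "z \<noteq> 0" "z - 1 \<noteq> 0" using z by (auto simp: punctured_sphere_iff)
    have "\<alpha> z $ i $ j = c z * poly (P i j) z" for i j
      using P(2)[OF z, of i j] z0 by (simp add: c_def field_simps)
    moreover have "\<alpha> z $ 1 $ 1 = - \<alpha> z $ 2 $ 2" using nil(2)[OF z] by (simp add: trace_entry add_eq_0_iff)
    ultimately show ?thesis by (simp add: cmat_eq_iff est(1,3) P21)
  qed
  define w0 where "w0 = s0 * pderiv t0 - pderiv s0 * t0"
  have H0: "hopf \<alpha> z = c z * poly e z * poly w0 z" if z: "z \<in> punctured_sphere" for z
  proof -
    have "hopf \<alpha> z = c z * poly e z * (poly s0 z * poly (pderiv t0) z - poly (pderiv s0) z * poly t0 z)"
      by (rule rational_null_curve_hopf[OF \<alpha> z _ \<alpha>0, where c' = "\<lambda>z. c' z * poly e z + c z * poly (pderiv e) z"])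
        (auto intro!: derivative_eq_intros c poly_DERIV)
    then show ?thesis by (simp add: w0_def)
  qed
  have limit: "G 0 = q k" if G: "isCont G 0"
    and eq: "\<And>w. w \<noteq> 0 \<Longrightarrow> chart k w \<in> punctured_sphere \<Longrightarrow>
      w\<^sup>2 * (deriv (chart k) w)\<^sup>2 * hopf \<alpha> (chart k w) = G w" for G k
  proof (rule limit_at_0_unique)
    show "(G \<longlongrightarrow> G 0) (at 0)" using G by (simp add: isCont_def)
    show "(G \<longlongrightarrow> q k) (at 0)"
    proof (rule Lim_transform_eventually)
      show "((\<lambda>w. w\<^sup>2 * (deriv (chart k) w)\<^sup>2 * hopf \<alpha> (chart k w)) \<longlongrightarrow> q k) (at 0)"
        using ends[of k] by (simp add: weighted_end_def)
      have "\<forall>\<^sub>F w in at 0. w \<noteq> (0 :: complex)" by (simp add: eventually_at_filter)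
      then show "\<forall>\<^sub>F w in at 0. w\<^sup>2 * (deriv (chart k) w)\<^sup>2 * hopf \<alpha> (chart k w) = G w"
        using eventually_chart_in_sphere[of k] by eventually_elim (rule eq)
    qed
  qed
  have e0: "poly e 0 \<noteq> 0"
    using limit[of "\<lambda>w. poly e w * poly w0 w / (w - 1)\<^sup>2" P0] q[of P0]
    by (auto simp: H0 deriv_chart c_def intro!: continuous_intros isCont_o2[OF _ poly_isCont])
  have "isCont (\<lambda>w. poly P (1 + w)) 0" for P :: "complex poly"
    by (rule isCont_o2[OF _ poly_isCont]) (intro continuous_intros)
  then have e1: "poly e 1 \<noteq> 0"
    using limit[of "\<lambda>w. poly e (1 + w) * poly w0 (1 + w) / (1 + w)\<^sup>2" P1] q[of P1]
    by (auto simp: H0 deriv_chart c_def intro!: continuous_intros)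
  have "poly e z \<noteq> 0" for z
  proof (cases "z \<in> punctured_sphere")
    case True
    then show ?thesis using \<alpha>0[OF True] nil(3)[OF True] by auto
  qed (use e0 e1 in \<open>auto simp: punctured_sphere_iff\<close>)
  then have "degree e = 0"
    using alg_closed_imp_poly_has_root[of e] by auto
  then obtain k where k: "e = [:k:]" by (metis degree_eq_zeroE)
  have k0: "k \<noteq> 0" using e0 k by simp
  define s t where "s = smult (csqrt k) s0" and "t = smult (csqrt k) t0"
  have kk: "csqrt k * csqrt k = k" using power2_csqrt[of k] by (simp only: power2_eq_square)
  have "spin (poly s z) (poly t z) = smul k (spin (poly s0 z) (poly t0 z))" for z
  proof -
    have "spin (r * x) (r * y) = smul (r * r) (spin x y)" for r x y
      by (simp add: cmat_eq_iff power2_eq_square)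
    from this[of "csqrt k"] show ?thesis by (simp add: s_def t_def kk)
  qed
  with \<alpha>0 have \<alpha>1: "\<alpha> z = smul (c z) (spin (poly s z) (poly t z))" if "z \<in> punctured_sphere" for z
    using that by (simp add: k)
  have "degree s \<le> 2"
  proof -
    have "degree (s0\<^sup>2) = degree (P 1 2)" using est(1) k k0 by simp
    then show ?thesis using P(1)[of 1 2] by (cases "s0 = 0") (auto simp: s_def degree_power_eq)
  qed
  then obtain a0 a1 a2 where s: "s = [:a0, a1, a2:]" by (rule poly_degree_2)
  have "degree t \<le> 2"
  proof -
    have "degree (t0\<^sup>2) = degree (P 2 1)" using P21 k k0 by simp
    then show ?thesis using P(1)[of 2 1] by (cases "t0 = 0") (auto simp: t_def degree_power_eq)
  qed
  then obtain b0 b1 b2 where t: "t = [:b0, b1, b2:]" by (rule poly_degree_2)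
  have st: "poly s z = a0 + a1 * z + a2 * z\<^sup>2" "poly t z = b0 + b1 * z + b2 * z\<^sup>2" for z
    by (simp_all add: s t power2_eq_square algebra_simps)
  let ?p01 = "a0 * b1 - a1 * b0" and ?p02 = "a0 * b2 - a2 * b0" and ?p12 = "a1 * b2 - a2 * b1"
  have H: "hopf \<alpha> z = c z * (?p01 + 2 * ?p02 * z + ?p12 * z\<^sup>2)" if z: "z \<in> punctured_sphere" for z
    using rational_null_curve_hopf[OF \<alpha> z c \<alpha>1]
    by (simp add: s t pderiv_pCons power2_eq_square algebra_simps)
  have "?p01 = q P0"
    using limit[of "\<lambda>w. (?p01 + 2 * ?p02 * w + ?p12 * w\<^sup>2) / (w - 1)\<^sup>2" P0]
    by (simp add: H deriv_chart c_def)
  moreover have "?p12 = q PInf"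
  proof -
    let ?G = "\<lambda>w. (?p01 * w\<^sup>2 + 2 * ?p02 * w + ?p12) / (1 - w)\<^sup>2"
    have "?G 0 = q PInf"
    proof (rule limit)
      fix w :: complex assume w0: "w \<noteq> 0" and ps: "chart PInf w \<in> punctured_sphere"
      then have w: "w \<noteq> 0" "1 - w \<noteq> 0" by (auto simp: punctured_sphere_iff)
      have "c (1 / w) = w ^ 4 / (1 - w)\<^sup>2"
      proof -
        have "(1 / w - 1) = (1 - w) / w" using w by (simp add: field_simps)
        then show ?thesis using w unfolding c_def by (simp add: power_divide power2_eq_square power4_eq_xxxx)
      qed
      moreover have "?p01 + 2 * ?p02 * (1 / w) + ?p12 * (1 / w)\<^sup>2 = (?p01 * w\<^sup>2 + 2 * ?p02 * w + ?p12) / w\<^sup>2"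
        using w by (simp add: field_simps power2_eq_square)
      ultimately have "hopf \<alpha> (1 / w) = w ^ 4 / (1 - w)\<^sup>2 * ((?p01 * w\<^sup>2 + 2 * ?p02 * w + ?p12) / w\<^sup>2)"
        using H[of "1 / w"] ps by simp
      moreover have "w\<^sup>2 * (- (1 / w\<^sup>2))\<^sup>2 * (w ^ 4 / (1 - w)\<^sup>2 * (K / w\<^sup>2)) = K / (1 - w)\<^sup>2" for K
        using w by (simp add: field_simps power2_eq_square power4_eq_xxxx)
      ultimately show "w\<^sup>2 * (deriv (chart PInf) w)\<^sup>2 * hopf \<alpha> (chart PInf w) = ?G w"
        using deriv_chart(3)[OF w(1)] by simp
    qed (intro continuous_intros, simp)
    then show ?thesis by simp
  qed
  moreover have "?p01 + 2 * ?p02 + ?p12 = q P1"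
    using limit[of "\<lambda>w. (?p01 + 2 * ?p02 * (1 + w) + ?p12 * (1 + w)\<^sup>2) / (1 + w)\<^sup>2" P1]
    by (simp add: H deriv_chart c_def)
  ultimately show thesis using that \<alpha>1 unfolding st c_def by blast
qed

text \<open>
  Two pairs of vectors in a three-dimensional space with the same nonzero Pluecker coordinates differ by a
  matrix of determinant 1. The matrix S is the one that matches the coefficients of degree 0
  and 1, which are linearly independent because q P0 does not vanish.
\<close>

theorem weighted_null_curves_conjugate:
  assumes "null_curve \<alpha>" "null_curve \<beta>" "\<And>k. weighted_end \<alpha> k (q k)" "\<And>k. weighted_end \<beta> k (q k)"
    and q: "\<And>k. q k \<noteq> 0"
  obtains S where "det S = 1" "\<And>z. z \<in> punctured_sphere \<Longrightarrow> \<beta> z = S ** \<alpha> z ** adjugate S"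
proof -
  obtain a0 a1 a2 b0 b1 b2 where a:
    "\<And>z. z \<in> punctured_sphere \<Longrightarrow>
       \<alpha> z = smul (1 / (z\<^sup>2 * (z - 1)\<^sup>2)) (spin (a0 + a1 * z + a2 * z\<^sup>2) (b0 + b1 * z + b2 * z\<^sup>2))"
    "a0 * b1 - a1 * b0 = q P0" "a1 * b2 - a2 * b1 = q PInf"
    "(a0 * b1 - a1 * b0) + 2 * (a0 * b2 - a2 * b0) + (a1 * b2 - a2 * b1) = q P1"
    using weighted_null_curve_spinor[OF assms(1,3) q] by metis
  obtain c0 c1 c2 d0 d1 d2 where c:
    "\<And>z. z \<in> punctured_sphere \<Longrightarrow>
       \<beta> z = smul (1 / (z\<^sup>2 * (z - 1)\<^sup>2)) (spin (c0 + c1 * z + c2 * z\<^sup>2) (d0 + d1 * z + d2 * z\<^sup>2))"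
    "c0 * d1 - c1 * d0 = q P0" "c1 * d2 - c2 * d1 = q PInf"
    "(c0 * d1 - c1 * d0) + 2 * (c0 * d2 - c2 * d0) + (c1 * d2 - c2 * d1) = q P1"
    using weighted_null_curve_spinor[OF assms(2,4) q] by metis
  define m where "m = q P0"
  have m: "m \<noteq> 0" using q by (simp add: m_def)
  define S where "S = (vector [vector [(c0 * b1 - c1 * b0) / m, (a0 * c1 - a1 * c0) / m],
                               vector [(d0 * b1 - d1 * b0) / m, (a0 * d1 - a1 * d0) / m]] :: cmat)"
  have Se: "S$1$1 = (c0 * b1 - c1 * b0) / m" "S$1$2 = (a0 * c1 - a1 * c0) / m"
    "S$2$1 = (d0 * b1 - d1 * b0) / m" "S$2$2 = (a0 * d1 - a1 * d0) / m"
    by (simp_all add: S_def)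
  have e1: "a0 * b1 - a1 * b0 = m" "c0 * d1 - c1 * d0 = m" using a c by (simp_all add: m_def)
  have e2: "a1 * b2 - a2 * b1 = c1 * d2 - c2 * d1" using a(3) c(3) by simp
  have "(a0 * b1 - a1 * b0) + 2 * (a0 * b2 - a2 * b0) + (a1 * b2 - a2 * b1)
      = (c0 * d1 - c1 * d0) + 2 * (c0 * d2 - c2 * d0) + (c1 * d2 - c2 * d1)" using a(4) c(4) by simp
  then have "2 * (a0 * b2 - a2 * b0) = 2 * (c0 * d2 - c2 * d0)" unfolding e1 e2 by simp
  then have e3: "a0 * b2 - a2 * b0 = c0 * d2 - c2 * d0" by (simp only: mult_cancel_left) simp
  have "det S * m\<^sup>2 = (c0 * b1 - c1 * b0) * (a0 * d1 - a1 * d0) - (a0 * c1 - a1 * c0) * (d0 * b1 - d1 * b0)"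
    using m by (simp add: det_2 Se power2_eq_square field_simps)
  also have "\<dots> = (a0 * b1 - a1 * b0) * (c0 * d1 - c1 * d0)" by (simp add: algebra_simps)
  also have "\<dots> = m\<^sup>2" unfolding e1 power2_eq_square ..
  finally have "det S = 1" using m by simp
  moreover have "S ** spin (a0 + a1 * z + a2 * z\<^sup>2) (b0 + b1 * z + b2 * z\<^sup>2) ** adjugate S
     = spin (c0 + c1 * z + c2 * z\<^sup>2) (d0 + d1 * z + d2 * z\<^sup>2)" for z
  proof -
    \<comment> \<open>The coefficient of degree 2 is a combination of the other two whose coefficients are quotients of
      Pluecker coordinates.\<close>
    have pl: "(c0 * b1 - c1 * b0) * (a0 + a1 * z + a2 * z\<^sup>2) + (a0 * c1 - a1 * c0) * (b0 + b1 * z + b2 * z\<^sup>2)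
        = (a0 * b1 - a1 * b0) * (c0 + c1 * z) + (c1 * (a0 * b2 - a2 * b0) - c0 * (a1 * b2 - a2 * b1)) * z\<^sup>2"
      for c0 c1 by (simp add: algebra_simps)
    have "(c0 * b1 - c1 * b0) * (a0 + a1 * z + a2 * z\<^sup>2) + (a0 * c1 - a1 * c0) * (b0 + b1 * z + b2 * z\<^sup>2)
        = m * (c0 + c1 * z) + ((c0 * d1 - c1 * d0) * c2) * z\<^sup>2"
      unfolding pl e2 e3 e1(1) by (simp add: algebra_simps)
    also have "\<dots> = m * (c0 + c1 * z + c2 * z\<^sup>2)"
      unfolding e1(2) by (simp add: algebra_simps)
    finally have "(c0 * b1 - c1 * b0) * (a0 + a1 * z + a2 * z\<^sup>2) + (a0 * c1 - a1 * c0) * (b0 + b1 * z + b2 * z\<^sup>2)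
        = m * (c0 + c1 * z + c2 * z\<^sup>2)" .
    then have 1: "S$1$1 * (a0 + a1 * z + a2 * z\<^sup>2) + S$1$2 * (b0 + b1 * z + b2 * z\<^sup>2) = c0 + c1 * z + c2 * z\<^sup>2"
      using m by (simp add: Se add_divide_distrib[symmetric])
    have "(d0 * b1 - d1 * b0) * (a0 + a1 * z + a2 * z\<^sup>2) + (a0 * d1 - a1 * d0) * (b0 + b1 * z + b2 * z\<^sup>2)
        = m * (d0 + d1 * z) + ((c0 * d1 - c1 * d0) * d2) * z\<^sup>2"
      unfolding pl e2 e3 e1(1) by (simp add: algebra_simps)
    also have "\<dots> = m * (d0 + d1 * z + d2 * z\<^sup>2)"
      unfolding e1(2) by (simp add: algebra_simps)
    finally have "(d0 * b1 - d1 * b0) * (a0 + a1 * z + a2 * z\<^sup>2) + (a0 * d1 - a1 * d0) * (b0 + b1 * z + b2 * z\<^sup>2)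
        = m * (d0 + d1 * z + d2 * z\<^sup>2)" .
    then have 2: "S$2$1 * (a0 + a1 * z + a2 * z\<^sup>2) + S$2$2 * (b0 + b1 * z + b2 * z\<^sup>2) = d0 + d1 * z + d2 * z\<^sup>2"
      using m by (simp add: Se add_divide_distrib[symmetric])
    show ?thesis unfolding spin_transform[symmetric] 1 2 ..
  qed
  then have "\<beta> z = S ** \<alpha> z ** adjugate S" if "z \<in> punctured_sphere" for z
    unfolding a(1)[OF that] c(1)[OF that] by simp
  ultimately show thesis by (rule that)
qed

section \<open>Behaviour at the punctures\<close>

lemma char_poly_traceless:
  assumes "\<And>x. det (mat x - R :: cmat) = (x - c) * (x + c)"
  shows "trace R = 0" "det R = - c\<^sup>2"
proof -
  have e: "det (mat x - R) = x\<^sup>2 - trace R * x + det R" for x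
    by (simp add: det_2 trace_entry mat_def power2_eq_square algebra_simps)
  show 1: "det R = - c\<^sup>2" using assms[of 0] e[of 0] by (simp add: power2_eq_square)
  show "trace R = 0" using assms[of 1] e[of 1] 1 by (simp add: power2_eq_square algebra_simps)
qed

text \<open>
  The determinants at l = 0, 1 and -1 determine the determinant of R + l A as a polynomial in l: the coefficient of the
  square says that A is singular, the linear one that the trace of A R is q. For a singular
  traceless A, the product A M A is the trace of A M times A.
\<close>

lemma residue_algebra:
  fixes R A :: cmat
  assumes "trace R = 0" "trace (R + A) = 0" "det R = - (1/4)" "det (R + A) = - (q + 1/4)" "det (R - A) = - (1/4 - q)"
  shows "A ** R ** A = smul q A" "smul 2 R ** smul 2 R = mat 1"
proof -
  define a b c where abc: "a = A$1$1" "b = A$1$2" "c = A$2$1"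
  define x y z where xyz: "x = R$1$1" "y = R$1$2" "z = R$2$1"
  have R: "R$1$1 = x" "R$1$2 = y" "R$2$1 = z" "R$2$2 = - x"
    using assms(1) by (auto simp: trace_entry add_eq_0_iff xyz)
  have A: "A$1$1 = a" "A$1$2 = b" "A$2$1 = c" "A$2$2 = - a"
    using assms(1,2) by (auto simp: trace_entry trace_linear add_eq_0_iff abc)
  have 1: "x * x + y * z = 1/4" using assms(3) by (simp add: det_2 R algebra_simps)
  have 2: "(x + a) * (x + a) + (y + b) * (z + c) = q + 1/4"
    using assms(4) by (simp add: det_2 R A algebra_simps)
  have 3: "(x - a) * (x - a) + (y - b) * (z - c) = 1/4 - q"
  proof -
    have "det (R - A) = - ((x - a) * (x - a) + (y - b) * (z - c))" by (simp add: det_2 R A algebra_simps)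
    with assms(5) show ?thesis by (simp only: neg_equal_iff_equal)
  qed
  have "2 * (a * a + b * c) = 0" using 1 2 3 by algebra
  then have n: "a * a + b * c = 0" by (simp only: mult_eq_0_iff) simp
  have "2 * (2 * a * x + b * z + c * y) = 2 * q" using 1 2 3 n by algebra
  then have q: "2 * a * x + b * z + c * y = q" by (simp only: mult_cancel_left) simp
  have "(a * x + b * z) * a + (a * y - b * x) * c = q * a" "(a * x + b * z) * b - (a * y - b * x) * a = q * b"
    "(c * x - a * z) * a + (c * y + a * x) * c = q * c" "(c * x - a * z) * b - (c * y + a * x) * a = - (q * a)"
    using n q by algebra+
  then show "A ** R ** A = smul q A" by (simp add: cmat_expand R A algebra_simps)
  have "4 * (x * x + y * z) = 1" unfolding 1 by simp
  then show "smul 2 R ** smul 2 R = mat 1" by (simp add: cmat_expand R algebra_simps)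
qed

text \<open>
  The gauged potential is affine in l because the original one is, and so are its residues; this gives the two
  functions a and b, which are holomorphic at the puncture. Written with the local coordinate w, the
  gauged potential is (l a + b) dw / w. The residue b 0 has eigenvalues 1/2 and -1/2, so twice it is an involution.
\<close>

lemma has_weight_normal_form:
  assumes w: "has_weight A B k q"
  obtains r g a b where "0 < r" "r \<le> 1" "holo_mat g (ball 0 r - {0})"
    "\<And>t. t \<in> ball 0 r - {0} \<Longrightarrow> det (g t) = 1"
    "holo_mat a (ball 0 r)" "holo_mat b (ball 0 r)"
    "\<And>t. t \<in> ball 0 r - {0} \<Longrightarrow> smul (deriv (\<lambda>s. chart k (s\<^sup>2)) t) (A (chart k (t\<^sup>2)))
        = smul (2 / t) (g t ** a (t\<^sup>2) ** adjugate (g t))"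
    "\<And>t. t \<in> ball 0 r - {0} \<Longrightarrow> smul (deriv (\<lambda>s. chart k (s\<^sup>2)) t) (B (chart k (t\<^sup>2)))
        = smul (2 / t) (g t ** b (t\<^sup>2) ** adjugate (g t)) - deriv_mat g t ** adjugate (g t)"
    "a 0 \<noteq> 0" "a 0 ** b 0 ** a 0 = smul q (a 0)" "smul 2 (b 0) ** smul 2 (b 0) = mat 1"
proof -
  obtain \<eta> where q: "q \<noteq> 0" and gauged: "gauged_potential_at A B k \<eta>"
    and poles: "\<And>l. \<exists>R. has_simple_pole (\<eta> l) 0 R \<and>
           (\<forall>x. det (mat x - R) = (x - csqrt (q * l + 1/4)) * (x + csqrt (q * l + 1/4)))"
    using w unfolding has_weight_def by blast
  obtain r0 g where r0: "r0 > 0" and g: "holo_mat g (ball 0 r0 - {0})"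
    "\<And>t. t \<in> ball 0 r0 - {0} \<Longrightarrow> det (g t) = 1"
    and eq: "\<And>l t. t \<in> ball 0 r0 - {0} \<Longrightarrow> smul (2 * t) (\<eta> l (t\<^sup>2)) =
             matrix_inv (g t) **
               smul (deriv (\<lambda>s. chart k (s\<^sup>2)) t) (potential A B l (chart k (t\<^sup>2))) ** g t
             + matrix_inv (g t) ** deriv_mat g t"
    using gauged unfolding gauged_potential_at_def by blast
  have "\<exists>R H r. r > 0 \<and> holo_mat H (ball 0 r) \<and> (\<forall>w \<in> ball 0 r - {0}. \<eta> l w = smul (1 / w) R + H w) \<and>
     trace R = 0 \<and> det R = - (q * l + 1/4)" for l
  proof -
    obtain R where R: "has_simple_pole (\<eta> l) 0 R"
      "\<And>x. det (mat x - R) = (x - csqrt (q * l + 1/4)) * (x + csqrt (q * l + 1/4))" using poles by blast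
    show ?thesis using R(1) char_poly_traceless[OF R(2)] unfolding has_simple_pole_def
      by (metis diff_zero power2_csqrt)
  qed
  then obtain Res H \<rho> where H: "\<And>l. \<rho> l > 0" "\<And>l. holo_mat (H l) (ball 0 (\<rho> l))"
    "\<And>l w. w \<in> ball 0 (\<rho> l) - {0} \<Longrightarrow> \<eta> l w = smul (1 / w) (Res l) + H l w"
    "\<And>l. trace (Res l) = 0" "\<And>l. det (Res l) = - (q * l + 1/4)"
    by metis
  define r where "r = min 1 (min r0 (min (\<rho> 0) (min (\<rho> 1) (\<rho> (-1)))))"
  have r: "r > 0" "r \<le> 1" "r \<le> r0" "r \<le> \<rho> 0" "r \<le> \<rho> 1" "r \<le> \<rho> (-1)"
    using r0 H(1) by (auto simp: r_def)
  have sq: "t\<^sup>2 \<in> ball 0 r - {0}" if "t \<in> ball 0 r - {0}" for t :: complex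
  proof -
    have "norm t ^ 2 \<le> norm t ^ 1" by (rule power_decreasing) (use that r in auto)
    then show ?thesis using that by (auto simp: norm_power)
  qed
  have inv: "matrix_inv (g t) = adjugate (g t)" "g t ** adjugate (g t) = mat 1"
      "\<And>M. (M :: cmat) ** g t ** adjugate (g t) = M" "\<And>M. (M :: cmat) ** adjugate (g t) ** g t = M"
    if "t \<in> ball 0 r - {0}" for t
    using g(2)[of t] that r by (auto simp: matrix_inv_eq_adjugate mult_adjugate_cancel)
  define a where "a w = Res 1 - Res 0 + smul w (H 1 w - H 0 w)" for w
  define b where "b w = Res 0 + smul w (H 0 w)" for w
  have \<eta>: "smul (2 * t) (\<eta> l (t\<^sup>2)) = smul (2 / t) (Res l + smul (t\<^sup>2) (H l (t\<^sup>2)))"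
    if t: "t \<in> ball 0 r - {0}" and l: "r \<le> \<rho> l" for t l
  proof -
    have "t\<^sup>2 \<in> ball 0 (\<rho> l) - {0}" using sq[OF t] l by auto
    then show ?thesis using t by (simp add: H(3) smul_add power2_eq_square)
  qed
  let ?c = "\<lambda>t. deriv (\<lambda>s. chart k (s\<^sup>2)) t"
  have eq': "g t ** smul (2 * t) (\<eta> l (t\<^sup>2)) ** adjugate (g t) =
      smul (?c t) (smul l (A (chart k (t\<^sup>2))) + B (chart k (t\<^sup>2))) + deriv_mat g t ** adjugate (g t)"
    if t: "t \<in> ball 0 r - {0}" for t l
  proof -
    have "t \<in> ball 0 r0 - {0}" using t r by auto
    from eq[OF this] show ?thesis
      unfolding inv(1)[OF t] potential_def
      by (simp add: mm.add_left mm.add_right matrix_mul_assoc inv[OF t])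
  qed
  have hol: "holo_mat (H l) (ball 0 r)" if "r \<le> \<rho> l" for l
    by (rule holo_mat_subset[OF H(2)]) (use that in auto)
  \<comment> \<open>Comparing residues at l = -1, 0 and 1: the difference of the two sides is holomorphic times w.\<close>
  have mid: "Res (-1) = smul 2 (Res 0) - Res 1"
  proof -
    define G where "G w = smul w (H (-1) w + H 1 w - smul 2 (H 0 w))" for w
    have "continuous_on (ball 0 r) G"
      unfolding G_def[abs_def]
      by (intro continuous_mult continuous_intros holo_mat_continuous_on hol r) auto
    then have lim: "(G \<longlongrightarrow> G 0) (at 0)"
      using r by (simp add: continuous_on_eq_continuous_at isCont_def)
    have "\<forall>\<^sub>F t in at 0. t \<in> ball 0 r - {0 :: complex}"
      using r by (intro eventually_at_in_open) auto
    then have "\<forall>\<^sub>F t in at 0. G (t\<^sup>2) = smul 2 (Res 0) - Res 1 - Res (-1)"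
    proof eventually_elim
      case (elim t)
      have t0: "t \<noteq> 0" using elim by auto
      have "g t ** (smul (2 * t) (\<eta> (-1) (t\<^sup>2)) + smul (2 * t) (\<eta> 1 (t\<^sup>2)) - smul 2 (smul (2 * t) (\<eta> 0 (t\<^sup>2)))) ** adjugate (g t) = 0"
      proof -
        have "g t ** (smul (2 * t) (\<eta> (-1) (t\<^sup>2)) + smul (2 * t) (\<eta> 1 (t\<^sup>2)) - smul 2 (smul (2 * t) (\<eta> 0 (t\<^sup>2)))) ** adjugate (g t)
          = g t ** smul (2 * t) (\<eta> (-1) (t\<^sup>2)) ** adjugate (g t) + g t ** smul (2 * t) (\<eta> 1 (t\<^sup>2)) ** adjugate (g t)
            - smul 2 (g t ** smul (2 * t) (\<eta> 0 (t\<^sup>2)) ** adjugate (g t))"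
          by (simp add: mm.add_left mm.add_right mm.diff_left mm.diff_right)
        also have "\<dots> = 0" unfolding eq'[OF elim] by (simp add: cmat_eq_iff algebra_simps)
        finally show ?thesis .
      qed
      then have "adjugate (g t) ** (g t ** (smul (2 * t) (\<eta> (-1) (t\<^sup>2)) + smul (2 * t) (\<eta> 1 (t\<^sup>2)) - smul 2 (smul (2 * t) (\<eta> 0 (t\<^sup>2)))) ** adjugate (g t)) ** g t = 0"
        by simp
      then have "smul (2 * t) (\<eta> (-1) (t\<^sup>2)) + smul (2 * t) (\<eta> 1 (t\<^sup>2)) - smul 2 (smul (2 * t) (\<eta> 0 (t\<^sup>2))) = 0"
        using mult_adjugate_cancel(2)[of "g t"] g(2)[of t] elim r by (simp add: matrix_mul_assoc inv[OF elim])
      then have "smul (2 / t) ((Res (-1) + Res 1 - smul 2 (Res 0)) + G (t\<^sup>2)) = 0"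
        unfolding \<eta>[OF elim r(4)] \<eta>[OF elim r(5)] \<eta>[OF elim r(6)] G_def
        by (simp add: cmat_eq_iff algebra_simps)
      then have "smul (t / 2) (smul (2 / t) ((Res (-1) + Res 1 - smul 2 (Res 0)) + G (t\<^sup>2))) = 0"
        by simp
      then have "(Res (-1) + Res 1 - smul 2 (Res 0)) + G (t\<^sup>2) = 0" using t0 by simp
      then have "G (t\<^sup>2) = - (Res (-1) + Res 1 - smul 2 (Res 0))" by (simp only: add_eq_0_iff)
      then show ?case by simp
    qed
    moreover have "((\<lambda>t. G (t\<^sup>2)) \<longlongrightarrow> G 0) (at (0 :: complex))"
    proof -
      have "filterlim (\<lambda>t :: complex. t\<^sup>2) (at 0) (at 0)"
        unfolding filterlim_at by (auto intro!: tendsto_eq_intros simp: eventually_at_filter)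
      with lim show ?thesis by (rule filterlim_compose)
    qed
    ultimately have "((\<lambda>t :: complex. smul 2 (Res 0) - Res 1 - Res (-1)) \<longlongrightarrow> G 0) (at 0)"
      by (rule Lim_transform_eventually[rotated])
    then have "G 0 = smul 2 (Res 0) - Res 1 - Res (-1)" by (simp add: tendsto_const_iff)
    then show ?thesis by (simp add: G_def)
  qed
  have "A' ** R' ** A' = smul q A' \<and> smul 2 R' ** smul 2 R' = mat 1"
    if "A' = Res 1 - Res 0" "R' = Res 0" for A' R'
  proof -
    have "R' + A' = Res 1" "R' - A' = Res (-1)" using that mid by (simp_all add: cmat_eq_iff)
    then show ?thesis using residue_algebra[of R' A' q] H(4,5)[of 0] H(4,5)[of 1] H(5)[of "-1"] that by simp
  qed
  then have res: "a 0 ** b 0 ** a 0 = smul q (a 0)" "smul 2 (b 0) ** smul 2 (b 0) = mat 1"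
    by (simp_all add: a_def b_def)
  have "a 0 \<noteq> 0"
  proof
    assume "a 0 = 0"
    then have "det (Res 1) = det (Res 0)" by (simp add: a_def)
    then show False using H(5)[of 0] H(5)[of 1] q by simp
  qed
  moreover have "holo_mat a (ball 0 r)" "holo_mat b (ball 0 r)"
    using hol[OF r(4)] hol[OF r(5)]
    by (auto simp: holo_mat_def a_def[abs_def] b_def[abs_def] intro!: holomorphic_intros)
  moreover have "smul (?c t) (A (chart k (t\<^sup>2))) = smul (2 / t) (g t ** a (t\<^sup>2) ** adjugate (g t))"
    if t: "t \<in> ball 0 r - {0}" for t
  proof -
    have "smul (?c t) (A (chart k (t\<^sup>2))) = g t ** smul (2 * t) (\<eta> 1 (t\<^sup>2)) ** adjugate (g t) - g t ** smul (2 * t) (\<eta> 0 (t\<^sup>2)) ** adjugate (g t)"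
      unfolding eq'[OF t] by (simp add: smul_add)
    also have "\<dots> = smul (2 / t) (g t ** a (t\<^sup>2) ** adjugate (g t))"
      unfolding \<eta>[OF t r(4)] \<eta>[OF t r(5)] a_def
      by (simp add: mm.add_left mm.add_right mm.diff_left mm.diff_right smul_add smul_diff)
    finally show ?thesis .
  qed
  moreover have "smul (?c t) (B (chart k (t\<^sup>2))) = smul (2 / t) (g t ** b (t\<^sup>2) ** adjugate (g t)) - deriv_mat g t ** adjugate (g t)"
    if t: "t \<in> ball 0 r - {0}" for t
  proof -
    have "smul (?c t) (B (chart k (t\<^sup>2))) = g t ** smul (2 * t) (\<eta> 0 (t\<^sup>2)) ** adjugate (g t) - deriv_mat g t ** adjugate (g t)"
      unfolding eq'[OF t] by simp
    also have "\<dots> = smul (2 / t) (g t ** b (t\<^sup>2) ** adjugate (g t)) - deriv_mat g t ** adjugate (g t)"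
      unfolding \<eta>[OF t r(4)] b_def by simp
    finally show ?thesis .
  qed
  moreover have "holo_mat g (ball 0 r - {0})" by (rule holo_mat_subset[OF g(1)]) (use r in auto)
  moreover have "det (g t) = 1" if "t \<in> ball 0 r - {0}" for t using g(2) that r by auto
  ultimately show thesis using that r(1,2) res by blast
qed

text \<open>
  A Gronwall estimate with the sharp exponent. For an involution T, the sum of the squared norms of F and F T changes
  along F' = F T at a rate of at most twice itself, since multiplication by T only exchanges the two summands.
  The perturbation E is integrable towards Re s = -\<infinity>, so it costs only a bounded factor.
\<close>

lemma square_one_growth:
  fixes F E :: "complex \<Rightarrow> cmat" and T :: cmat
  assumes F: "\<And>s. Re s < \<sigma>1 \<Longrightarrow> has_mderiv F (F s ** (T + E s)) s"
    and T: "T ** T = mat 1"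
    and E: "\<And>s. Re s < \<sigma>1 \<Longrightarrow> norm (E s) \<le> K * exp (2 * Re s)"
    and \<sigma>0: "\<sigma>0 < \<sigma>1"
  shows "\<exists>C. \<forall>s. Re s \<le> \<sigma>0 \<longrightarrow> \<bar>Im s\<bar> \<le> L \<longrightarrow> (norm (F s))\<^sup>2 \<le> C * exp (- 2 * Re s)"
proof -
  define n where "n s = (norm (F s))\<^sup>2 + (norm (F s ** T))\<^sup>2" for s
  define K3 where "K3 = (2 + norm T) * \<bar>K\<bar>"
  have n0: "n s \<ge> 0" for s by (simp add: n_def)
  \<comment> \<open>The integrating factor; the function m turns out to be nondecreasing along horizontal lines.\<close>
  define m where "m \<theta> \<sigma> = n (Complex \<sigma> \<theta>) * exp (2 * \<sigma> + K3 / 2 * exp (2 * \<sigma>))" for \<theta> \<sigma>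
  have mono: "m \<theta> \<sigma> \<le> m \<theta> \<sigma>0" if "\<sigma> \<le> \<sigma>0" for \<theta> \<sigma>
  proof (rule DERIV_nonneg_imp_nondecreasing[OF that])
    fix x assume x: "\<sigma> \<le> x" "x \<le> \<sigma>0"
    define s where "s = Complex x \<theta>"
    have s: "Re s < \<sigma>1" using x \<sigma>0 by (simp add: s_def)
    let ?F = "F s" and ?D = "F s ** (T + E s)"
    have line: "((\<lambda>\<sigma>. Complex \<sigma> \<theta>) has_derivative (\<lambda>h. of_real h)) (at x)"
    proof -
      have "((\<lambda>\<sigma>. of_real \<sigma> + \<i> * of_real \<theta>) has_derivative (\<lambda>h. of_real h)) (at x)"
        by (auto intro!: derivative_eq_intros)
      then show ?thesis by (simp add: Complex_eq)
    qed
    have dF: "((\<lambda>\<sigma>. F (Complex \<sigma> \<theta>)) has_derivative (\<lambda>h. h *\<^sub>R ?D)) (at x)"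
      using has_derivative_compose[OF line, of F] F[OF s] by (simp add: has_mderiv_def s_def scaleR_smul)
    have dFT: "((\<lambda>\<sigma>. F (Complex \<sigma> \<theta>) ** T) has_derivative (\<lambda>h. h *\<^sub>R (?D ** T))) (at x)"
      using mm.FDERIV[OF dF has_derivative_const[of T]] by (simp add: mm.scaleR_left)
    have "((\<lambda>\<sigma>. n (Complex \<sigma> \<theta>)) has_derivative (\<lambda>h. h * (2 * (?F \<bullet> ?D) + 2 * ((?F ** T) \<bullet> (?D ** T))))) (at x)"
      unfolding n_def power2_norm_eq_inner
      by (rule has_derivative_eq_rhs[OF has_derivative_add[OF has_derivative_inner[OF dF dF] has_derivative_inner[OF dFT dFT]]])
        (simp add: s_def inner_commute algebra_simps)
    then have dn: "((\<lambda>\<sigma>. n (Complex \<sigma> \<theta>)) has_real_derivative (2 * (?F \<bullet> ?D) + 2 * ((?F ** T) \<bullet> (?D ** T)))) (at x)"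
      by (simp add: has_field_derivative_def mult.commute[of _ "_ + _"] mult_commute_abs)
    let ?d = "2 * (?F \<bullet> ?D) + 2 * ((?F ** T) \<bullet> (?D ** T))"
    have D: "?D = ?F ** T + ?F ** E s" "?D ** T = ?F + ?F ** E s ** T"
      by (simp_all add: mm.add_right mm.add_left matrix_mul_assoc[symmetric] T)
    have "?d = 4 * (?F \<bullet> (?F ** T)) + 2 * (?F \<bullet> (?F ** E s)) + 2 * ((?F ** T) \<bullet> (?F ** E s ** T))"
      unfolding D(2) unfolding D(1) by (simp add: inner_add_right inner_commute algebra_simps)
    moreover have "4 * (?F \<bullet> (?F ** T)) \<ge> - 2 * n s"
    proof -
      have "0 \<le> (?F + ?F ** T) \<bullet> (?F + ?F ** T)" by simp
      also have "\<dots> = n s + 2 * (?F \<bullet> (?F ** T))"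
        by (simp add: n_def power2_norm_eq_inner inner_add_left inner_add_right inner_commute)
      finally show ?thesis by simp
    qed
    moreover have "2 * (?F \<bullet> (?F ** E s)) + 2 * ((?F ** T) \<bullet> (?F ** E s ** T)) \<ge> - (K3 * exp (2 * x) * n s)"
    proof -
      have e: "norm (E s) \<le> \<bar>K\<bar> * exp (2 * x)"
      proof -
        have h: "K * exp (2 * x) \<le> \<bar>K\<bar> * exp (2 * x)" by (intro mult_right_mono) auto
        show ?thesis by (rule order_trans[OF _ h]) (use E[OF s] in \<open>simp add: s_def\<close>)
      qed
      have FE: "norm (?F ** E s) \<le> norm ?F * norm (E s)" by (rule norm_mult_le)
      have FET: "norm (?F ** E s ** T) \<le> norm ?F * norm (E s) * norm T"
        by (rule order_trans[OF norm_mult_le]) (intro mult_right_mono FE norm_ge_zero)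
      have FT: "(norm ?F)\<^sup>2 \<le> n s" "2 * (norm (?F ** T) * norm ?F) \<le> n s"
        using sum_squares_bound[of "norm (?F ** T)" "norm ?F"] by (auto simp: n_def)
      have "\<bar>?F \<bullet> (?F ** E s)\<bar> \<le> norm ?F * (norm ?F * norm (E s))"
        by (rule order_trans[OF Cauchy_Schwarz_ineq2]) (use FE in \<open>auto intro!: mult_left_mono\<close>)
      also have "\<dots> = (norm ?F)\<^sup>2 * norm (E s)" by (simp add: power2_eq_square)
      also have "\<dots> \<le> n s * norm (E s)" using FT by (intro mult_right_mono) auto
      finally have 1: "2 * \<bar>?F \<bullet> (?F ** E s)\<bar> \<le> n s * (norm (E s) * 2)" by simp
      have "\<bar>(?F ** T) \<bullet> (?F ** E s ** T)\<bar> \<le> norm (?F ** T) * (norm ?F * norm (E s) * norm T)"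
        by (rule order_trans[OF Cauchy_Schwarz_ineq2]) (use FET in \<open>auto intro!: mult_left_mono\<close>)
      then have "2 * \<bar>(?F ** T) \<bullet> (?F ** E s ** T)\<bar> \<le> 2 * (norm (?F ** T) * norm ?F) * (norm (E s) * norm T)"
        by (simp add: mult_ac)
      also have "\<dots> \<le> n s * (norm (E s) * norm T)" using FT by (intro mult_right_mono) auto
      finally have "2 * \<bar>?F \<bullet> (?F ** E s)\<bar> + 2 * \<bar>(?F ** T) \<bullet> (?F ** E s ** T)\<bar> \<le> n s * (norm (E s) * (2 + norm T))"
        using 1 by (simp add: distrib_left)
      also have "\<dots> \<le> n s * (\<bar>K\<bar> * exp (2 * x) * (2 + norm T))"
        using e n0 by (intro mult_left_mono mult_right_mono) auto
      also have "\<dots> = K3 * exp (2 * x) * n s" by (simp add: K3_def)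
      finally show ?thesis by (simp add: abs_le_iff)
    qed
    ultimately have key: "?d + n s * (2 + K3 * exp (2 * x)) \<ge> 0" by (simp add: algebra_simps)
    have "(m \<theta> has_real_derivative (?d + n s * (2 + K3 * exp (2 * x))) * exp (2 * x + K3 / 2 * exp (2 * x))) (at x)"
      unfolding m_def[abs_def] by (auto intro!: derivative_eq_intros dn simp: s_def algebra_simps)
    with key show "\<exists>y. (m \<theta> has_real_derivative y) (at x) \<and> y \<ge> 0"
      by (auto intro!: exI)
  qed
  have "continuous_on {-L..L} (\<lambda>\<theta>. m \<theta> \<sigma>0)"
  proof -
    have cF: "continuous_on {s. Re s < \<sigma>1} F"
      using F has_mderiv_imp_continuous by (intro continuous_at_imp_continuous_on) blast
    have "continuous_on {-L..L} (\<lambda>\<theta>. F (Complex \<sigma>0 \<theta>))"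
      unfolding Complex_eq
      by (rule continuous_on_compose2[OF cF]) (use \<sigma>0 in \<open>auto intro!: continuous_intros\<close>)
    then show ?thesis unfolding m_def n_def by (intro continuous_intros continuous_mult)
  qed
  then have "bounded ((\<lambda>\<theta>. m \<theta> \<sigma>0) ` {-L..L})"
    by (intro compact_imp_bounded compact_continuous_image) auto
  then obtain C where C: "\<And>\<theta>. \<theta> \<in> {-L..L} \<Longrightarrow> \<bar>m \<theta> \<sigma>0\<bar> \<le> C"
    unfolding bounded_iff real_norm_def by blast
  have "(norm (F s))\<^sup>2 \<le> C * exp (- 2 * Re s)" if s: "Re s \<le> \<sigma>0" "\<bar>Im s\<bar> \<le> L" for s
  proof -
    have K3: "K3 \<ge> 0" by (simp add: K3_def)
    have "n s * exp (2 * Re s) \<le> m (Im s) (Re s)"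
      unfolding m_def using n0 K3 by (intro mult_mono) auto
    also have "\<dots> \<le> m (Im s) \<sigma>0" using s by (intro mono)
    also have "\<dots> \<le> C" using C[of "Im s"] s by (auto simp: abs_le_iff)
    finally have "n s \<le> C * exp (- 2 * Re s)" by (simp add: exp_minus field_simps)
    moreover have "(norm (F s))\<^sup>2 \<le> n s" by (simp add: n_def)
    ultimately show ?thesis by (rule order_trans[rotated])
  qed
  then show ?thesis by blast
qed


lemma chart_deriv:
  assumes "w \<noteq> 0"
  shows "(chart k has_field_derivative deriv (chart k) w) (at w)" "deriv (chart k) w \<noteq> 0"
proof -
  have e: "chart P0 = (\<lambda>w. w)" "chart P1 = (\<lambda>w. 1 + w)" "chart PInf = (\<lambda>w. 1 / w)" by auto
  show "deriv (chart k) w \<noteq> 0" using assms by (cases k) (simp_all add: deriv_chart)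
  show "(chart k has_field_derivative deriv (chart k) w) (at w)"
    by (cases k; simp add: deriv_chart assms; unfold e)
      (use assms in \<open>auto intro!: derivative_eq_intros simp: power2_eq_square\<close>)
qed

lemma chart_in_sphere: "w \<in> ball 0 1 - {0} \<Longrightarrow> chart k w \<in> punctured_sphere"
  by (cases k) (auto simp: punctured_sphere_iff add_eq_0_iff)

text \<open>
  A local inverse of c at t transports holomorphy from the parameter to the image.
\<close>

lemma analytic_on_image:
  assumes c: "c holomorphic_on D" "open D" "t \<in> D" "deriv c t \<noteq> 0"
    and F: "(\<lambda>t. F (c t)) holomorphic_on D"
  shows "F analytic_on {c t}"
proof -
  obtain r where r: "r > 0" "ball t r \<subseteq> D" "inj_on c (ball t r)"
    using has_complex_derivative_locally_injective[OF c(1,3,2,4)] by metis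
  let ?B = "ball t r"
  have cB: "c holomorphic_on ?B" using c(1) r(2) by (rule holomorphic_on_subset)
  obtain h where h: "h holomorphic_on c ` ?B" "\<And>x. x \<in> ?B \<Longrightarrow> h (c x) = x"
    using holomorphic_has_inverse[OF cB open_ball r(3)] by metis
  have op: "open (c ` ?B)" by (rule open_mapping_thm3[OF cB open_ball r(3)])
  have "(\<lambda>z. F (c (h z))) holomorphic_on c ` ?B"
  proof (rule holomorphic_on_compose_gen[OF h(1) F, unfolded o_def])
    show "h ` c ` ?B \<subseteq> D" using h(2) r(2) by (auto simp: subset_iff)
  qed
  then have "F holomorphic_on c ` ?B"
    by (rule holomorphic_transform) (use h(2) in auto)
  then show ?thesis using op r(1) by (auto simp: analytic_at)
qed

text \<open>
  One half of the principal logarithm solves w = (exp s)^2 inside a bounded horizontal strip, where the growth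
  estimate is uniform.
\<close>

lemma half_Ln:
  assumes "w \<noteq> 0"
  shows "exp (Ln w / 2) ^ 2 = w" "Re (Ln w / 2) = ln (norm w) / 2" "\<bar>Im (Ln w / 2)\<bar> \<le> 4"
proof -
  have "exp (Ln w / 2) ^ 2 = exp (2 * (Ln w / 2))" by (rule exp_double[symmetric])
  then show "exp (Ln w / 2) ^ 2 = w" using assms by simp
  show "Re (Ln w / 2) = ln (norm w) / 2" using assms by simp
  show "\<bar>Im (Ln w / 2)\<bar> \<le> 4"
    using Im_Ln_le_pi[OF assms] mpi_less_Im_Ln[OF assms] pi_less_4 by simp
qed

text \<open>
  In the variable s, with w = (exp s)^2, the matrix F solves an equation whose leading part is the involution
  2 b 0, up to an error of the size of w. So F is at most of the size of the power -1/2 of w, and conjugation by F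
  costs one more power of w than the factor 1 / w.
\<close>

lemma double_pole_bound:
  fixes F a b \<beta> :: "complex \<Rightarrow> cmat"
  assumes r: "0 < r" "r \<le> 1" and ab: "holo_mat a (ball 0 r)" "holo_mat b (ball 0 r)"
    and T: "smul 2 (b 0) ** smul 2 (b 0) = mat 1"
    and dF: "\<And>s. Re s < ln r \<Longrightarrow> has_mderiv F (F s ** smul 2 (b ((exp s)\<^sup>2))) s"
    and rel: "\<And>s. Re s < ln r \<Longrightarrow>
      \<beta> ((exp s)\<^sup>2) = smul (1 / (exp s)\<^sup>2) (F s ** a ((exp s)\<^sup>2) ** adjugate (F s))"
  shows "\<exists>C. \<forall>\<^sub>F w in at 0. norm (\<beta> w) \<le> C / norm w ^ 2"
proof -
  define E where "E s = smul 2 (b ((exp s)\<^sup>2)) - smul 2 (b 0)" for s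
  have b: "has_mderiv b (deriv_mat b 0) 0" and a: "has_mderiv a (deriv_mat a 0) 0"
    using holo_mat_has_mderiv[OF ab(2) open_ball] holo_mat_has_mderiv[OF ab(1) open_ball] r by auto
  from b[unfolded has_mderiv_def has_derivative_at_alt]
  obtain d where d: "d > 0" "\<And>w. norm w < d \<Longrightarrow> norm (b w - b 0 - smul w (deriv_mat b 0)) \<le> norm w"
    by (auto dest!: spec[of _ "1 :: real"])
  define r' where "r' = min r d"
  have r': "r' > 0" "r' \<le> r" "r' \<le> d" using r d by (auto simp: r'_def)
  define \<sigma>1 where "\<sigma>1 = ln r'"
  have H1: "Re s < ln r" "norm ((exp s)\<^sup>2) < d" if "Re s < \<sigma>1" for s
  proof -
    have e: "exp (Re s) < r'" using that r' by (simp add: \<sigma>1_def) (metis exp_less_cancel_iff exp_ln)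
    have "ln r' \<le> ln r" using r' r by (subst ln_le_cancel_iff) auto
    then show "Re s < ln r" using that by (simp add: \<sigma>1_def)
    have "exp (Re s) \<le> 1" using e r' r by linarith
    then have "exp (Re s) ^ 2 \<le> exp (Re s) ^ 1" by (intro power_decreasing) simp_all
    then show "norm ((exp s)\<^sup>2) < d" using e r' by (simp add: norm_power)
  qed
  have "\<exists>C. \<forall>s. Re s \<le> \<sigma>1 - 1 \<longrightarrow> \<bar>Im s\<bar> \<le> 4 \<longrightarrow> (norm (F s))\<^sup>2 \<le> C * exp (- 2 * Re s)"
  proof (rule square_one_growth[where T = "smul 2 (b 0)" and E = E and ?\<sigma>1.0 = \<sigma>1 and K = "2 * (1 + norm (deriv_mat b 0))"])
    show "has_mderiv F (F s ** (smul 2 (b 0) + E s)) s" if "Re s < \<sigma>1" for s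
      using dF[OF H1(1)[OF that]] by (simp add: E_def)
    show "norm (E s) \<le> 2 * (1 + norm (deriv_mat b 0)) * exp (2 * Re s)" if s: "Re s < \<sigma>1" for s
    proof -
      let ?w = "(exp s)\<^sup>2"
      have "norm (b ?w - b 0) \<le> norm (b ?w - b 0 - smul ?w (deriv_mat b 0)) + norm (smul ?w (deriv_mat b 0))"
        by (metis diff_add_cancel norm_triangle_ineq)
      also have "\<dots> \<le> norm ?w + norm ?w * norm (deriv_mat b 0)"
        using d(2)[OF H1(2)[OF s]] by (simp add: norm_smul)
      finally have "norm (smul 2 (b ?w - b 0)) \<le> 2 * (1 + norm (deriv_mat b 0)) * norm ?w"
        by (simp add: norm_smul algebra_simps)
      also have "norm ?w = exp (2 * Re s)" by (simp add: norm_power exp_double)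
      finally show ?thesis by (simp add: E_def smul_diff)
    qed
  qed (use T in simp_all)
  then obtain C where C: "\<And>s. Re s \<le> \<sigma>1 - 1 \<Longrightarrow> \<bar>Im s\<bar> \<le> 4 \<Longrightarrow> (norm (F s))\<^sup>2 \<le> C * exp (- 2 * Re s)" by blast
  have "isCont a 0" using a by (rule has_mderiv_imp_continuous)
  then have "((\<lambda>w. norm (a w)) \<longlongrightarrow> norm (a 0)) (at 0)" unfolding isCont_def by (rule tendsto_norm)
  then have ev_a: "\<forall>\<^sub>F w in at 0. norm (a w) < norm (a 0) + 1" by (rule order_tendstoD) simp
  have ev_w: "\<forall>\<^sub>F w in at 0. w \<in> ball 0 (exp (2 * (\<sigma>1 - 1))) - {0 :: complex}"
    by (rule eventually_at_in_open) auto
  define M where "M = \<bar>C\<bar> * (norm (a 0) + 1)"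
  have "\<forall>\<^sub>F w in at 0. norm (\<beta> w) \<le> M / norm w ^ 2"
    using ev_a ev_w
  proof eventually_elim
    case (elim w)
    then have w: "w \<noteq> 0" "norm w < exp (2 * (\<sigma>1 - 1))" by auto
    define s where "s = Ln w / 2"
    have "ln (norm w) < 2 * (\<sigma>1 - 1)" using w by (metis exp_less_cancel_iff exp_ln zero_less_norm_iff)
    then have s: "Re s \<le> \<sigma>1 - 1" "Re s < \<sigma>1" using half_Ln(2)[OF w(1)] by (auto simp: s_def)
    have sw: "w = (exp s)\<^sup>2" using half_Ln(1)[OF w(1)] by (simp add: s_def)
    have nw: "exp (- 2 * Re s) = 1 / norm w"
      using half_Ln(2)[OF w(1)] w(1) by (simp add: s_def exp_minus inverse_eq_divide)
    have Fb: "(norm (F s))\<^sup>2 \<le> \<bar>C\<bar> / norm w"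
    proof -
      have "(norm (F s))\<^sup>2 \<le> C * (1 / norm w)"
        using C[OF s(1) half_Ln(3)[OF w(1), folded s_def]] unfolding nw .
      also have "\<dots> \<le> \<bar>C\<bar> * (1 / norm w)" by (intro mult_right_mono) auto
      finally show ?thesis by simp
    qed
    have "norm (F s ** a w ** adjugate (F s)) \<le> norm (F s) * norm (a w) * norm (F s)"
      by (rule order_trans[OF norm_mult_le]) (simp add: norm_adjugate mult_right_mono norm_mult_le)
    also have "\<dots> = (norm (F s))\<^sup>2 * norm (a w)" by (simp add: power2_eq_square)
    also have "\<dots> \<le> (\<bar>C\<bar> / norm w) * (norm (a 0) + 1)"
      using Fb elim(1) by (intro mult_mono) auto
    finally have X: "norm (F s ** a w ** adjugate (F s)) \<le> (\<bar>C\<bar> / norm w) * (norm (a 0) + 1)" .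
    have "norm (\<beta> w) = norm (1 / w) * norm (F s ** a w ** adjugate (F s))"
      unfolding rel[OF H1(1)[OF s(2)], folded sw] by (rule norm_smul)
    also have "\<dots> \<le> norm (1 / w) * ((\<bar>C\<bar> / norm w) * (norm (a 0) + 1))"
      using X by (rule mult_left_mono) simp
    also have "\<dots> = M / norm w ^ 2" by (simp add: M_def norm_divide power2_eq_square)
    finally show ?case .
  qed
  then show ?thesis by blast
qed

text \<open>
  The coefficient of the null form with respect to ds is the conjugate of A by F. Its product with its own derivative
  is computed once on the sphere, where it is the Hopf coefficient times a square, and once through F, where it is the
  conjugate of the left hand side.
\<close>

lemma hopf_of_conjugate:
  assumes \<alpha>: "null_curve \<alpha>" and S: "open S" "s \<in> S"
    and z: "z holomorphic_on S" "z s \<in> punctured_sphere"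
    and eq: "\<And>s. s \<in> S \<Longrightarrow> smul (deriv z s) (\<alpha> (z s)) = F s ** A s ** adjugate (F s)"
    and dF: "has_mderiv F (F s ** B) s" and detF: "det (F s) = 1" and dA: "has_mderiv A A' s"
  shows "A s ** A' + A s ** B ** A s = smul ((deriv z s)\<^sup>2 * hopf \<alpha> (z s)) (A s)"
proof -
  let ?G = "adjugate (F s)" and ?m = "deriv z s" and ?m' = "deriv (deriv z) s"
  note D\<alpha> = null_curve_deriv[OF \<alpha> z(2)] and h = null_curve_hopf(1)[OF \<alpha> z(2)]
  have right: "has_mderiv (\<lambda>s. F s ** A s ** adjugate (F s))
      (F s ** A s ** adjugate (F s ** B) + (F s ** A' + F s ** B ** A s) ** ?G) s"
    by (intro has_mderiv_mult has_mderiv_adjugate dF dA)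
  have "has_mderiv (\<lambda>s. smul (deriv z s) (\<alpha> (z s))) (smul ?m (smul ?m (deriv_mat \<alpha> (z s))) + smul ?m' (\<alpha> (z s))) s"
    using z(1) S by (intro has_mderiv_smul has_mderiv_compose[where F = \<alpha> and g = z, OF D\<alpha>] holomorphic_derivI[OF holomorphic_deriv] holomorphic_derivI) auto
  then have "has_mderiv (\<lambda>s. F s ** A s ** adjugate (F s)) (smul ?m (smul ?m (deriv_mat \<alpha> (z s))) + smul ?m' (\<alpha> (z s))) s"
    by (rule has_mderiv_cong[OF _ S]) (rule eq)
  from has_mderiv_unique[OF right this]
  have D: "F s ** A s ** adjugate (F s ** B) + (F s ** A' + F s ** B ** A s) ** ?G
     = smul ?m (smul ?m (deriv_mat \<alpha> (z s))) + smul ?m' (\<alpha> (z s))" .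
  have Finv: "?G ** F s = mat 1" "\<And>M. (M :: cmat) ** ?G ** F s = M"
    using detF by (auto simp: mult_adjugate_cancel)
  have nil: "\<alpha> (z s) ** \<alpha> (z s) = 0" using \<alpha> z(2) by (simp add: null_curve_def)
  have unconj: "M = N" if "F s ** M ** ?G = F s ** N ** ?G" for M N
  proof -
    have "?G ** (F s ** M ** ?G) ** F s = ?G ** (F s ** N ** ?G) ** F s" by (simp only: that)
    then show ?thesis by (simp add: matrix_mul_assoc Finv)
  qed
  have "F s ** (A s ** A s) ** ?G = (F s ** A s ** ?G) ** (F s ** A s ** ?G)"
    by (simp add: matrix_mul_assoc Finv)
  also have "\<dots> = F s ** 0 ** ?G" unfolding eq[OF S(2), symmetric] by (simp add: nil)
  finally have AA: "A s ** A s = 0" by (rule unconj)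
  have "F s ** (A s ** A' + A s ** B ** A s) ** ?G
     = (F s ** A s ** ?G) ** (F s ** A s ** adjugate (F s ** B) + (F s ** A' + F s ** B ** A s) ** ?G)
       - F s ** (A s ** A s) ** adjugate (F s ** B)"
    by (simp add: mm.add_left mm.add_right matrix_mul_assoc Finv)
  also have "\<dots> = F s ** smul (?m\<^sup>2 * hopf \<alpha> (z s)) (A s) ** ?G"
    unfolding D AA smul_mult_right smul_mult_left eq[OF S(2), symmetric]
    by (simp add: mm.add_right nil h power2_eq_square mult_ac)
  finally show ?thesis by (rule unconj)
qed

text \<open>
  At w = 0 the relation between the conjugated null form and its derivative reduces to the assumption on the
  product a 0 b 0 a 0; a nonzero entry of a 0 isolates the scalar.
\<close>

lemma hopf_leading_coefficient:
  assumes \<alpha>: "null_curve \<alpha>" and r: "0 < r" "r \<le> 1"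
    and ab: "holo_mat a (ball 0 r)" "holo_mat b (ball 0 r)"
    and res: "a 0 \<noteq> 0" "a 0 ** b 0 ** a 0 = smul q (a 0)"
    and dF: "\<And>s. Re s < ln r \<Longrightarrow> has_mderiv F (F s ** smul 2 (b ((exp s)\<^sup>2))) s"
    and detF: "\<And>s. Re s < ln r \<Longrightarrow> det (F s) = 1"
    and rel: "\<And>s. Re s < ln r \<Longrightarrow> smul (deriv (chart k) ((exp s)\<^sup>2)) (\<alpha> (chart k ((exp s)\<^sup>2)))
      = smul (1 / (exp s)\<^sup>2) (F s ** a ((exp s)\<^sup>2) ** adjugate (F s))"
  shows "((\<lambda>w. w\<^sup>2 * (deriv (chart k) w)\<^sup>2 * hopf \<alpha> (chart k w)) \<longlongrightarrow> q) (at 0)"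
proof -
  define h where "h w = w\<^sup>2 * (deriv (chart k) w)\<^sup>2 * hopf \<alpha> (chart k w)" for w
  have hopf_rel: "a w ** b w ** a w + smul w (a w ** deriv_mat a w) = smul (h w) (a w)"
    if s: "Re s < ln r" and w: "w = (exp s)\<^sup>2" for s w
  proof -
    let ?H = "{s. Re s < ln r}" and ?z = "\<lambda>s. chart k ((exp s)\<^sup>2)"
    have disc: "(exp s)\<^sup>2 \<in> ball 0 r - {0}" if "Re s < ln r" for s
    proof -
      have e: "exp (Re s) < r" using that r by (metis exp_less_cancel_iff exp_ln)
      then have "exp (Re s) \<le> 1" using r by linarith
      then have "exp (Re s) ^ 2 \<le> exp (Re s) ^ 1" by (intro power_decreasing) simp_all
      then show ?thesis using e by (simp add: norm_power)
    qed
    have dz: "(?z has_field_derivative deriv (chart k) ((exp s)\<^sup>2) * (2 * (exp s)\<^sup>2)) (at s)" for s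
      by (rule DERIV_chain2[OF chart_deriv(1)]) (auto intro!: derivative_eq_intros simp: power2_eq_square)
    have oH: "open ?H" by (rule open_halfspace_Re_lt)
    define AA where "AA s = smul 2 (a ((exp s)\<^sup>2))" for s
    have dA: "has_mderiv AA (smul (4 * w) (deriv_mat a w)) s"
    proof -
      have 1: "has_mderiv a (deriv_mat a w) ((exp s)\<^sup>2)"
        using holo_mat_has_mderiv[OF ab(1) open_ball] disc[OF s] w by simp
      have 2: "((\<lambda>s. (exp s)\<^sup>2) has_field_derivative 2 * w) (at s)"
        by (auto intro!: derivative_eq_intros simp: w power2_eq_square)
      show ?thesis
        using has_mderiv_smul[OF DERIV_const[of 2] has_mderiv_compose[OF 1 2]] by (simp add: AA_def[abs_def])
    qed
    have "AA s ** smul (4 * w) (deriv_mat a w) + AA s ** smul 2 (b w) ** AA s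
        = smul ((deriv ?z s)\<^sup>2 * hopf \<alpha> (?z s)) (AA s)"
    proof (rule hopf_of_conjugate[OF \<alpha> oH, where F = F])
      show "?z holomorphic_on ?H" using dz by (auto simp: holomorphic_on_open[OF oH])
      show "?z s \<in> punctured_sphere" using chart_in_sphere[of "(exp s)\<^sup>2"] disc[OF s] r by auto
      show "smul (deriv ?z s) (\<alpha> (?z s)) = F s ** AA s ** adjugate (F s)" if "s \<in> ?H" for s
      proof -
        have "smul (deriv ?z s) (\<alpha> (?z s)) = smul (2 * (exp s)\<^sup>2) (smul (deriv (chart k) ((exp s)\<^sup>2)) (\<alpha> (?z s)))"
          unfolding DERIV_imp_deriv[OF dz] by (simp add: mult.commute)
        also have "\<dots> = F s ** AA s ** adjugate (F s)"
          using that by (simp only: rel mem_Collect_eq) (simp add: AA_def)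
        finally show ?thesis .
      qed
    qed (use s dF[OF s] detF[OF s] dA w in auto)
    then have "smul 8 (a w ** b w ** a w + smul w (a w ** deriv_mat a w)) = smul 8 (smul (h w) (a w))"
      unfolding DERIV_imp_deriv[OF dz] AA_def h_def w[symmetric]
      by (simp add: smul_add power_mult_distrib mult_ac add.commute)
    then have "smul (1/8) (smul 8 (a w ** b w ** a w + smul w (a w ** deriv_mat a w))) = smul (1/8) (smul 8 (smul (h w) (a w)))"
      by simp
    then show ?thesis by simp
  qed
  have ln_half: "ln (norm w) / 2 < ln r" if "w \<in> ball 0 (r\<^sup>2) - {0}" for w :: complex
  proof -
    have "ln (norm w) < ln (r\<^sup>2)" using that r by (subst ln_less_cancel_iff) auto
    then show ?thesis using r by (simp add: ln_realpow)
  qed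
  obtain i j where ij: "a 0 $ i $ j \<noteq> 0" using res(1) by (auto simp: vec_eq_iff)
  define M where "M w = a w ** b w ** a w + smul w (a w ** deriv_mat a w)" for w
  have "holo_mat (deriv_mat a) (ball 0 r)"
    using ab(1) by (auto simp: holo_mat_def deriv_mat_def intro!: holomorphic_deriv)
  then have "continuous_on (ball 0 r) M"
    unfolding M_def[abs_def]
    by (intro continuous_mult continuous_on_add continuous_on_id holo_mat_continuous_on ab open_ball)
  then have "isCont (\<lambda>w. M w $ i $ j) 0"
    using continuous_mult(5)[of "ball 0 r" M] r by (simp add: continuous_on_eq_continuous_at)
  moreover have "isCont (\<lambda>w. a w $ i $ j) 0"
    using continuous_mult(5)[OF holo_mat_continuous_on[OF ab(1) open_ball], of i j] r by (simp add: continuous_on_eq_continuous_at)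
  ultimately have lim: "((\<lambda>w. M w $ i $ j / a w $ i $ j) \<longlongrightarrow> M 0 $ i $ j / a 0 $ i $ j) (at 0)"
    using ij unfolding isCont_def by (intro tendsto_divide)
  have M0: "M 0 $ i $ j / a 0 $ i $ j = q" using ij by (simp add: M_def res(2))
  have "\<forall>\<^sub>F w in at 0. M w $ i $ j / a w $ i $ j = h w"
  proof -
    have "\<forall>\<^sub>F w in at 0. a w $ i $ j \<noteq> 0"
      using \<open>isCont (\<lambda>w. a w $ i $ j) 0\<close> ij unfolding isCont_def by (rule tendsto_imp_eventually_ne)
    moreover have "\<forall>\<^sub>F w in at 0. w \<in> ball 0 (r\<^sup>2) - {0 :: complex}"
      using r by (intro eventually_at_in_open) auto
    ultimately show ?thesis
    proof eventually_elim
      case (elim w)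
      then have "M w = smul (h w) (a w)"
        unfolding M_def using hopf_rel[of "Ln w / 2" w] half_Ln(1,2)[of w] ln_half[of w] by auto
      then show ?case using elim by simp
    qed
  qed
  from Lim_transform_eventually[OF lim this] show ?thesis unfolding M0 h_def .
qed

lemma trinoid_weight: "trinoid_from X A B U p \<Phi> f q \<Longrightarrow> has_weight A B k (q k)"
  by (auto simp: trinoid_from_def)

context trinoid_frame
begin

lemma null_curve_null_form: "null_curve \<alpha>"
  using holo_null_form null_form_nilpotent null_form_nonzero[OF immersion]
  by (auto simp: null_curve_def)

text \<open>
  With t = exp s the punctured disc of the gauge becomes a half-plane H, which is simply connected, so the
  map to the sphere lifts to the universal cover. Along the lift, the frame at 0 times the gauge is a
  function F on H. Its logarithmic derivative is the gauged potential at 0, and it conjugates the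
  holomorphic part a of the gauged potential to the null form.
\<close>

lemma gauged_frame_at_puncture:
  obtains r F a b where "0 < r" "r \<le> 1" "holo_mat a (ball 0 r)" "holo_mat b (ball 0 r)"
    "a 0 \<noteq> 0" "a 0 ** b 0 ** a 0 = smul (q k) (a 0)" "smul 2 (b 0) ** smul 2 (b 0) = mat 1"
    "\<And>s. Re s < ln r \<Longrightarrow> has_mderiv F (F s ** smul 2 (b ((exp s)\<^sup>2))) s"
    "\<And>s. Re s < ln r \<Longrightarrow> det (F s) = 1"
    "\<And>s. Re s < ln r \<Longrightarrow> smul (deriv (chart k) ((exp s)\<^sup>2)) (\<alpha> (chart k ((exp s)\<^sup>2)))
      = smul (1 / (exp s)\<^sup>2) (F s ** a ((exp s)\<^sup>2) ** adjugate (F s))"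
proof -
  obtain r g a b where r: "0 < r" "r \<le> 1" and g: "holo_mat g (ball 0 r - {0})"
    "\<And>t. t \<in> ball 0 r - {0} \<Longrightarrow> det (g t) = 1"
    and ab: "holo_mat a (ball 0 r)" "holo_mat b (ball 0 r)"
    and gA: "\<And>t. t \<in> ball 0 r - {0} \<Longrightarrow> smul (deriv (\<lambda>s. chart k (s\<^sup>2)) t) (A (chart k (t\<^sup>2)))
        = smul (2 / t) (g t ** a (t\<^sup>2) ** adjugate (g t))"
    and gB: "\<And>t. t \<in> ball 0 r - {0} \<Longrightarrow> smul (deriv (\<lambda>s. chart k (s\<^sup>2)) t) (B (chart k (t\<^sup>2)))
        = smul (2 / t) (g t ** b (t\<^sup>2) ** adjugate (g t)) - deriv_mat g t ** adjugate (g t)"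
    and res: "a 0 \<noteq> 0" "a 0 ** b 0 ** a 0 = smul (q k) (a 0)" "smul 2 (b 0) ** smul 2 (b 0) = mat 1"
    using has_weight_normal_form[OF trinoid_weight[OF trinoid, of k]] by metis
  define D where "D = ball 0 r - {0 :: complex}"
  have oD: "open D" by (auto simp: D_def)
  define c where "c t = chart k (t\<^sup>2)" for t
  define c' where "c' t = deriv (\<lambda>s. chart k (s\<^sup>2)) t" for t
  have sqD: "t\<^sup>2 \<in> ball 0 r - {0}" if "t \<in> D" for t :: complex
  proof -
    have "norm t ^ 2 \<le> norm t ^ 1" by (rule power_decreasing) (use that r in \<open>auto simp: D_def\<close>)
    then show ?thesis using that by (auto simp: norm_power D_def)
  qed
  have t0: "t \<noteq> 0" if "t \<in> D" for t using that by (auto simp: D_def)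
  have D0: "0 \<notin> D" by (simp add: D_def)
  have dc: "(c has_field_derivative deriv (chart k) (t\<^sup>2) * (2 * t)) (at t)" if "t \<in> D" for t
    unfolding c_def[abs_def]
    by (rule DERIV_chain2[OF chart_deriv(1)]) (use t0[OF that] in \<open>auto intro!: derivative_eq_intros\<close>)
  have c'_eq: "c' t = deriv (chart k) (t\<^sup>2) * (2 * t)" if "t \<in> D" for t
    using DERIV_imp_deriv[OF dc[OF that]] by (simp add: c'_def c_def[abs_def])
  have c'0: "c' t \<noteq> 0" if "t \<in> D" for t
    using c'_eq[OF that] chart_deriv(2)[of "t\<^sup>2" k] t0[OF that] by simp
  have dc': "(c has_field_derivative c' t) (at t)" if "t \<in> D" for t using dc c'_eq that by metis
  have holc: "c holomorphic_on D" using dc' by (auto simp: holomorphic_on_open[OF oD])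
  have holc': "c' holomorphic_on D"
    using holomorphic_deriv[OF holc oD] by (simp add: c_def[abs_def] c'_def[abs_def])
  have cPS: "c t \<in> punctured_sphere" if "t \<in> D" for t
    unfolding c_def by (rule chart_in_sphere) (use sqD[OF that] r in auto)
  have inv: "g t ** adjugate (g t) = mat 1" "adjugate (g t) ** g t = mat 1"
      "\<And>M. (M :: cmat) ** g t ** adjugate (g t) = M" "\<And>M. (M :: cmat) ** adjugate (g t) ** g t = M"
    if "t \<in> D" for t
    using g(2)[of t] that by (auto simp: mult_adjugate_cancel D_def)
  have hol2: "(\<lambda>t. F (t\<^sup>2) $ i $ j) holomorphic_on D" if "holo_mat F (ball 0 r)" for F :: "complex \<Rightarrow> cmat" and i j
  proof -
    have "(\<lambda>w. F w $ i $ j) holomorphic_on ball 0 r" using that by (simp add: holo_mat_def)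
    then show ?thesis
    proof (rule holomorphic_on_compose_gen[rotated, of _ _ "\<lambda>t. t\<^sup>2" D, unfolded o_def])
      show "(\<lambda>t. t\<^sup>2) ` D \<subseteq> ball 0 r" using sqD by (metis Diff_iff image_subsetI)
    qed (intro holomorphic_intros)
  qed
  \<comment> \<open>The gauge equation expresses the potential near the puncture through functions that are holomorphic on the
    punctured disc, so its poles do not accumulate at the puncture.\<close>
  have cR: "c t \<in> regular_base" if t: "t \<in> D" for t
  proof -
    have ent: "(\<lambda>t. F (c t) $ i $ j) holomorphic_on D"
      if eq: "\<And>t. t \<in> D \<Longrightarrow> smul (c' t) (F (c t)) = G t" and G: "\<And>i j. (\<lambda>t. G t $ i $ j) holomorphic_on D"
      for F G :: "complex \<Rightarrow> cmat" and i j
    proof -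
      have "(\<lambda>t. G t $ i $ j / c' t) holomorphic_on D"
        using G holc' c'0 by (intro holomorphic_intros) auto
      moreover have "G t $ i $ j / c' t = F (c t) $ i $ j" if "t \<in> D" for t
        using eq[OF that, symmetric] c'0[OF that] by simp
      ultimately show ?thesis by (rule holomorphic_transform)
    qed
    have gh: "(\<lambda>t. g t $ i $ j) holomorphic_on D" for i j
      using g(1) by (simp add: holo_mat_def D_def)
    have adjh: "(\<lambda>t. adjugate (g t) $ i $ j) holomorphic_on D" for i j
      using exhaust_2[of i] exhaust_2[of j] gh by (auto intro!: holomorphic_intros)
    have dgh: "(\<lambda>t. deriv_mat g t $ i $ j) holomorphic_on D" for i j
      using holomorphic_deriv[OF gh oD] by (simp add: deriv_mat_def)
    have "(\<lambda>t. A (c t) $ i $ j) holomorphic_on D" for i j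
      by (rule ent[OF gA[folded c_def c'_def D_def]])
        (auto simp: mult_entry D0 intro!: holomorphic_intros gh adjh hol2[OF ab(1)])
    moreover have "(\<lambda>t. B (c t) $ i $ j) holomorphic_on D" for i j
      by (rule ent[OF gB[folded c_def c'_def D_def]])
        (auto simp: mult_entry D0 intro!: holomorphic_intros gh adjh dgh hol2[OF ab(2)])
    moreover have "deriv c t \<noteq> 0" using DERIV_imp_deriv[OF dc'[OF t]] c'0[OF t] by simp
    ultimately have "analytic_mat_at A (c t)" "analytic_mat_at B (c t)"
      unfolding analytic_mat_at_def using analytic_on_image[OF holc oD t] by auto
    then show ?thesis using cPS[OF t] by (simp add: regular_base_def poles_def)
  qed
  define H where "H = {s. Re s < ln r}"
  have expH: "exp s \<in> D" if "s \<in> H" for s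
    using that r by (simp add: D_def H_def) (metis exp_less_cancel_iff exp_ln)
  have oH: "open H" unfolding H_def by (rule open_halfspace_Re_lt)
  have "convex H" unfolding H_def by (rule convex_halfspace_Re_lt)
  then have scH: "simply_connected H" by (rule convex_imp_simply_connected)
  define zf where "zf s = c (exp s)" for s
  have dzf: "(zf has_field_derivative c' (exp s) * exp s) (at s)" if "s \<in> H" for s
    unfolding zf_def[abs_def] by (rule DERIV_chain2[OF dc'[OF expH[OF that]] DERIV_exp])
  have holzf: "zf holomorphic_on H" using dzf by (auto simp: holomorphic_on_open[OF oH])
  have zfPS: "zf \<in> H \<rightarrow> punctured_sphere" using cPS expH by (auto simp: zf_def)
  obtain l where l: "l holomorphic_on H" "l \<in> H \<rightarrow> U" "\<And>s. s \<in> H \<Longrightarrow> p (l s) = zf s"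
    using covering_space_lift_holomorphic[OF U_facts(4,1,3) holzf zfPS scH open_imp_locally_path_connected[OF oH]] by metis
  have lreg: "l s \<in> reg" if "s \<in> H" for s
    using l(2,3) cR expH that by (auto simp: reg_iff zf_def)
  have dl: "deriv p (l s) * deriv l s = c' (exp s) * exp s" if s: "s \<in> H" for s
  proof -
    have "(l has_field_derivative deriv l s) (at s)" using l(1) oH s by (rule holomorphic_derivI)
    from DERIV_chain2[OF deriv_p[OF reg_imp_U[OF lreg[OF s]]] this]
    have "((\<lambda>s. p (l s)) has_field_derivative deriv p (l s) * deriv l s) (at s)" .
    then have "(zf has_field_derivative deriv p (l s) * deriv l s) (at s)"
      by (rule has_field_derivative_transform_within_open[OF _ oH s]) (rule l(3))
    then show ?thesis using DERIV_unique dzf[OF s] by blast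
  qed
  define F where "F s = \<Phi> (l s) 0 ** g (exp s)" for s
  have detF: "det (F s) = 1" if "s \<in> H" for s
    using frame_facts(1)[OF lreg[OF that]] g(2)[of "exp s"] expH[OF that] by (simp add: F_def det_mul D_def)
  have dF: "has_mderiv F (F s ** smul 2 (b ((exp s)\<^sup>2))) s" if s: "s \<in> H" for s
  proof -
    let ?t = "exp s" and ?P = "\<Phi> (l s) 0" 
    have t: "?t \<in> D" by (rule expH[OF s])
    have "(l has_field_derivative deriv l s) (at s)" using l(1) oH s by (rule holomorphic_derivI)
    from has_mderiv_compose[OF frame_facts(2)[OF lreg[OF s], of 0] this]
    have 1: "has_mderiv (\<lambda>s. \<Phi> (l s) 0) (smul (c' ?t * ?t) (?P ** B (c ?t))) s"
      using dl[OF s] by (simp add: potential_def l(3)[OF s] zf_def mult.commute[of "deriv l s"])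
    have "has_mderiv g (deriv_mat g ?t) ?t" using holo_mat_has_mderiv[OF g(1)] oD t by (simp add: D_def)
    from has_mderiv_compose[OF this DERIV_exp]
    have 2: "has_mderiv (\<lambda>s. g (exp s)) (smul ?t (deriv_mat g ?t)) s" .
    have 3: "smul (c' ?t) (B (c ?t)) = smul (2 / ?t) (g ?t ** b (?t\<^sup>2) ** adjugate (g ?t)) - deriv_mat g ?t ** adjugate (g ?t)"
      using gB[of ?t] t by (simp add: c_def c'_def D_def)
    have "has_mderiv F (?P ** smul ?t (deriv_mat g ?t) + smul (c' ?t * ?t) (?P ** B (c ?t)) ** g ?t) s"
      unfolding F_def[abs_def] by (rule has_mderiv_mult[OF 1 2])
    also have "smul (c' ?t * ?t) (?P ** B (c ?t)) ** g ?t = smul ?t (?P ** smul (c' ?t) (B (c ?t)) ** g ?t)"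
      by (simp add: mult.commute)
    also have "\<dots> = smul 2 (?P ** g ?t ** b (?t\<^sup>2)) - smul ?t (?P ** deriv_mat g ?t)"
      unfolding 3 by (simp add: mm.diff_left mm.diff_right matrix_mul_assoc inv[OF t] smul_diff)
    finally show ?thesis by (simp add: F_def[abs_def])
  qed
  have rel: "smul (deriv (chart k) ((exp s)\<^sup>2)) (\<alpha> (chart k ((exp s)\<^sup>2)))
      = smul (1 / (exp s)\<^sup>2) (F s ** a ((exp s)\<^sup>2) ** adjugate (F s))" if s: "s \<in> H" for s
  proof -
    let ?t = "exp s"
    have t: "?t \<in> D" by (rule expH[OF s])
    have "smul (c' ?t) (\<alpha> (c ?t)) = \<Phi> (l s) 0 ** smul (c' ?t) (A (c ?t)) ** adjugate (\<Phi> (l s) 0)"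
      using null_form_frame[OF lreg[OF s]] l(3)[OF s] by (simp add: frame_form_def zf_def)
    also have "smul (c' ?t) (A (c ?t)) = smul (2 / ?t) (g ?t ** a (?t\<^sup>2) ** adjugate (g ?t))"
      using gA[of ?t] t by (simp add: c_def c'_def D_def)
    finally have "smul (1 / (2 * ?t)) (smul (c' ?t) (\<alpha> (c ?t)))
        = smul (1 / (2 * ?t)) (smul (2 / ?t) (F s ** a (?t\<^sup>2) ** adjugate (F s)))"
      by (simp add: F_def matrix_mul_assoc)
    then show ?thesis by (simp add: c'_eq[OF t] c_def power2_eq_square)
  qed
  show thesis
    by (rule that[OF r ab res]) (use dF detF rel in \<open>auto simp: H_def\<close>)
qed

proposition weighted_end_null_form: "weighted_end \<alpha> k (q k)"
proof (rule gauged_frame_at_puncture[of k])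
  fix r :: real and F a b
  assume g: "0 < r" "r \<le> 1" "holo_mat a (ball 0 r)" "holo_mat b (ball 0 r)"
    "a 0 \<noteq> 0" "a 0 ** b 0 ** a 0 = smul (q k) (a 0)" "smul 2 (b 0) ** smul 2 (b 0) = mat 1"
    "\<And>s. Re s < ln r \<Longrightarrow> has_mderiv F (F s ** smul 2 (b ((exp s)\<^sup>2))) s"
    "\<And>s. Re s < ln r \<Longrightarrow> det (F s) = 1"
    "\<And>s. Re s < ln r \<Longrightarrow> smul (deriv (chart k) ((exp s)\<^sup>2)) (\<alpha> (chart k ((exp s)\<^sup>2)))
      = smul (1 / (exp s)\<^sup>2) (F s ** a ((exp s)\<^sup>2) ** adjugate (F s))"
  show ?thesis
    unfolding weighted_end_def
    using double_pole_bound[where \<beta> = "\<lambda>w. smul (deriv (chart k) w) (\<alpha> (chart k w))", OF g(1-4,7,8,10)]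
      hopf_leading_coefficient[OF null_curve_null_form g(1-6,8,9,10)] by blast
qed

end

section \<open>Monodromy\<close>

text \<open>
  A matrix that commutes with N is a combination of N and the identity, and N does not commute with D.
\<close>

lemma null_curve_commutant:
  assumes "N ** N = 0" "trace N = 0" "N \<noteq> 0" "trace D = 0" "N ** D = smul Q N" "Q \<noteq> 0"
    and "M ** N = N ** M" "M ** D = D ** M"
  shows "M = smul (M$1$1) (mat 1)"
proof -
  define a b c where abc: "a = N$1$1" "b = N$1$2" "c = N$2$1"
  have N: "N$1$1 = a" "N$1$2 = b" "N$2$1 = c" "N$2$2 = - a"
    using assms(2) by (auto simp: trace_entry add_eq_0_iff abc)
  define a' b' c' where abc': "a' = D$1$1" "b' = D$1$2" "c' = D$2$1"
  have D: "D$1$1 = a'" "D$1$2 = b'" "D$2$1 = c'" "D$2$2 = - a'"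
    using assms(4) by (auto simp: trace_entry add_eq_0_iff abc')
  define d x y where dxy: "d = M$1$1 - M$2$2" "x = M$1$2" "y = M$2$1"
  have sq: "a * a + b * c = 0" using assms(1) by (simp add: cmat_expand N)
  have Qb: "Q * b = a * b' - b * a'" and Qc: "Q * c = c * a' - a * c'"
    and Qa: "Q * a = a * a' + b * c'" "- (Q * a) = c * b' + a * a'"
    using assms(5) by (simp_all add: cmat_expand N D algebra_simps)
  have comm: "x * \<gamma> = \<beta> * y" "d * \<beta> = 2 * (\<alpha> * x)" "d * \<gamma> = 2 * (\<alpha> * y)"
    if L: "M ** L = L ** M" "L$1$1 = \<alpha>" "L$1$2 = \<beta>" "L$2$1 = \<gamma>" "L$2$2 = - \<alpha>" for L \<alpha> \<beta> \<gamma>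
  proof -
    have "M$1$1 * \<alpha> + x * \<gamma> = \<alpha> * M$1$1 + \<beta> * y" "M$1$1 * \<beta> + x * (- \<alpha>) = \<alpha> * x + \<beta> * M$2$2"
      "y * \<alpha> + M$2$2 * \<gamma> = \<gamma> * M$1$1 + (- \<alpha>) * y"
      using arg_cong[OF L(1), of "\<lambda>K. K$1$1"] arg_cong[OF L(1), of "\<lambda>K. K$1$2"] arg_cong[OF L(1), of "\<lambda>K. K$2$1"]
      unfolding mult_entry L(2-5) dxy .
    then show "x * \<gamma> = \<beta> * y" "d * \<beta> = 2 * (\<alpha> * x)" "d * \<gamma> = 2 * (\<alpha> * y)"
      unfolding dxy(1) by algebra+
  qed
  note m = comm[OF assms(7) N] comm[OF assms(8) D]
  have bc: "b \<noteq> 0 \<or> c \<noteq> 0" using sq assms(3) by (auto simp: cmat_eq_iff N)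
  have "Q * (d * b) = 0" "Q * (d * c) = 0" using m Qb Qc by algebra+
  then have d: "d = 0" using assms(6) bc by auto
  have "Q * (x * b) = 0" "Q * (y * b) = 0" "Q * (y * c) = 0" "Q * (x * c) = 0"
    using m Qb Qc Qa d by algebra+
  then have "x = 0" "y = 0" using assms(6) bc by auto
  with d have "d = 0" "x = 0" "y = 0" by auto
  then show ?thesis by (simp add: cmat_eq_iff dxy)
qed

lemma singular_column_multiple:
  fixes K :: cmat
  assumes "det K = 0" and v: "v = (\<chi> i. K $ i $ j)" "v \<noteq> 0"
  shows "\<exists>c. (\<chi> i. K $ i $ l) = c *s v"
proof (cases "v $ 1 = 0")
  case True
  then have "v $ 2 \<noteq> 0" using v(2) by (auto simp: vec_eq_iff forall_2)
  then show ?thesis using assms(1) True exhaust_2[of j] exhaust_2[of l]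
    by (intro exI[of _ "K $ 2 $ l / v $ 2"]) (auto simp: v(1) vec_eq_iff forall_2 det_2 field_simps)
next
  case False
  then show ?thesis using assms(1) exhaust_2[of j] exhaust_2[of l]
    by (intro exI[of _ "K $ 1 $ l / v $ 1"]) (auto simp: v(1) vec_eq_iff forall_2 det_2 field_simps)
qed

text \<open>
  The Schur lemma: if P is not scalar then, for an eigenvalue c, the image of the singular matrix K = P - c is an
  invariant line.
\<close>

lemma irreducible_commutant:
  assumes irr: "irreducible_mats S" and comm: "\<And>M. M \<in> S \<Longrightarrow> M ** P = P ** M"
  shows "\<exists>c. P = smul c (mat 1)"
proof (rule ccontr)
  assume no: "\<nexists>c. P = smul c (mat 1)"
  define t where "t = P$1$1 + P$2$2"
  define c where "c = (t + csqrt (t\<^sup>2 - 4 * det P)) / 2"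
  define K where "K = P - smul c (mat 1)"
  have "2 * c - t = csqrt (t\<^sup>2 - 4 * det P)" by (simp add: c_def field_simps)
  then have "(2 * c - t)\<^sup>2 = t\<^sup>2 - 4 * det P" by simp
  then have "4 * (c\<^sup>2 - t * c + det P) = 0" by (simp add: power2_eq_square algebra_simps)
  then have "c\<^sup>2 - t * c + det P = 0" by (simp only: mult_eq_0_iff) simp
  then have detK: "det K = 0" by (simp add: K_def det_2 t_def power2_eq_square algebra_simps)
  have "K \<noteq> 0" using no by (auto simp: K_def)
  then obtain i j where "K $ i $ j \<noteq> 0" by (auto simp: vec_eq_iff)
  define v where "v = (\<chi> i. K $ i $ j)"
  have v0: "v \<noteq> 0" using \<open>K $ i $ j \<noteq> 0\<close> by (auto simp: v_def vec_eq_iff)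
  have "\<exists>c. M *v v = c *s v" if M: "M \<in> S" for M
  proof -
    have "M ** K = K ** M" using comm[OF M] by (simp add: K_def mm.diff_left mm.diff_right)
    then have "M *v v = (\<chi> i. K $ i $ 1 * M $ 1 $ j + K $ i $ 2 * M $ 2 $ j)"
      by (auto simp: vec_eq_iff v_def matrix_vector_mult_def sum_2 mult_entry[symmetric])
    moreover obtain c1 c2 where "(\<chi> i. K $ i $ 1) = c1 *s v" "(\<chi> i. K $ i $ 2) = c2 *s v"
      using singular_column_multiple[OF detK v_def v0] by metis
    then have "K $ i $ 1 = c1 * v $ i" "K $ i $ 2 = c2 * v $ i" for i
      by (auto simp: vec_eq_iff)
    ultimately have "M *v v = (c1 * M $ 1 $ j + c2 * M $ 2 $ j) *s v"
      by (simp add: vec_eq_iff algebra_simps)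
    then show ?thesis by blast
  qed
  then show False using irr v0 unfolding irreducible_mats_def by blast
qed

locale trinoid_monodromy = trinoid_frame +
  fixes M :: "puncture \<Rightarrow> complex \<Rightarrow> cmat"
  assumes monodromy: "monodromy A B U p \<Phi> M"
begin

lemma deck:
  "\<exists>\<tau>. \<forall>u\<in>reg. \<tau> u \<in> reg \<and> p (\<tau> u) = p u \<and> (\<forall>l. \<Phi> (\<tau> u) l = M k l ** \<Phi> u l)"
proof -
  obtain u0 \<tau> where \<tau>: "deck_of_loop U p u0 (puncture_loop k) \<tau>"
    "\<forall>u \<in> reg. \<forall>l. \<Phi> (\<tau> u) l = M k l ** \<Phi> u l"
    using monodromy unfolding monodromy_def by blast
  have pt: "p (\<tau> u) = p u" "\<tau> u \<in> U" if "u \<in> U" for u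
    using \<tau>(1) that unfolding deck_of_loop_def homeomorphism_def by auto
  have "\<tau> u \<in> reg \<and> p (\<tau> u) = p u \<and> (\<forall>l. \<Phi> (\<tau> u) l = M k l ** \<Phi> u l)" if "u \<in> reg" for u
    using pt \<tau>(2) that by (simp add: reg_iff)
  then show ?thesis by blast
qed

lemma reg_nonempty: obtains u where "u \<in> reg"
proof -
  have "1/2 \<in> punctured_sphere" by (simp add: punctured_sphere_iff)
  then have "\<forall>\<^sub>F z in at (1/2). z \<notin> poles A B" "\<forall>\<^sub>F z in at (1/2). z \<in> punctured_sphere"
    using sparse_poles open_punctured_sphere eventually_at_in_open'[OF open_punctured_sphere]
    by (simp_all add: sparse_in_eventually_iff)
  then have "\<forall>\<^sub>F z in at (1/2). z \<in> regular_base" by eventually_elim (simp add: regular_base_def)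
  then obtain z where "z \<in> regular_base" using eventually_happens[of _ "at (1/2 :: complex)"] by auto
  then show thesis using image_reg that by (metis imageE)
qed

lemma det_monodromy: "det (M k l) = 1"
proof -
  obtain u where u: "u \<in> reg" by (rule reg_nonempty)
  from deck[of k] obtain \<tau> where
    "\<forall>u\<in>reg. \<tau> u \<in> reg \<and> p (\<tau> u) = p u \<and> (\<forall>l. \<Phi> (\<tau> u) l = M k l ** \<Phi> u l)" by (rule exE)
  then have \<tau>: "\<And>u. u \<in> reg \<Longrightarrow> \<tau> u \<in> reg" "\<And>u. u \<in> reg \<Longrightarrow> p (\<tau> u) = p u"
    "\<And>u l. u \<in> reg \<Longrightarrow> \<Phi> (\<tau> u) l = M k l ** \<Phi> u l" by auto
  have "det (\<Phi> (\<tau> u) l) = det (M k l) * det (\<Phi> u l)" using \<tau>(3)[OF u] by (simp add: det_mul)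
  then show ?thesis using frame_facts(1)[OF u] frame_facts(1)[OF \<tau>(1)[OF u]] by simp
qed

lemma hopf_nonzero:
  obtains z where "z \<in> punctured_sphere" "hopf \<alpha> z \<noteq> 0"
proof -
  have "((\<lambda>w. w\<^sup>2 * (deriv (chart P0) w)\<^sup>2 * hopf \<alpha> (chart P0 w)) \<longlongrightarrow> q P0) (at 0)"
    using weighted_end_null_form[of P0] by (simp add: weighted_end_def)
  moreover have "q P0 \<noteq> 0" using trinoid_weight[OF trinoid, of P0] by (simp add: has_weight_def)
  ultimately have "\<forall>\<^sub>F w in at 0. w\<^sup>2 * (deriv (chart P0) w)\<^sup>2 * hopf \<alpha> (chart P0 w) \<noteq> 0"
    by (rule tendsto_imp_eventually_ne)
  then have "\<forall>\<^sub>F w in at 0. chart P0 w \<in> punctured_sphere \<and> hopf \<alpha> (chart P0 w) \<noteq> 0"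
    using eventually_chart_in_sphere[of P0] by eventually_elim auto
  from eventually_happens[OF this] show thesis using that by auto
qed

text \<open>
  The null form is invariant under deck transformations, so the monodromy at 0 commutes with it, and therefore
  with its derivative as well.
\<close>

lemma monodromy_at_0: "\<exists>\<epsilon>. M k 0 = smul \<epsilon> (mat 1) \<and> \<epsilon> * \<epsilon> = 1"
proof -
  from deck[of k] obtain \<tau> where
    "\<forall>u\<in>reg. \<tau> u \<in> reg \<and> p (\<tau> u) = p u \<and> (\<forall>l. \<Phi> (\<tau> u) l = M k l ** \<Phi> u l)" by (rule exE)
  then have \<tau>: "\<And>u. u \<in> reg \<Longrightarrow> \<tau> u \<in> reg" "\<And>u. u \<in> reg \<Longrightarrow> p (\<tau> u) = p u"
    "\<And>u l. u \<in> reg \<Longrightarrow> \<Phi> (\<tau> u) l = M k l ** \<Phi> u l" by auto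
  have R: "M k 0 ** \<alpha> z = \<alpha> z ** M k 0" if zR: "z \<in> regular_base" for z
  proof -
    obtain u where u: "u \<in> reg" "p u = z" using zR unfolding image_reg[symmetric] by auto
    have "\<alpha> z = frame_form (\<tau> u)" using null_form_frame[OF \<tau>(1)[OF u(1)]] \<tau>(2)[OF u(1)] u(2) by simp
    also have "\<dots> = M k 0 ** frame_form u ** adjugate (M k 0)"
      by (simp add: frame_form_def \<tau>(2,3)[OF u(1)] matrix_mul_assoc)
    finally have "\<alpha> z = M k 0 ** \<alpha> z ** adjugate (M k 0)" using null_form_frame[OF u(1)] u(2) by simp
    then have "\<alpha> z ** M k 0 = M k 0 ** \<alpha> z ** adjugate (M k 0) ** M k 0" by simp
    then show ?thesis by (simp add: mult_adjugate_cancel[OF det_monodromy])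
  qed
  have comm: "M k 0 ** \<alpha> z = \<alpha> z ** M k 0" if "z \<in> punctured_sphere" for z
    by (rule continuous_extension[OF _ _ R that])
      (intro continuous_mult continuous_on_const continuous_null_form[OF immersion])+
  obtain z where z: "z \<in> punctured_sphere" "hopf \<alpha> z \<noteq> 0" by (rule hopf_nonzero)
  note D = null_curve_deriv[OF null_curve_null_form z(1)]
  have "has_mderiv (\<lambda>z. M k 0 ** \<alpha> z) (M k 0 ** deriv_mat \<alpha> z + 0 ** \<alpha> z) z"
    by (intro has_mderiv_mult has_mderiv_const D)
  moreover have "has_mderiv (\<lambda>z. \<alpha> z ** M k 0) (\<alpha> z ** 0 + deriv_mat \<alpha> z ** M k 0) z"
    by (intro has_mderiv_mult has_mderiv_const D)
  then have "has_mderiv (\<lambda>z. M k 0 ** \<alpha> z) (\<alpha> z ** 0 + deriv_mat \<alpha> z ** M k 0) z"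
    by (rule has_mderiv_cong[OF _ open_punctured_sphere z(1)]) (simp add: comm)
  ultimately have "M k 0 ** deriv_mat \<alpha> z + 0 ** \<alpha> z = \<alpha> z ** 0 + deriv_mat \<alpha> z ** M k 0"
    by (rule has_mderiv_unique)
  then have comm': "M k 0 ** deriv_mat \<alpha> z = deriv_mat \<alpha> z ** M k 0" by simp
  have \<alpha>: "\<alpha> z ** \<alpha> z = 0" "trace (\<alpha> z) = 0" "\<alpha> z \<noteq> 0"
    using null_curve_null_form z(1) by (auto simp: null_curve_def)
  note h = null_curve_hopf[OF null_curve_null_form z(1)]
  have s: "M k 0 = smul (M k 0 $ 1 $ 1) (mat 1)"
    by (rule null_curve_commutant[OF \<alpha> h(3) h(1) z(2) comm[OF z(1)] comm'])
  then have "det (smul (M k 0 $ 1 $ 1) (mat 1)) = 1" using det_monodromy[of k 0] by simp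
  then have "(M k 0 $ 1 $ 1) * (M k 0 $ 1 $ 1) = 1" by (simp add: det_2)
  with s show ?thesis by blast
qed

text \<open>
  The frame quotient picks up the monodromy at 1 up to sign; f is single-valued, so this monodromy is unitary.
\<close>

lemma frame_quotient_deck:
  assumes "X = Hyperbolic"
  obtains \<tau> \<epsilon> where "\<And>u. u \<in> reg \<Longrightarrow> \<tau> u \<in> reg" "\<And>u. u \<in> reg \<Longrightarrow> p (\<tau> u) = p u"
    "\<And>u. u \<in> reg \<Longrightarrow> frame_quotient (\<tau> u) = smul \<epsilon> (M k 1 ** frame_quotient u)" "\<epsilon> * \<epsilon> = 1" "cnj \<epsilon> * \<epsilon> = 1"
    "ctransp (M k 1) ** M k 1 = mat 1"
proof -
  from deck[of k] obtain \<tau> where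
    "\<forall>u\<in>reg. \<tau> u \<in> reg \<and> p (\<tau> u) = p u \<and> (\<forall>l. \<Phi> (\<tau> u) l = M k l ** \<Phi> u l)" by (rule exE)
  then have \<tau>: "\<And>u. u \<in> reg \<Longrightarrow> \<tau> u \<in> reg" "\<And>u. u \<in> reg \<Longrightarrow> p (\<tau> u) = p u"
    "\<And>u l. u \<in> reg \<Longrightarrow> \<Phi> (\<tau> u) l = M k l ** \<Phi> u l" by auto
  obtain \<epsilon> where \<epsilon>: "M k 0 = smul \<epsilon> (mat 1)" "\<epsilon> * \<epsilon> = 1" using monodromy_at_0[of k] by blast
  have "\<epsilon> = 1 \<or> \<epsilon> = -1" using \<epsilon>(2) by (simp add: square_eq_1_iff)
  then have \<epsilon>': "cnj \<epsilon> * \<epsilon> = 1" by auto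
  have Q: "frame_quotient (\<tau> u) = smul \<epsilon> (M k 1 ** frame_quotient u)" if "u \<in> reg" for u
    by (simp add: frame_quotient_def \<tau>(3)[OF that] \<epsilon>(1) matrix_mul_assoc)
  obtain u where u: "u \<in> reg" by (rule reg_nonempty)
  have dQ: "det (frame_quotient u) = 1" using frame_facts(1)[OF u] by (simp add: frame_quotient_def det_mul)
  have "ctransp (frame_quotient (\<tau> u)) ** frame_quotient (\<tau> u) = ctransp (frame_quotient u) ** frame_quotient u"
    using f_frame(2)[OF u assms] f_frame(2)[OF \<tau>(1)[OF u] assms] \<tau>(2)[OF u] by simp
  then have "smul (cnj \<epsilon> * \<epsilon>) (ctransp (frame_quotient u) ** (ctransp (M k 1) ** M k 1) ** frame_quotient u) = ctransp (frame_quotient u) ** frame_quotient u"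
    by (simp add: Q[OF u] matrix_mul_assoc mult.commute)
  then have "adjugate (ctransp (frame_quotient u)) ** (ctransp (frame_quotient u) ** (ctransp (M k 1) ** M k 1) ** frame_quotient u) ** adjugate (frame_quotient u)
     = adjugate (ctransp (frame_quotient u)) ** (ctransp (frame_quotient u) ** frame_quotient u) ** adjugate (frame_quotient u)" by (simp add: \<epsilon>')
  then have "ctransp (M k 1) ** M k 1 = mat 1"
    using dQ mult_adjugate_cancel(2)[of "ctransp (frame_quotient u)"] by (simp add: matrix_mul_assoc mult_adjugate_cancel)
  with \<tau>(1,2) Q \<epsilon>(2) \<epsilon>' show thesis by (rule that)
qed

text \<open>
  The Sym formula picks up an additive period, because the conjugation by the monodromy at 0 is trivial.
\<close>

lemma sym_formula_deck:
  obtains \<tau> \<epsilon> where "\<And>u. u \<in> reg \<Longrightarrow> \<tau> u \<in> reg" "\<And>u. u \<in> reg \<Longrightarrow> p (\<tau> u) = p u"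
    "\<And>u. u \<in> reg \<Longrightarrow> sym_formula (\<tau> u) = sym_formula u + smul \<epsilon> (deriv_mat (M k) 0)" "\<epsilon> * \<epsilon> = 1"
proof -
  from deck[of k] obtain \<tau> where
    "\<forall>u\<in>reg. \<tau> u \<in> reg \<and> p (\<tau> u) = p u \<and> (\<forall>l. \<Phi> (\<tau> u) l = M k l ** \<Phi> u l)" by (rule exE)
  then have \<tau>: "\<And>u. u \<in> reg \<Longrightarrow> \<tau> u \<in> reg" "\<And>u. u \<in> reg \<Longrightarrow> p (\<tau> u) = p u"
    "\<And>u l. u \<in> reg \<Longrightarrow> \<Phi> (\<tau> u) l = M k l ** \<Phi> u l" by auto
  obtain \<epsilon> where \<epsilon>: "M k 0 = smul \<epsilon> (mat 1)" "\<epsilon> * \<epsilon> = 1" using monodromy_at_0[of k] by blast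
  have "sym_formula (\<tau> u) = sym_formula u + smul \<epsilon> (deriv_mat (M k) 0)" if u: "u \<in> reg" for u
  proof -
    have "M k l = \<Phi> (\<tau> u) l ** adjugate (\<Phi> u l)" for l
      by (simp add: \<tau>(3)[OF u] mult_adjugate_cancel[OF frame_facts(1)[OF u]])
    then have "M k = (\<lambda>l. \<Phi> (\<tau> u) l ** adjugate (\<Phi> u l))" by blast
    moreover have "has_mderiv (\<lambda>l. \<Phi> (\<tau> u) l ** adjugate (\<Phi> u l))
        (\<Phi> (\<tau> u) 0 ** adjugate (deriv_mat (\<Phi> u) 0) + deriv_mat (\<Phi> (\<tau> u)) 0 ** adjugate (\<Phi> u 0)) 0"
      by (intro has_mderiv_mult has_mderiv_adjugate frame_facts u \<tau>(1))
    ultimately obtain D where "has_mderiv (M k) D 0" by metis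
    then have D: "has_mderiv (M k) (deriv_mat (M k) 0) 0" using has_mderiv_deriv_mat by metis
    have "has_mderiv (\<lambda>l. M k l ** \<Phi> u l) (M k 0 ** deriv_mat (\<Phi> u) 0 + deriv_mat (M k) 0 ** \<Phi> u 0) 0"
      by (intro has_mderiv_mult D frame_facts u)
    then have "has_mderiv (\<Phi> (\<tau> u)) (M k 0 ** deriv_mat (\<Phi> u) 0 + deriv_mat (M k) 0 ** \<Phi> u 0) 0"
      using \<tau>(3)[OF u] by presburger
    then have "deriv_mat (\<Phi> (\<tau> u)) 0 = smul \<epsilon> (deriv_mat (\<Phi> u) 0) + deriv_mat (M k) 0 ** \<Phi> u 0"
      by (simp add: \<epsilon>(1) has_mderiv_deriv_mat)
    then have "sym_formula (\<tau> u) = (smul \<epsilon> (deriv_mat (\<Phi> u) 0) + deriv_mat (M k) 0 ** \<Phi> u 0) ** adjugate (\<Phi> u 0) ** smul \<epsilon> (mat 1)"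
      by (simp add: sym_formula_def \<tau>(3)[OF u] \<epsilon>(1))
    also have "\<dots> = smul (\<epsilon> * \<epsilon>) (sym_formula u) + smul \<epsilon> (deriv_mat (M k) 0)"
      by (simp add: sym_formula_def mm.add_left smul_add mult_adjugate_cancel[OF frame_facts(1)[OF u]])
    finally show ?thesis by (simp add: \<epsilon>(2))
  qed
  with \<tau>(1,2) show thesis using \<epsilon>(2) by (rule that)
qed

end

section \<open>Congruences of the ambient spaces\<close>

lemma form_congruence:
  assumes "det T = 1"
  shows "form (ctransp T ** x ** T) (ctransp T ** y ** T) = form x y"
proof -
  have "trace (ctransp T ** x ** T ** adjugate (ctransp T ** y ** T)) = trace (ctransp T ** (x ** adjugate y ** adjugate (ctransp T)))"
    by (simp add: matrix_mul_assoc mult_adjugate_cancel[OF assms])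
  also have "\<dots> = trace (x ** adjugate y ** adjugate (ctransp T) ** ctransp T)" by (rule trace_commute)
  also have "\<dots> = trace (x ** adjugate y)" using assms by (simp add: mult_adjugate_cancel)
  finally show ?thesis by (simp add: form_def)
qed

text \<open>
  A Hermitian matrix with determinant 1 has positive trace exactly if it is positive definite, which is preserved
  by congruences.
\<close>

lemma congruence_hyperbolic:
  assumes T: "det T = 1" and x: "x \<in> space_of Hyperbolic"
  shows "ctransp T ** x ** T \<in> space_of Hyperbolic"
proof -
  from x have h: "ctransp x = x" and d: "det x = 1" and tr: "Re (trace x) > 0" by (auto simp: hermitian_def)
  have real: "Im (x$1$1) = 0" "Im (x$2$2) = 0" "x$2$1 = cnj (x$1$2)"
  proof -
    have e: "cnj (x$j$i) = x$i$j" for i j using arg_cong[OF h, of "\<lambda>K. K$i$j"] by simp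
    show "x$2$1 = cnj (x$1$2)" using e[of 1 2] by (metis complex_cnj_cnj)
    show "Im (x$1$1) = 0" "Im (x$2$2) = 0"
      using arg_cong[OF e[of 1 1], of Im] arg_cong[OF e[of 2 2], of Im] by simp_all
  qed
  define a where "a = Re (x$1$1)"
  define e where "e = Re (x$2$2)"
  define b where "b = x$1$2"
  have xe: "x$1$1 = of_real a" "x$2$2 = of_real e" "x$1$2 = b" "x$2$1 = cnj b"
    using real by (auto simp: a_def b_def e_def complex_eq_iff)
  have "of_real (a * e - (cmod b)\<^sup>2) = (1 :: complex)"
    using d by (simp add: det_2 xe complex_norm_square[symmetric])
  then have det: "a * e = 1 + (cmod b)\<^sup>2" by (metis add.commute diff_eq_eq of_real_eq_1_iff)
  have "a + e > 0" using tr by (simp add: trace_entry xe)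
  moreover have "a * e > 0" using det by (simp add: add_pos_nonneg)
  ultimately have a: "a > 0" by (smt (verit) mult_nonpos_nonneg mult_nonneg_nonpos zero_less_mult_iff)
  have diag: "a * Re ((ctransp T ** x ** T) $ i $ i) = (cmod (of_real a * T$1$i + b * T$2$i))\<^sup>2 + (cmod (T$2$i))\<^sup>2" for i
  proof -
    have "of_real (a * Re ((ctransp T ** x ** T) $ i $ i)) = of_real a * (ctransp T ** x ** T) $ i $ i"
      by (simp add: mult_entry xe complex_eq_iff algebra_simps)
    also have "\<dots> = (of_real a * T$1$i + b * T$2$i) * cnj (of_real a * T$1$i + b * T$2$i)
        + (of_real (a * e) - b * cnj b) * (T$2$i * cnj (T$2$i))"
      by (simp add: mult_entry xe algebra_simps)
    also have "of_real (a * e) - b * cnj b = 1" unfolding det by (simp add: complex_norm_square[symmetric])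
    also have "(of_real a * T$1$i + b * T$2$i) * cnj (of_real a * T$1$i + b * T$2$i) + 1 * (T$2$i * cnj (T$2$i))
       = of_real ((cmod (of_real a * T$1$i + b * T$2$i))\<^sup>2 + (cmod (T$2$i))\<^sup>2)"
      by (simp only: complex_norm_square[symmetric] of_real_add mult_1)
    finally show ?thesis by (simp only: of_real_eq_iff)
  qed
  have nn: "Re ((ctransp T ** x ** T) $ i $ i) \<ge> 0" for i
  proof (rule ccontr)
    assume "\<not> ?thesis"
    then have "a * Re ((ctransp T ** x ** T) $ i $ i) < 0" using a by (simp add: mult_pos_neg)
    from this[unfolded diag] show False
      using sum_power2_ge_zero[of "cmod (of_real a * T$1$i + b * T$2$i)" "cmod (T$2$i)"] by linarith
  qed
  have "Re ((ctransp T ** x ** T) $ 1 $ 1) \<noteq> 0 \<or> Re ((ctransp T ** x ** T) $ 2 $ 2) \<noteq> 0"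
  proof (rule ccontr)
    assume "\<not> ?thesis"
    moreover have "(cmod (T$2$i))\<^sup>2 \<le> 0" if "Re ((ctransp T ** x ** T) $ i $ i) = 0" for i
    proof -
      have "0 = (cmod (of_real a * T$1$i + b * T$2$i))\<^sup>2 + (cmod (T$2$i))\<^sup>2"
        unfolding diag[symmetric] that by simp
      then show ?thesis using zero_le_power2[of "cmod (of_real a * T$1$i + b * T$2$i)"] by linarith
    qed
    ultimately have "(cmod (T$2$1))\<^sup>2 \<le> 0" "(cmod (T$2$2))\<^sup>2 \<le> 0" by blast+
    then have "T$2$1 = 0" "T$2$2 = 0" by auto
    then show False using T by (simp add: det_2)
  qed
  then have "Re (trace (ctransp T ** x ** T)) > 0"
    using nn[of 1] nn[of 2] unfolding trace_entry plus_complex.sel by linarith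
  moreover have "det (ctransp T ** x ** T) = 1" by (simp add: det_mul T d)
  ultimately show ?thesis by (simp add: hermitian_def h matrix_mul_assoc)
qed

section \<open>Orientation and the Gram determinant\<close>

lemma det_4:
  "det (A :: 'a::comm_ring_1^4^4) =
    A$1$1 * (A$2$2 * A$3$3 * A$4$4 + A$2$3 * A$3$4 * A$4$2 + A$2$4 * A$3$2 * A$4$3
           - A$2$2 * A$3$4 * A$4$3 - A$2$3 * A$3$2 * A$4$4 - A$2$4 * A$3$3 * A$4$2)
  - A$1$2 * (A$2$1 * A$3$3 * A$4$4 + A$2$3 * A$3$4 * A$4$1 + A$2$4 * A$3$1 * A$4$3
           - A$2$1 * A$3$4 * A$4$3 - A$2$3 * A$3$1 * A$4$4 - A$2$4 * A$3$3 * A$4$1)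
  + A$1$3 * (A$2$1 * A$3$2 * A$4$4 + A$2$2 * A$3$4 * A$4$1 + A$2$4 * A$3$1 * A$4$2
           - A$2$1 * A$3$4 * A$4$2 - A$2$2 * A$3$1 * A$4$4 - A$2$4 * A$3$2 * A$4$1)
  - A$1$4 * (A$2$1 * A$3$2 * A$4$3 + A$2$2 * A$3$3 * A$4$1 + A$2$3 * A$3$1 * A$4$2
           - A$2$1 * A$3$3 * A$4$2 - A$2$2 * A$3$1 * A$4$3 - A$2$3 * A$3$2 * A$4$1)"
proof -
  have f1: "finite {2::4, 3, 4}" "1 \<notin> {2::4, 3, 4}" by auto
  have f2: "finite {3::4, 4}" "2 \<notin> {3::4, 4}" by auto
  have f3: "finite {4::4}" "3 \<notin> {4::4}" by auto
  show ?thesis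
    unfolding det_def UNIV_4
    unfolding sum_over_permutations_insert[OF f1]
    unfolding sum_over_permutations_insert[OF f2]
    unfolding sum_over_permutations_insert[OF f3]
    unfolding permutes_sing
    by (simp add: sign_swap_id permutation_swap_id permutation_compose sign_compose sign_id swap_id_eq algebra_simps)
qed

lemma vector_4_entry [simp]:
  "(vector [x, y, z, w] :: 'a::zero^4) $ 1 = x" "(vector [x, y, z, w] :: 'a::zero^4) $ 2 = y"
  "(vector [x, y, z, w] :: 'a::zero^4) $ 3 = z" "(vector [x, y, z, w] :: 'a::zero^4) $ 4 = w"
  unfolding vector_def by simp_all

definition herm :: "real \<Rightarrow> real \<Rightarrow> real \<Rightarrow> real \<Rightarrow> cmat" where
  "herm t x y z = vector [vector [Complex (t + z) 0, Complex x (- y)], vector [Complex x y, Complex (t - z) 0]]"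

lemma herm_entry [simp]:
  "herm t x y z $ 1 $ 1 = Complex (t + z) 0" "herm t x y z $ 1 $ 2 = Complex x (- y)"
  "herm t x y z $ 2 $ 1 = Complex x y" "herm t x y z $ 2 $ 2 = Complex (t - z) 0"
  by (simp_all add: herm_def)

lemma hermitian_herm: "ctransp (herm t x y z) = herm t x y z"
  by (simp add: cmat_eq_iff complex_eq_iff)

lemma hermitian_cases:
  assumes "ctransp a = a"
  obtains t x y z where "a = herm t x y z"
proof -
  have e: "cnj (a$j$i) = a$i$j" for i j using arg_cong[OF assms, of "\<lambda>K. K$i$j"] by simp
  have "Im (a$1$1) = 0" "Im (a$2$2) = 0" "Re (a$2$1) = Re (a$1$2)" "Im (a$2$1) = - Im (a$1$2)"
    using arg_cong[OF e[of 1 1], of Im] arg_cong[OF e[of 2 2], of Im]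
      arg_cong[OF e[of 2 1], of Im] arg_cong[OF e[of 2 1], of Re] by simp_all
  then have "a = herm ((Re (a$1$1) + Re (a$2$2)) / 2) (Re (a$1$2)) (- Im (a$1$2)) ((Re (a$1$1) - Re (a$2$2)) / 2)"
    by (simp add: cmat_eq_iff complex_eq_iff field_simps)
  then show thesis by (rule that)
qed

lemma pauli_coords_herm: "pauli_coords (herm t x y z) = vector [t, x, y, z]"
  by (simp add: pauli_coords_def)

lemma form_herm: "form (herm t x y z) (herm t' x' y' z') = - (t * t') + x * x' + y * y' + z * z'"
  by (simp add: form_def cmat_expand field_simps)

lemma form_commute: "form x y = form y x"
  by (simp add: form_def cmat_expand algebra_simps)

text \<open>
  This expression for the orientation form makes its invariance under congruences evident: the factors alternate
  between x and its adjugate, so the matrices of the congruence cancel.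
\<close>

lemma vol4_trace:
  assumes "ctransp a = a" "ctransp b = b" "ctransp c = c" "ctransp d = d"
  shows "vol4 a b c d = Im (trace (a ** adjugate b ** c ** adjugate d)) / 2"
proof -
  obtain ta xa ya za where a: "a = herm ta xa ya za" using assms(1) by (rule hermitian_cases)
  obtain tb xb yb zb where b: "b = herm tb xb yb zb" using assms(2) by (rule hermitian_cases)
  obtain tc xc yc zc where c: "c = herm tc xc yc zc" using assms(3) by (rule hermitian_cases)
  obtain td xd yd zd where d: "d = herm td xd yd zd" using assms(4) by (rule hermitian_cases)
  show ?thesis
    unfolding a b c d vol4_def pauli_coords_herm det_4
    by (simp add: trace_entry mult_entry algebra_simps)
qed

text \<open>
  The Gram determinant of two quadruples is minus the product of their volumes, as the form has signature (3, 1).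
\<close>

lemma vol4_gram:
  fixes a b a' b' :: "cmat^4"
  assumes "\<And>i. ctransp (a$i) = a$i" "\<And>i. ctransp (b$i) = b$i" "\<And>i. ctransp (a'$i) = a'$i" "\<And>i. ctransp (b'$i) = b'$i"
    and eq: "\<And>i j. form (a$i) (b$j) = form (a'$i) (b'$j)"
  shows "vol4 (a$1) (a$2) (a$3) (a$4) * vol4 (b$1) (b$2) (b$3) (b$4)
       = vol4 (a'$1) (a'$2) (a'$3) (a'$4) * vol4 (b'$1) (b'$2) (b'$3) (b'$4)"
proof -
  define G :: "real^4^4" where "G = (\<chi> i j. if i = j then (if i = 1 then -1 else 1) else 0)"
  define rows :: "cmat^4 \<Rightarrow> real^4^4" where "rows a = (\<chi> i. pauli_coords (a$i))" for a
  have vol: "vol4 (a$1) (a$2) (a$3) (a$4) = det (rows a)" for a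
    unfolding vol4_def by (rule arg_cong[of _ _ det]) (simp add: rows_def vec_eq_iff forall_4)
  have gram: "(rows a ** G ** transpose (rows b)) $ i $ j = form (a$i) (b$j)"
    if h: "ctransp (a$i) = a$i" "ctransp (b$j) = b$j" for a b :: "cmat^4" and i j
  proof -
    obtain ta xa ya za where a: "a$i = herm ta xa ya za" using h(1) by (rule hermitian_cases)
    obtain tb xb yb zb where b: "b$j = herm tb xb yb zb" using h(2) by (rule hermitian_cases)
    show ?thesis
      unfolding a b form_herm
      by (simp add: matrix_matrix_mult_def sum_4 rows_def G_def transpose_def a b pauli_coords_herm)
  qed
  have "rows a ** G ** transpose (rows b) = rows a' ** G ** transpose (rows b')"
    unfolding vec_eq_iff using gram assms by simp
  then have "det (rows a ** G ** transpose (rows b)) = det (rows a' ** G ** transpose (rows b'))" by simp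
  then have "det (rows a) * det G * det (rows b) = det (rows a') * det G * det (rows b')"
    by (simp add: det_mul)
  moreover have "det G = - 1" by (simp add: det_4 G_def)
  ultimately show ?thesis by (simp add: vol)
qed

lemma vol4_congruence:
  assumes T: "det T = 1" and h: "ctransp a = a" "ctransp b = b" "ctransp c = c" "ctransp d = d"
  shows "vol4 (ctransp T ** a ** T) (ctransp T ** b ** T) (ctransp T ** c ** T) (ctransp T ** d ** T) = vol4 a b c d"
proof -
  let ?J = "\<lambda>x. ctransp T ** x ** T"
  have "trace (?J a ** adjugate (?J b) ** ?J c ** adjugate (?J d))
     = trace (ctransp T ** (a ** adjugate b ** c ** adjugate d ** adjugate (ctransp T)))"
    using T by (simp add: matrix_mul_assoc mult_adjugate_cancel)
  also have "\<dots> = trace (a ** adjugate b ** c ** adjugate d ** adjugate (ctransp T) ** ctransp T)"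
    by (rule trace_commute)
  also have "\<dots> = trace (a ** adjugate b ** c ** adjugate d)"
    using T by (simp add: mult_adjugate_cancel)
  finally show ?thesis
    using h by (subst (1 2) vol4_trace) (simp_all add: matrix_mul_assoc)
qed

lemma rigid_motion_hyperbolic:
  assumes T: "det T = 1"
  shows "rigid_motion Hyperbolic (\<lambda>x. ctransp T ** x ** T)"
  unfolding rigid_motion_def
proof (intro conjI ballI impI)
  let ?S = "space_of Hyperbolic"
  have aT: "det (adjugate T) = 1" using T by simp
  show "bij_betw (\<lambda>x. ctransp T ** x ** T) ?S ?S"
  proof (rule bij_betw_byWitness[where f' = "\<lambda>x. ctransp (adjugate T) ** x ** adjugate T"])
    show "\<forall>x\<in>?S. ctransp (adjugate T) ** (ctransp T ** x ** T) ** adjugate T = x"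
      using T by (simp add: matrix_mul_assoc mult_adjugate_cancel)
    show "\<forall>x\<in>?S. ctransp T ** (ctransp (adjugate T) ** x ** adjugate T) ** T = x"
      using T by (simp add: matrix_mul_assoc mult_adjugate_cancel)
    show "(\<lambda>x. ctransp T ** x ** T) ` ?S \<subseteq> ?S" "(\<lambda>x. ctransp (adjugate T) ** x ** adjugate T) ` ?S \<subseteq> ?S"
      using congruence_hyperbolic[OF T] congruence_hyperbolic[OF aT] by blast+
  qed
  fix x y
  show "ambient_dist Hyperbolic (ctransp T ** x ** T) (ctransp T ** y ** T) = ambient_dist Hyperbolic x y"
    by (simp add: form_congruence[OF T])
next
  fix a b c d assume "a \<in> space_of Hyperbolic" "b \<in> space_of Hyperbolic" "c \<in> space_of Hyperbolic" "d \<in> space_of Hyperbolic"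
    and "positive_simplex Hyperbolic a b c d"
  then show "positive_simplex Hyperbolic (ctransp T ** a ** T) (ctransp T ** b ** T) (ctransp T ** c ** T) (ctransp T ** d ** T)"
    by (simp add: vol4_congruence[OF T] hermitian_def)
qed

lemma rigid_motion_euclidean:
  assumes T: "det T = 1" "ctransp T ** T = mat 1" and C: "C \<in> space_of Euclidean"
  shows "rigid_motion Euclidean (\<lambda>x. ctransp T ** x ** T + C)"
  unfolding rigid_motion_def
proof (intro conjI ballI impI)
  let ?S = "space_of Euclidean" and ?J = "\<lambda>x. ctransp T ** x ** T + C"
  have "ctransp T = ctransp T ** T ** adjugate T" using T(1) by (simp add: mult_adjugate_cancel)
  then have adjT: "adjugate T = ctransp T" unfolding T(2) by simp
  have TT: "T ** ctransp T = mat 1" using mult_adjugate_cancel(1)[OF T(1)] unfolding adjT .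
  have TTr: "\<And>M. (M :: cmat) ** T ** ctransp T = M" "\<And>M. (M :: cmat) ** ctransp T ** T = M"
    by (simp_all add: matrix_mul_assoc[symmetric] T(2) TT)
  have sp: "ctransp U ** x ** U \<in> ?S" if "x \<in> ?S" "U ** ctransp U = mat 1" for x U
  proof -
    have "trace (ctransp U ** (x ** U)) = trace (x ** U ** ctransp U)" by (rule trace_commute)
    then show ?thesis using that by (simp add: hermitian_def matrix_mul_assoc matrix_mul_assoc[symmetric, of _ U])
  qed
  have add: "x + y \<in> ?S" "x - y \<in> ?S" if "x \<in> ?S" "y \<in> ?S" for x y
    using that by (auto simp: hermitian_def ctransp_linear trace_linear)
  show "bij_betw ?J ?S ?S"
  proof (rule bij_betw_byWitness[where f' = "\<lambda>x. T ** (x - C) ** ctransp T"])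
    show "\<forall>x\<in>?S. T ** (?J x - C) ** ctransp T = x"
      by (simp add: matrix_mul_assoc TTr TT)
    show "\<forall>x\<in>?S. ?J (T ** (x - C) ** ctransp T) = x"
      by (simp add: matrix_mul_assoc TTr T(2))
    show "?J ` ?S \<subseteq> ?S" using sp[OF _ TT] add(1)[OF _ C] by auto
    show "(\<lambda>x. T ** (x - C) ** ctransp T) ` ?S \<subseteq> ?S"
    proof
      fix y assume "y \<in> (\<lambda>x. T ** (x - C) ** ctransp T) ` ?S"
      then obtain x where x: "x \<in> ?S" "y = T ** (x - C) ** ctransp T" by blast
      show "y \<in> ?S" using sp[OF add(2)[OF x(1) C], of "ctransp T"] T(2) x(2) by simp
    qed
  qed
  have diff: "?J x - ?J y = ctransp T ** (x - y) ** T" for x y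
    by (simp add: mm.diff_left mm.diff_right)
  show "ambient_dist Euclidean (?J x) (?J y) = ambient_dist Euclidean x y" for x y
    unfolding ambient_dist.simps diff by (simp add: form_congruence[OF T(1)])
  fix a b c d assume "a \<in> ?S" "b \<in> ?S" "c \<in> ?S" "d \<in> ?S" and pos: "positive_simplex Euclidean a b c d"
  then have h: "ctransp (b - a) = b - a" "ctransp (c - a) = c - a" "ctransp (d - a) = d - a"
    by (auto simp: hermitian_def ctransp_linear)
  have "vol4 (mat 1) (?J b - ?J a) (?J c - ?J a) (?J d - ?J a) = vol4 (mat 1) (b - a) (c - a) (d - a)"
    unfolding diff using vol4_congruence[OF T(1) _ h, of "mat 1"] T(2) by simp
  then show "positive_simplex Euclidean (?J a) (?J b) (?J c) (?J d)" using pos by simp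
qed

section \<open>Equal weights imply congruence\<close>

lemma rpf_congruence: "ctransp T ** real_part_form K v ** T = real_part_form (ctransp T ** K ** T) v"
  by (simp add: real_part_form_def mm.add_left mm.add_right matrix_mul_assoc)

context trinoid_monodromy
begin

text \<open>
  The matrix function h, the second surface transported by S, has the same null form as f. So h pulled back by the frame
  quotient is constant; the pull-back of f itself is the identity. This constant commutes with the unitary
  monodromy at 1, so it is a scalar, and determinant and trace leave only 1.
\<close>

lemma congruent_hyperbolic:
  assumes X: "X = Hyperbolic" and irr: "irreducible_mats (range (\<lambda>k. M k 1))"
    and imm': "conformal_immersion Hyperbolic f'" and S: "det S = 1"
    and conj: "\<And>z. z \<in> punctured_sphere \<Longrightarrow> null_form Hyperbolic f' z = S ** \<alpha> z ** adjugate S"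
    and z: "z \<in> punctured_sphere"
  shows "f' z = ctransp (adjugate S) ** f z ** adjugate S"
proof -
  define h where "h z = ctransp S ** f' z ** S" for z
  have hH: "h z \<in> space_of Hyperbolic" if "z \<in> punctured_sphere" for z
    unfolding h_def by (rule congruence_hyperbolic[OF S immersion_in_space[OF imm' that]])
  then have herm_h: "ctransp (h z) = h z" if "z \<in> punctured_sphere" for z
    using that by (auto simp: hermitian_def)
  have dh: "(h has_derivative real_part_form (h z ** \<alpha> z)) (at z)" if zz: "z \<in> punctured_sphere" for z
  proof -
    have "(f' has_derivative real_part_form (f' z ** (S ** \<alpha> z ** adjugate S))) (at z)"
      using immersion_derivative[OF imm' zz] conj[OF zz] by (simp add: base_def)
    then have "((\<lambda>z. ctransp S ** f' z ** S) has_derivative (\<lambda>v. ctransp S ** real_part_form (f' z ** (S ** \<alpha> z ** adjugate S)) v ** S)) (at z)"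
      by (intro bounded_linear.has_derivative[OF mm.bounded_linear_left] bounded_linear.has_derivative[OF mm.bounded_linear_right])
    then show ?thesis
      unfolding rpf_congruence h_def[abs_def]
      by (simp add: matrix_mul_assoc mult_adjugate_cancel[OF S])
  qed
  define H where "H u = ctransp (adjugate (frame_quotient u)) ** h (p u) ** adjugate (frame_quotient u)" for u
  have PS: "p u \<in> punctured_sphere" if "u \<in> reg" for u
    using reg_imp_base[OF that] by (simp add: regular_base_def)
  have dH: "(H has_derivative (\<lambda>v. 0)) (at u)" if u: "u \<in> reg" for u
  proof -
    let ?G = "adjugate (frame_quotient u)" and ?\<alpha> = "\<alpha> (p u)" and ?c = "deriv p u"
    have "adjugate ?\<alpha> = - ?\<alpha>"
      using null_form_nilpotent(2)[OF PS[OF u]] by (rule adjugate_tracefree)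
    then have "has_mderiv (\<lambda>u. adjugate (frame_quotient u)) (- smul ?c (?\<alpha> ** ?G)) u"
      using has_mderiv_adjugate[OF frame_quotient_mderiv[OF u]] null_form_frame[OF u] by (simp add: mm.minus_left smul_minus)
    then have dG: "((\<lambda>u. adjugate (frame_quotient u)) has_derivative (\<lambda>v. - smul (v * ?c) (?\<alpha> ** ?G))) (at u)"
      by (simp add: has_mderiv_def smul_minus)
    have dhp: "((\<lambda>u. h (p u)) has_derivative (\<lambda>v. real_part_form (h (p u) ** ?\<alpha>) (?c * v))) (at u)"
      using has_derivative_compose[OF deriv_p[OF reg_imp_U[OF u], unfolded has_field_derivative_def] dh[OF PS[OF u]]] .
    have "(H has_derivative (\<lambda>v. (ctransp ?G ** h (p u)) ** (- smul (v * ?c) (?\<alpha> ** ?G))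
       + (ctransp ?G ** real_part_form (h (p u) ** ?\<alpha>) (?c * v) + ctransp (- smul (v * ?c) (?\<alpha> ** ?G)) ** h (p u)) ** ?G)) (at u)"
      unfolding H_def[abs_def]
      by (intro mm.FDERIV bounded_linear.has_derivative[OF bounded_linear_ctransp] dG dhp)
    moreover have "(ctransp ?G ** h (p u)) ** (- smul (v * ?c) (?\<alpha> ** ?G))
       + (ctransp ?G ** real_part_form (h (p u) ** ?\<alpha>) (?c * v) + ctransp (- smul (v * ?c) (?\<alpha> ** ?G)) ** h (p u)) ** ?G = 0" for v
      by (simp add: real_part_form_def mm.add_left mm.add_right mm.minus_left mm.minus_right ctransp_linear
          matrix_mul_assoc herm_h[OF PS[OF u]] mult.commute del: adjugate_simps(6))
    ultimately show ?thesis by simp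
  qed
  have const: "H u = H v" if "u \<in> reg" "v \<in> reg" for u v
    using has_derivative_zero_unique_connected[OF open_reg connected_reg dH that] .
  obtain u0 where u0: "u0 \<in> reg" by (rule reg_nonempty)
  have comm: "M k 1 ** H u0 = H u0 ** M k 1" for k
  proof -
    obtain \<tau> \<epsilon> where \<tau>: "\<And>u. u \<in> reg \<Longrightarrow> \<tau> u \<in> reg" "\<And>u. u \<in> reg \<Longrightarrow> p (\<tau> u) = p u"
      "\<And>u. u \<in> reg \<Longrightarrow> frame_quotient (\<tau> u) = smul \<epsilon> (M k 1 ** frame_quotient u)" "\<epsilon> * \<epsilon> = 1" "cnj \<epsilon> * \<epsilon> = 1"
      "ctransp (M k 1) ** M k 1 = mat 1" using frame_quotient_deck[OF X, of k] by blast
    let ?M = "M k 1"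
    have d: "det ?M = 1" by (rule det_monodromy)
    have "ctransp ?M = ctransp ?M ** ?M ** adjugate ?M" using d by (simp add: mult_adjugate_cancel)
    then have adjM: "adjugate ?M = ctransp ?M" unfolding \<tau>(6) by simp
    have "adjugate (frame_quotient (\<tau> u0)) = smul \<epsilon> (adjugate (frame_quotient u0) ** ctransp ?M)"
      unfolding \<tau>(3)[OF u0] by (simp add: adjM)
    then have "H (\<tau> u0) = smul (cnj \<epsilon> * \<epsilon>) (?M ** H u0 ** ctransp ?M)"
      unfolding H_def \<tau>(2)[OF u0] by (simp add: matrix_mul_assoc mult.commute del: adjugate_simps(6))
    then have "H u0 = ?M ** H u0 ** ctransp ?M"
      using const[OF \<tau>(1)[OF u0] u0] \<tau>(5) by simp
    then have "H u0 ** ?M = ?M ** H u0 ** ctransp ?M ** ?M" by simp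
    also have "\<dots> = ?M ** H u0" using mult_adjugate_cancel(4)[OF d] unfolding adjM by metis
    finally show ?thesis by simp
  qed
  have "\<exists>c. H u0 = smul c (mat 1)"
    by (rule irreducible_commutant[OF irr]) (use comm in auto)
  then obtain c where c: "H u0 = smul c (mat 1)" by blast
  have hf: "h z = smul c (f z)" if "z \<in> regular_base" for z
  proof -
    have "z \<in> p ` reg" using that image_reg by simp
    then obtain u where u: "u \<in> reg" "p u = z" by auto
    have d: "det (frame_quotient u) = 1" using frame_facts(1)[OF u(1)] by (simp add: frame_quotient_def det_mul)
    have cancel: "ctransp (frame_quotient u) ** ctransp (adjugate (frame_quotient u)) = mat 1"
      using mult_adjugate_cancel(2)[OF d] by (metis ctransp_simps(2,4))
    have "ctransp (frame_quotient u) ** H u ** frame_quotient u = h z"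
      unfolding H_def u(2)
      by (simp add: matrix_mul_assoc mult_adjugate_cancel[OF d] cancel del: adjugate_simps(6))
    moreover have "H u = smul c (mat 1)" using const[OF u(1) u0] c by simp
    ultimately show ?thesis using f_frame(2)[OF u(1) X] u(2) by simp
  qed
  have "continuous_on punctured_sphere h"
    using dh by (intro continuous_at_imp_continuous_on ballI) (blast intro: has_derivative_continuous)
  then have hf': "h z = smul c (f z)"
    by (rule continuous_extension[OF _ _ hf z])
      (intro continuous_mult continuous_on_const immersion_continuous[OF immersion])
  have "f z \<in> space_of Hyperbolic" using immersion_in_space[OF immersion z] X by simp
  then have fz: "det (f z) = 1" "Re (trace (f z)) > 0" by auto
  have hz: "det (h z) = 1" "Re (trace (h z)) > 0" using hH[OF z] by auto
  have "c\<^sup>2 = 1" using hz(1) fz(1) by (simp add: hf' det_smul)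
  moreover have "c \<noteq> -1" using hz(2) fz(2) by (auto simp: hf' trace_linear)
  ultimately have "c = 1" by (simp add: power2_eq_1_iff)
  then have "ctransp S ** f' z ** S = f z" using hf' by (simp add: h_def)
  then have "ctransp (adjugate S) ** (ctransp S ** f' z ** S) ** adjugate S = ctransp (adjugate S) ** f z ** adjugate S" by simp
  then show ?thesis using S by (simp add: matrix_mul_assoc mult_adjugate_cancel)
qed

text \<open>
  Let P be the adjoint of S times S. In the difference E the antiholomorphic parts of the derivatives cancel, so E is
  holomorphic and single-valued on the sphere. Up to a constant it is the difference of psi conjugated by P and psi, where
  psi is the Sym formula, so the periods of psi commute with P.
\<close>

lemma congruent_euclidean:
  assumes X: "X = Euclidean" and irr: "irreducible_mats (range (\<lambda>k. deriv_mat (M k) 0))"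
    and imm': "conformal_immersion Euclidean f'" and S: "det S = 1"
    and conj: "\<And>z. z \<in> punctured_sphere \<Longrightarrow> null_form Euclidean f' z = S ** \<alpha> z ** adjugate S"
  shows "ctransp S ** S = mat 1"
    "\<exists>C \<in> space_of Euclidean. \<forall>z\<in>punctured_sphere. f' z = S ** f z ** ctransp S + C"
proof -
  define P where "P = ctransp S ** S"
  have dP: "det P = 1" using S by (simp add: P_def det_mul)
  have df: "(f has_derivative real_part_form (\<alpha> z)) (at z)" if "z \<in> punctured_sphere" for z
    using immersion_derivative[OF immersion that] X by (simp add: base_def)
  have df': "(f' has_derivative real_part_form (S ** \<alpha> z ** adjugate S)) (at z)" if "z \<in> punctured_sphere" for z
    using immersion_derivative[OF imm' that] conj[OF that] by (simp add: base_def)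
  define E where "E z = adjugate P ** f z ** P - adjugate S ** f' z ** S" for z
  have dE: "has_mderiv E (adjugate P ** \<alpha> z ** P - \<alpha> z) z" if z: "z \<in> punctured_sphere" for z
  proof -
    have "(E has_derivative (\<lambda>v. adjugate P ** real_part_form (\<alpha> z) v ** P - adjugate S ** real_part_form (S ** \<alpha> z ** adjugate S) v ** S)) (at z)"
      unfolding E_def[abs_def]
      by (intro has_derivative_diff bounded_linear.has_derivative[OF mm.bounded_linear_left]
          bounded_linear.has_derivative[OF mm.bounded_linear_right] df df' z)
    moreover have "adjugate P ** real_part_form (\<alpha> z) v ** P - adjugate S ** real_part_form (S ** \<alpha> z ** adjugate S) v ** S
       = smul v (adjugate P ** \<alpha> z ** P - \<alpha> z)" for v
    proof -
      have cS: "det (ctransp S) = 1" using S by simp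
      have "adjugate S ** real_part_form (S ** \<alpha> z ** adjugate S) v ** S
         = smul v (\<alpha> z) + smul (cnj v) (adjugate S ** adjugate (ctransp S) ** ctransp (\<alpha> z) ** ctransp S ** S)"
        by (simp add: real_part_form_def mm.add_left mm.add_right matrix_mul_assoc mult_adjugate_cancel[OF S])
      moreover have "adjugate P ** real_part_form (\<alpha> z) v ** P
         = smul v (adjugate P ** \<alpha> z ** P) + smul (cnj v) (adjugate S ** adjugate (ctransp S) ** ctransp (\<alpha> z) ** ctransp S ** S)"
        by (simp add: real_part_form_def mm.add_left mm.add_right matrix_mul_assoc P_def)
      ultimately show ?thesis by (simp add: smul_diff)
    qed
    ultimately show ?thesis by (simp add: has_mderiv_def)
  qed
  define H where "H u = adjugate P ** sym_formula u ** P - sym_formula u - E (p u)" for u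
  have PS: "p u \<in> punctured_sphere" if "u \<in> reg" for u
    using reg_imp_base[OF that] by (simp add: regular_base_def)
  have dH: "has_mderiv H 0 u" if u: "u \<in> reg" for u
  proof -
    have 1: "has_mderiv sym_formula (smul (deriv p u) (\<alpha> (p u))) u"
      using sym_formula_mderiv[OF u] null_form_frame[OF u] by simp
    have "has_mderiv (\<lambda>u. adjugate P ** sym_formula u ** P)
       ((adjugate P ** sym_formula u) ** 0 + (adjugate P ** smul (deriv p u) (\<alpha> (p u)) + 0 ** sym_formula u) ** P) u"
      by (intro has_mderiv_mult has_mderiv_const 1)
    then have 2: "has_mderiv (\<lambda>u. adjugate P ** sym_formula u ** P) (smul (deriv p u) (adjugate P ** \<alpha> (p u) ** P)) u"
      by simp
    have 3: "has_mderiv (\<lambda>u. E (p u)) (smul (deriv p u) (adjugate P ** \<alpha> (p u) ** P - \<alpha> (p u))) u"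
      by (rule has_mderiv_compose[OF dE[OF PS[OF u]] deriv_p[OF reg_imp_U[OF u]]])
    have "has_mderiv H (smul (deriv p u) (adjugate P ** \<alpha> (p u) ** P) - smul (deriv p u) (\<alpha> (p u))
       - smul (deriv p u) (adjugate P ** \<alpha> (p u) ** P - \<alpha> (p u))) u"
      unfolding H_def[abs_def] by (intro has_mderiv_diff 1 2 3)
    then show ?thesis by (simp add: smul_diff)
  qed
  obtain u0 where u0: "u0 \<in> reg" by (rule reg_nonempty)
  have comm: "deriv_mat (M k) 0 ** P = P ** deriv_mat (M k) 0" for k
  proof -
    obtain \<tau> \<epsilon> where \<tau>: "\<And>u. u \<in> reg \<Longrightarrow> \<tau> u \<in> reg" "\<And>u. u \<in> reg \<Longrightarrow> p (\<tau> u) = p u"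
      "\<And>u. u \<in> reg \<Longrightarrow> sym_formula (\<tau> u) = sym_formula u + smul \<epsilon> (deriv_mat (M k) 0)" "\<epsilon> * \<epsilon> = 1"
      using sym_formula_deck[of k] by blast
    let ?D = "deriv_mat (M k) 0"
    have "H (\<tau> u0) = H u0"
      by (rule has_mderiv_constant[OF open_reg connected_reg dH \<tau>(1)[OF u0] u0])
    then have "smul \<epsilon> (adjugate P ** ?D ** P - ?D) = 0"
      unfolding H_def \<tau>(2,3)[OF u0] by (simp add: mm.add_left mm.add_right smul_diff algebra_simps)
    then have "smul \<epsilon> (smul \<epsilon> (adjugate P ** ?D ** P - ?D)) = 0" by simp
    then have "adjugate P ** ?D ** P = ?D" by (simp add: \<tau>(4))
    then have "P ** (adjugate P ** ?D ** P) = P ** ?D" by simp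
    then show ?thesis by (simp add: matrix_mul_assoc mult_adjugate_cancel[OF dP])
  qed
  have "\<exists>c. P = smul c (mat 1)"
    by (rule irreducible_commutant[OF irr]) (use comm in auto)
  then obtain c where c: "P = smul c (mat 1)" by blast
  have "c\<^sup>2 = 1" using dP by (simp add: c det_smul)
  moreover have "c \<noteq> -1"
  proof
    assume "c = -1"
    then have "P $ 1 $ 1 = -1" by (simp add: c)
    moreover have "P $ 1 $ 1 = of_real ((cmod (S$1$1))\<^sup>2 + (cmod (S$2$1))\<^sup>2)"
      unfolding of_real_add complex_norm_square by (simp add: P_def mult_entry mult.commute)
    ultimately have "(cmod (S$1$1))\<^sup>2 + (cmod (S$2$1))\<^sup>2 = -1"
      by (metis of_real_1 of_real_eq_iff of_real_minus)
    then show False using sum_power2_ge_zero[of "cmod (S$1$1)" "cmod (S$2$1)"] by linarith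
  qed
  ultimately have "c = 1" by (simp add: power2_eq_1_iff)
  then show P1: "ctransp S ** S = mat 1" using c by (simp add: P_def)
  have "ctransp S = ctransp S ** S ** adjugate S" using S by (simp add: mult_adjugate_cancel)
  then have adjS: "adjugate S = ctransp S" unfolding P1 by simp
  define G where "G z = f' z - S ** f z ** ctransp S" for z
  have dG: "(G has_derivative (\<lambda>v. 0)) (at z)" if z: "z \<in> punctured_sphere" for z
  proof -
    have "(G has_derivative (\<lambda>v. real_part_form (S ** \<alpha> z ** adjugate S) v - S ** real_part_form (\<alpha> z) v ** ctransp S)) (at z)"
      unfolding G_def[abs_def]
      by (intro has_derivative_diff bounded_linear.has_derivative[OF mm.bounded_linear_left]
          bounded_linear.has_derivative[OF mm.bounded_linear_right] df df' z)
    moreover have "real_part_form (S ** \<alpha> z ** adjugate S) v - S ** real_part_form (\<alpha> z) v ** ctransp S = 0" for v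
      using rpf_congruence[of "ctransp S" "\<alpha> z" v] by (simp add: adjS)
    ultimately show ?thesis by simp
  qed
  have half: "1/2 \<in> punctured_sphere" by (simp add: punctured_sphere_iff)
  have Gc: "G z = G (1/2)" if "z \<in> punctured_sphere" for z
    using has_derivative_zero_unique_connected[OF open_punctured_sphere connected_punctured_sphere dG that half] .
  have "f' (1/2) \<in> space_of Euclidean" "f (1/2) \<in> space_of Euclidean"
    using immersion_in_space[OF imm' half] immersion_in_space[OF immersion half] X by auto
  moreover have "trace (S ** f (1/2) ** ctransp S) = trace (ctransp S ** (S ** f (1/2)))" by (rule trace_commute)
  ultimately have "G (1/2) \<in> space_of Euclidean"
    by (simp add: G_def hermitian_def ctransp_linear trace_linear matrix_mul_assoc P1)
  moreover have "f' z = S ** f z ** ctransp S + G (1/2)" if "z \<in> punctured_sphere" for z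
    using Gc[OF that] by (simp add: G_def algebra_simps)
  ultimately show "\<exists>C \<in> space_of Euclidean. \<forall>z\<in>punctured_sphere. f' z = S ** f z ** ctransp S + C" by blast
qed

end

theorem equal_weights_congruent:
  assumes t: "trinoid_from X A B U p \<Phi> f q" and m: "monodromy A B U p \<Phi> M" and irr: "irreducible_monodromy X 0 1 M"
    and t': "trinoid_from X A' B' U' p' \<Phi>' f' q"
  shows "same_up_to_rigid_motion X f f'"
proof -
  interpret T: trinoid_monodromy A B U p \<Phi> X f q M
    using t m by unfold_locales (auto simp: trinoid_from_def)
  interpret T': trinoid_frame A' B' U' p' \<Phi>' X f' q
    using t' by unfold_locales (auto simp: trinoid_from_def)
  have q: "q k \<noteq> 0" for k using trinoid_weight[OF t, of k] by (simp add: has_weight_def)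
  obtain S where S: "det S = 1" "\<And>z. z \<in> punctured_sphere \<Longrightarrow> null_form X f' z = S ** null_form X f z ** adjugate S"
    using weighted_null_curves_conjugate[OF T.null_curve_null_form T'.null_curve_null_form
        T.weighted_end_null_form T'.weighted_end_null_form q] by metis
  show ?thesis
  proof (cases X)
    case Euclidean
    have irr': "irreducible_mats (range (\<lambda>k. deriv_mat (M k) 0))" using irr Euclidean by simp
    have SS: "ctransp S ** S = mat 1"
      by (rule T.congruent_euclidean(1)[where f' = f', OF Euclidean irr' _ S(1)])
        (use T'.immersion S(2) Euclidean in auto)
    have "\<exists>C \<in> space_of Euclidean. \<forall>z\<in>punctured_sphere. f' z = S ** f z ** ctransp S + C"
      by (rule T.congruent_euclidean(2)[OF Euclidean irr' _ S(1)])
        (use T'.immersion S(2) Euclidean in auto)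
    then obtain C where C: "C \<in> space_of Euclidean" "\<forall>z\<in>punctured_sphere. f' z = S ** f z ** ctransp S + C"
      by blast
    have "ctransp S = ctransp S ** S ** adjugate S" using S(1) by (simp add: mult_adjugate_cancel)
    then have "adjugate S = ctransp S" unfolding SS by simp
    then have "S ** ctransp S = mat 1" using mult_adjugate_cancel(1)[OF S(1)] by simp
    then have "rigid_motion Euclidean (\<lambda>x. ctransp (ctransp S) ** x ** ctransp S + C)"
      using S(1) C(1) by (intro rigid_motion_euclidean) auto
    then show ?thesis using C(2) Euclidean unfolding same_up_to_rigid_motion_def by auto
  next
    case Hyperbolic
    have irr': "irreducible_mats (range (\<lambda>k. M k 1))" using irr Hyperbolic by simp
    have "rigid_motion Hyperbolic (\<lambda>x. ctransp (adjugate S) ** x ** adjugate S)"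
      using S(1) by (intro rigid_motion_hyperbolic) simp
    moreover have "f' z = ctransp (adjugate S) ** f z ** adjugate S" if "z \<in> punctured_sphere" for z
      by (rule T.congruent_hyperbolic[OF Hyperbolic irr' _ S(1) _ that])
        (use T'.immersion S(2) Hyperbolic in auto)
    ultimately show ?thesis using Hyperbolic unfolding same_up_to_rigid_motion_def by blast
  qed
qed


section \<open>The Hopf differential is a congruence invariant\<close>

lemma rpf_hermitian: "ctransp (real_part_form K v) = real_part_form K v"
  by (simp add: real_part_form_def ctransp_linear add.commute)

text \<open>
  The products P adj(b) c adj(d) expand into eight terms, half of which vanish because N is nilpotent. By N D = Q N and
  D N = - Q N, each of the others is a multiple of the real number trace (P N P' N'), which is the
  squared length of b; here P' is the inverse of P, and N' the adjoint of N.
\<close>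

lemma hopf_volume:
  fixes P N D :: cmat
  assumes P: "ctransp P = P" "det P = 1" and N: "trace N = 0" "N ** N = 0" and D: "trace D = 0"
    and ND: "N ** D = smul Q N" "D ** N = smul (- Q) N"
  defines "b \<equiv> real_part_form (P ** N) 1" and "c \<equiv> real_part_form (P ** N) \<i>"
  shows "vol4 P b c (real_part_form (P ** D) v) = 2 * form b b * Re (v * Q)"
proof -
  define P' where "P' = adjugate P"
  define N' where "N' = ctransp N"
  define D' where "D' = ctransp D"
  define e where "e = trace (P ** N ** P' ** N')"
  have inv: "P ** P' = mat 1" "P' ** P = mat 1" "\<And>K. (K :: cmat) ** P ** P' = K" "\<And>K. (K :: cmat) ** P' ** P = K"
    using mult_adjugate_cancel[OF P(2)] by (auto simp: P'_def)
  have P'h: "ctransp P' = P'" by (simp add: P'_def P)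
  have N'0: "N' ** N' = 0" using arg_cong[OF N(2), of ctransp] by (simp add: N'_def ctransp_linear)
  have NN: "(K :: cmat) ** N ** N = 0" "(K :: cmat) ** N' ** N' = 0" for K
    using N(2) N'0 by (simp_all add: matrix_mul_assoc[symmetric])
  have adj: "adjugate N = - N" "adjugate D = - D" "adjugate N' = - N'" "adjugate D' = - D'"
    using N D by (auto simp: N'_def D'_def intro!: adjugate_tracefree)
  have b: "b = P ** N + N' ** P" and c: "c = smul \<i> (P ** N) - smul \<i> (N' ** P)"
    by (simp_all add: b_def c_def real_part_form_def P N'_def smul_minus_left)
  have ND': "D' ** N' = smul (cnj Q) N'" "N' ** D' = smul (- cnj Q) N'"
    using arg_cong[OF ND(1), of ctransp] arg_cong[OF ND(2), of ctransp] by (simp_all add: N'_def D'_def)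
  let ?d = "real_part_form (P ** D) v"
  have d: "?d = smul v (P ** D) + smul (cnj v) (D' ** P)"
    by (simp add: real_part_form_def P D'_def)
  have adjb: "adjugate b = - (N ** P') - P' ** N'" 
    by (simp add: b adjugate_linear adj P'_def[symmetric] mm.minus_left mm.minus_right)
  have adjd: "adjugate ?d = - smul v (D ** P') - smul (cnj v) (P' ** D')"
    by (simp add: d adjugate_linear adj P'_def[symmetric] mm.minus_left mm.minus_right smul_minus)
  have Pb: "P ** adjugate b = - (P ** N ** P') - N'"
    by (simp add: adjb mm.minus_right mm.diff_right matrix_mul_assoc inv)
  have Pbc: "P ** adjugate b ** c = smul \<i> (P ** N ** P' ** N' ** P) - smul \<i> (N' ** P ** N)"
    by (simp add: Pb c mm.minus_left mm.diff_left mm.diff_right mm.minus_right matrix_mul_assoc inv NN N'0 smul_minus)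
  have "P ** adjugate b ** c ** adjugate ?d =
     smul (\<i> * v) (N' ** P ** N ** D ** P') + smul (\<i> * cnj v) (N' ** P ** N ** P' ** D')
     - smul (\<i> * v) (P ** N ** P' ** N' ** P ** D ** P') - smul (\<i> * cnj v) (P ** N ** P' ** N' ** D')"
    unfolding Pbc adjd
    by (simp add: mm.minus_left mm.diff_left mm.diff_right mm.minus_right smul_minus smul_diff matrix_mul_assoc inv mult.commute)
  then have tr: "trace (P ** adjugate b ** c ** adjugate ?d) =
     \<i> * v * trace (N' ** P ** N ** D ** P') + \<i> * cnj v * trace (N' ** P ** N ** P' ** D')
     - \<i> * v * trace (P ** N ** P' ** N' ** P ** D ** P') - \<i> * cnj v * trace (P ** N ** P' ** N' ** D')"
    by (simp add: trace_linear)
  have cyc: "trace (N' ** P ** N ** P') = e"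
    using trace_commute[of N' "P ** N ** P'"] by (simp add: e_def matrix_mul_assoc)
  have "trace (N' ** P ** N ** D ** P') = trace (N' ** P ** (N ** D) ** P')" by (simp add: matrix_mul_assoc)
  then have t1: "trace (N' ** P ** N ** D ** P') = Q * e" unfolding ND by (simp add: trace_linear cyc)
  have "trace (N' ** P ** N ** P' ** D') = trace (D' ** N' ** P ** N ** P')"
    using trace_commute[of "N' ** P ** N ** P'" D'] by (simp add: matrix_mul_assoc)
  then have t2: "trace (N' ** P ** N ** P' ** D') = cnj Q * e" unfolding ND' by (simp add: trace_linear cyc)
  have "trace (P ** N ** P' ** N' ** P ** D ** P') = trace (P' ** P ** N ** P' ** N' ** P ** D)"
    using trace_commute[of "P ** N ** P' ** N' ** P ** D" P'] by (simp add: matrix_mul_assoc)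
  also have "\<dots> = trace (N ** (P' ** N' ** P ** D))" by (simp add: inv matrix_mul_assoc)
  also have "\<dots> = trace (P' ** N' ** P ** D ** N)" by (rule trace_commute)
  also have "\<dots> = trace (P' ** N' ** P ** (D ** N))" by (simp add: matrix_mul_assoc)
  also have "\<dots> = - Q * trace (P' ** (N' ** P ** N))" unfolding ND by (simp add: trace_linear matrix_mul_assoc)
  also have "trace (P' ** (N' ** P ** N)) = trace (N' ** P ** N ** P')" by (rule trace_commute)
  finally have t3: "trace (P ** N ** P' ** N' ** P ** D ** P') = - Q * e" unfolding cyc .
  have "trace (P ** N ** P' ** N' ** D') = trace (P ** N ** P' ** (N' ** D'))" by (simp add: matrix_mul_assoc)
  then have t4: "trace (P ** N ** P' ** N' ** D') = - cnj Q * e" unfolding ND' by (simp add: trace_linear e_def)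
  have ec: "cnj e = e"
  proof -
    have "cnj e = trace (ctransp (P ** N ** P' ** N'))" by (simp only: trace_ctransp e_def)
    also have "ctransp (P ** N ** P' ** N') = N ** (P' ** N' ** P)" by (simp add: N'_def P P'h matrix_mul_assoc)
    also have "trace (N ** (P' ** N' ** P)) = trace (P' ** N' ** P ** N)" by (rule trace_commute)
    also have "\<dots> = trace (P' ** (N' ** P ** N))" by (simp add: matrix_mul_assoc)
    also have "\<dots> = trace (N' ** P ** N ** P')" by (rule trace_commute)
    finally show ?thesis unfolding cyc .
  qed
  then have er: "e = of_real (Re e)" by (metis Reals_cnj_iff of_real_Re)
  have "b ** adjugate b = - (P ** N ** P' ** N') - N' ** P ** N ** P'"
    unfolding adjb unfolding b
    by (simp add: mm.add_left mm.diff_right mm.minus_right matrix_mul_assoc inv NN N'0)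
  then have "trace (b ** adjugate b) = - (2 * e)" using cyc by (simp add: trace_linear e_def[symmetric])
  then have fb: "form b b = Re e" by (simp add: form_def)
  have "trace (P ** adjugate b ** c ** adjugate ?d) = 2 * \<i> * e * (v * Q + cnj (v * Q))"
    unfolding tr t1 t2 t3 t4 by (simp add: algebra_simps)
  also have "\<dots> = 2 * \<i> * e * of_real (2 * Re (v * Q))" by (simp only: complex_add_cnj)
  also have "\<dots> = 2 * \<i> * of_real (Re e) * of_real (2 * Re (v * Q))" by (subst er) (rule refl)
  also have "\<dots> = \<i> * of_real (4 * Re e * Re (v * Q))" by (simp del: times_complex.sel)
  finally have "Im (trace (P ** adjugate b ** c ** adjugate ?d)) = 4 * Re e * Re (v * Q)" by simp
  moreover have "vol4 P b c ?d = Im (trace (P ** adjugate b ** c ** adjugate ?d)) / 2"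
    by (rule vol4_trace) (simp_all add: P b_def c_def rpf_hermitian)
  ultimately show ?thesis by (simp add: fb)
qed

lemma partial_eq: "(F has_derivative D) (at z) \<Longrightarrow> partial v F z = D v"
  unfolding partial_def using frechet_derivative_at by metis

text \<open>
  In the hyperbolic case both pure second derivatives contain the Hermitian matrix 2 K, which cancels in their
  difference; the mixed derivative does not contain it.
\<close>

lemma second_partials:
  assumes imm: "conformal_immersion X f" and nc: "null_curve (null_form X f)" and z: "z \<in> punctured_sphere"
  shows "partial 1 (partial 1 f) z - partial \<i> (partial \<i> f) z = real_part_form (base X f z ** deriv_mat (null_form X f) z) 2"
    "partial \<i> (partial 1 f) z = real_part_form (base X f z ** deriv_mat (null_form X f) z) \<i>"
proof -
  let ?a = "null_form X f" and ?P = "base X f"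
  define K where "K = (if X = Hyperbolic then ctransp (?a z) ** f z ** ?a z else 0)"
  have fz: "ctransp (f z) = f z" by (rule immersion_hermitian[OF imm z])
  have K: "ctransp K = K" by (simp add: K_def matrix_mul_assoc ctransp_linear fz)
  have nil: "?a z ** ?a z = 0" using nc z by (auto simp: null_curve_def)
  have da: "(?a has_derivative (\<lambda>v. smul v (deriv_mat ?a z))) (at z)"
    using null_curve_deriv[OF nc z] by (simp add: has_mderiv_def)
  have dPa: "((\<lambda>z. ?P z ** ?a z) has_derivative (\<lambda>v. smul v (?P z ** deriv_mat ?a z) + smul (cnj v) K)) (at z)"
  proof (cases X)
    case Euclidean
    then show ?thesis using da by (simp add: base_def K_def)
  next
    case Hyperbolic
    have "((\<lambda>z. f z ** ?a z) has_derivative (\<lambda>v. f z ** smul v (deriv_mat ?a z) + real_part_form (f z ** ?a z) v ** ?a z)) (at z)"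
      using mm.FDERIV[OF immersion_derivative[OF imm z] da] Hyperbolic by (simp add: base_def)
    moreover have "real_part_form (f z ** ?a z) v ** ?a z = smul (cnj v) K" for v
    proof -
      have "f z ** ?a z ** ?a z = 0" using nil by (simp add: matrix_mul_assoc[symmetric])
      then show ?thesis by (simp add: real_part_form_def mm.add_left fz K_def Hyperbolic matrix_mul_assoc)
    qed
    ultimately show ?thesis using Hyperbolic by (simp add: base_def)
  qed
  have second: "partial v (partial w f) z = real_part_form (smul v (?P z ** deriv_mat ?a z) + smul (cnj v) K) w" for v w
  proof (rule partial_eq)
    have "((\<lambda>z. smul w (?P z ** ?a z) + ctransp (smul w (?P z ** ?a z))) has_derivative
       (\<lambda>v. smul w (smul v (?P z ** deriv_mat ?a z) + smul (cnj v) K) + ctransp (smul w (smul v (?P z ** deriv_mat ?a z) + smul (cnj v) K)))) (at z)"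
      by (intro has_derivative_add bounded_linear.has_derivative[OF bounded_linear_ctransp]
          bounded_linear.has_derivative[OF sm.bounded_linear_right] dPa)
    then show "(partial w f has_derivative (\<lambda>v. real_part_form (smul v (?P z ** deriv_mat ?a z) + smul (cnj v) K) w)) (at z)"
      unfolding real_part_form_def
      by (rule has_derivative_transform_within_open[OF _ open_punctured_sphere z])
        (simp add: partial_immersion[OF imm] real_part_form_def)
  qed
  show "partial 1 (partial 1 f) z - partial \<i> (partial \<i> f) z = real_part_form (?P z ** deriv_mat ?a z) 2"
    unfolding second
    by (simp add: real_part_form_def K ctransp_linear smul_add smul_minus_left cmat_eq_iff
        right_diff_distrib distrib_left)
  show "partial \<i> (partial 1 f) z = real_part_form (?P z ** deriv_mat ?a z) \<i>"
    unfolding second by (simp add: real_part_form_def K ctransp_linear smul_add smul_minus_left)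
qed

lemma hopf_geometric:
  assumes imm: "conformal_immersion X f" and nc: "null_curve (null_form X f)" and z: "z \<in> punctured_sphere"
  shows "vol4 (base X f z) (partial 1 f z) (partial \<i> f z) (partial 1 (partial 1 f) z - partial \<i> (partial \<i> f) z)
      = 4 * form (partial 1 f z) (partial 1 f z) * Re (hopf (null_form X f) z)"
    "vol4 (base X f z) (partial 1 f z) (partial \<i> f z) (partial \<i> (partial 1 f) z)
      = - 2 * form (partial 1 f z) (partial 1 f z) * Im (hopf (null_form X f) z)"
    "form (partial 1 f z) (partial 1 f z) > 0"
proof -
  have P: "ctransp (base X f z) = base X f z" "det (base X f z) = 1"
    using base_facts[where f = f, OF immersion_in_space[OF imm z]] by auto
  have N: "trace (null_form X f z) = 0" "null_form X f z ** null_form X f z = 0" using nc z by (auto simp: null_curve_def)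
  note v = hopf_volume[OF P N null_curve_hopf(3)[OF nc z] null_curve_hopf(1,2)[OF nc z]]
  show "vol4 (base X f z) (partial 1 f z) (partial \<i> f z) (partial 1 (partial 1 f) z - partial \<i> (partial \<i> f) z)
      = 4 * form (partial 1 f z) (partial 1 f z) * Re (hopf (null_form X f) z)"
    unfolding second_partials[OF imm nc z] partial_immersion[OF imm z] v by simp
  show "vol4 (base X f z) (partial 1 f z) (partial \<i> f z) (partial \<i> (partial 1 f) z)
      = - 2 * form (partial 1 f z) (partial 1 f z) * Im (hopf (null_form X f) z)"
    unfolding second_partials[OF imm nc z] partial_immersion[OF imm z] v by simp
  obtain c where "c > 0" "\<And>v w. form (partial v f z) (partial w f z) = c * (v \<bullet> w)"
    using imm z unfolding conformal_immersion_def by blast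
  then show "form (partial 1 f z) (partial 1 f z) > 0" by simp
qed

lemma bounded_linear_form: "bounded_linear (\<lambda>x. form x b)"
  unfolding linear_conv_bounded_linear[symmetric]
  by (rule linearI) (simp_all add: form_def cmat_expand algebra_simps)

lemma form_partial:
  assumes eq: "\<And>z. z \<in> punctured_sphere \<Longrightarrow> form (F z - c) b = form (F' z - c') b'"
    and F: "F differentiable (at z)" "F' differentiable (at z)" and z: "z \<in> punctured_sphere"
  shows "form (partial v F z) b = form (partial v F' z) b'"
proof -
  have d: "((\<lambda>z. form (F z - c) b) has_derivative (\<lambda>v. form (partial v F z) b)) (at z)"
    if "F differentiable (at z)" for F c b
  proof -
    have "(F has_derivative (\<lambda>v. partial v F z)) (at z)"
      unfolding partial_def using frechet_derivative_works that by blast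
    from has_derivative_diff[OF this has_derivative_const[of c]]
    have "((\<lambda>z. F z - c) has_derivative (\<lambda>v. partial v F z)) (at z)" by simp
    then show ?thesis by (rule bounded_linear.has_derivative[OF bounded_linear_form])
  qed
  have "((\<lambda>z. form (F z - c) b) has_derivative (\<lambda>v. form (partial v F' z) b')) (at z)"
    by (rule has_derivative_transform_within_open[OF d[OF F(2)] open_punctured_sphere z]) (simp add: eq)
  from has_derivative_unique[OF d[OF F(1)] this] show ?thesis by metis
qed

text \<open>
  The matrices b and b' are reference frames that correspond under the congruence, and c, c' are
  corresponding origins. Differentiating the assumptions shows that the derivatives of f and f' have the same products
  with the frames, so by the Gram identity they span the same volumes.
\<close>

proposition hopf_congruent:
  fixes b b' :: "cmat^4"
  assumes imm: "conformal_immersion X f" "conformal_immersion X f'"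
    and nc: "null_curve (null_form X f)" "null_curve (null_form X f')"
    and dist: "\<And>z w. z \<in> punctured_sphere \<Longrightarrow> w \<in> punctured_sphere \<Longrightarrow> form (f z - c) (f w - c) = form (f' z - c') (f' w - c')"
    and frame: "\<And>z i. z \<in> punctured_sphere \<Longrightarrow> form (f z - c) (b$i) = form (f' z - c') (b'$i)"
    and base: "\<And>z i. z \<in> punctured_sphere \<Longrightarrow> form (base X f z) (b$i) = form (base X f' z) (b'$i)"
    and herm: "\<And>i. ctransp (b$i) = b$i" "\<And>i. ctransp (b'$i) = b'$i"
    and vol: "vol4 (b$1) (b$2) (b$3) (b$4) = vol4 (b'$1) (b'$2) (b'$3) (b'$4)" "vol4 (b$1) (b$2) (b$3) (b$4) \<noteq> 0"
    and z: "z \<in> punctured_sphere"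
  shows "hopf (null_form X f) z = hopf (null_form X f') z"
proof -
  note d1 = immersion_differentiable[OF imm(1)] and d2 = immersion_differentiable[OF imm(2)]
  have p: "form (partial v f z) (b$i) = form (partial v f' z) (b'$i)" if "z \<in> punctured_sphere" for v z i
    by (rule form_partial[OF frame d1(1)[OF that] d2(1)[OF that] that])
  have pp: "form (partial v (partial 1 f) z) (b$i) = form (partial v (partial 1 f') z) (b'$i)"
     "form (partial v (partial \<i> f) z) (b$i) = form (partial v (partial \<i> f') z) (b'$i)" for v i
    by (rule form_partial[where c = 0 and c' = 0, OF _ d1(2)[OF z] d2(2)[OF z] z], simp add: p)
      (rule form_partial[where c = 0 and c' = 0, OF _ d1(3)[OF z] d2(3)[OF z] z], simp add: p)
  have E: "form (partial 1 f z) (partial 1 f z) = form (partial 1 f' z) (partial 1 f' z)"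
  proof -
    have 1: "form (f w - c) (partial 1 f z) = form (f' w - c') (partial 1 f' z)" if "w \<in> punctured_sphere" for w
    proof -
      have "form (partial 1 f z) (f w - c) = form (partial 1 f' z) (f' w - c')"
        by (rule form_partial[OF _ d1(1)[OF z] d2(1)[OF z] z]) (rule dist[OF _ that])
      then show ?thesis by (simp add: form_commute)
    qed
    show ?thesis by (rule form_partial[OF 1 d1(1)[OF z] d2(1)[OF z] z])
  qed
  have h: "ctransp (base X f z) = base X f z" "ctransp (base X f' z) = base X f' z"
    using base_facts(2)[where f = f, OF immersion_in_space[OF imm(1) z]]
      base_facts(2)[where f = f', OF immersion_in_space[OF imm(2) z]] by auto
  have hp: "ctransp (partial v f z) = partial v f z" "ctransp (partial v f' z) = partial v f' z" for v
    unfolding partial_immersion[OF imm(1) z] partial_immersion[OF imm(2) z] by (rule rpf_hermitian)+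
  have eqvol: "vol4 (base X f z) (partial 1 f z) (partial \<i> f z) y = vol4 (base X f' z) (partial 1 f' z) (partial \<i> f' z) y'"
    if y: "ctransp y = y" "ctransp y' = y'" "\<And>i. form y (b$i) = form y' (b'$i)" for y y'
  proof -
    let ?u = "vector [base X f z, partial 1 f z, partial \<i> f z, y] :: cmat^4"
    let ?u' = "vector [base X f' z, partial 1 f' z, partial \<i> f' z, y'] :: cmat^4"
    have "\<forall>i. ctransp (?u$i) = ?u$i" "\<forall>i. ctransp (?u'$i) = ?u'$i"
      unfolding forall_4 by (simp_all add: h hp y)
    moreover have "\<forall>i. \<forall>j. form (?u$i) (b$j) = form (?u'$i) (b'$j)"
      unfolding forall_4[of "\<lambda>i. \<forall>j. form (?u$i) (b$j) = form (?u'$i) (b'$j)"] by (simp add: base[OF z] p[OF z] y)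
    ultimately have "vol4 (?u$1) (?u$2) (?u$3) (?u$4) * vol4 (b$1) (b$2) (b$3) (b$4)
       = vol4 (?u'$1) (?u'$2) (?u'$3) (?u'$4) * vol4 (b'$1) (b'$2) (b'$3) (b'$4)"
      by (intro vol4_gram herm) auto
    then show ?thesis using vol by simp
  qed
  note g = hopf_geometric[OF imm(1) nc(1) z] and g' = hopf_geometric[OF imm(2) nc(2) z]
  have form_diff: "form (x - y) w = form x w - form y w" for x y w
    by (rule linear_diff[OF bounded_linear.linear[OF bounded_linear_form]])
  have "vol4 (base X f z) (partial 1 f z) (partial \<i> f z) (partial 1 (partial 1 f) z - partial \<i> (partial \<i> f) z)
    = vol4 (base X f' z) (partial 1 f' z) (partial \<i> f' z) (partial 1 (partial 1 f') z - partial \<i> (partial \<i> f') z)"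
    by (rule eqvol) (simp_all add: second_partials[OF imm(1) nc(1) z] second_partials[OF imm(2) nc(2) z] rpf_hermitian,
        simp add: second_partials[OF imm(1) nc(1) z, symmetric] second_partials[OF imm(2) nc(2) z, symmetric] form_diff pp)
  then have "Re (hopf (null_form X f) z) = Re (hopf (null_form X f') z)"
    unfolding g(1) g'(1) using g(3) by (simp add: E)
  moreover have "vol4 (base X f z) (partial 1 f z) (partial \<i> f z) (partial \<i> (partial 1 f) z)
    = vol4 (base X f' z) (partial 1 f' z) (partial \<i> f' z) (partial \<i> (partial 1 f') z)"
    by (rule eqvol) (simp_all add: second_partials[OF imm(1) nc(1) z] second_partials[OF imm(2) nc(2) z] rpf_hermitian,
        simp add: second_partials[OF imm(1) nc(1) z, symmetric] second_partials[OF imm(2) nc(2) z, symmetric] pp)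
  then have "Im (hopf (null_form X f) z) = Im (hopf (null_form X f') z)"
    unfolding g(2) g'(2) using g(3) by (simp add: E)
  ultimately show ?thesis by (simp add: complex_eq_iff)
qed

text \<open>
  The reversed Cauchy-Schwarz inequality, which follows from the Lagrange identity. It is needed since arcosh determines its
  argument only on the interval from 1 to infinity.
\<close>

lemma hyperbolic_form_bound:
  assumes "x \<in> space_of Hyperbolic" "y \<in> space_of Hyperbolic"
  shows "- form x y \<ge> 1"
proof -
  have *: "\<exists>t a b c. x = herm t a b c \<and> t * t = 1 + (a * a + b * b + c * c) \<and> t > 0" if x: "x \<in> space_of Hyperbolic" for x
  proof -
    have "ctransp x = x" using x by (simp add: hermitian_def)
    then obtain t a b c where h: "x = herm t a b c" by (rule hermitian_cases)
    have "det x = 1" "Re (trace x) > 0" using x by auto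
    then have "t * t = 1 + (a * a + b * b + c * c)" "t > 0"
      by (simp_all add: h det_2 trace_entry complex_eq_iff algebra_simps)
    with h show ?thesis by blast
  qed
  obtain t a b c where x: "x = herm t a b c" "t * t = 1 + (a * a + b * b + c * c)" "t > 0" using *[OF assms(1)] by blast
  obtain s d e g where y: "y = herm s d e g" "s * s = 1 + (d * d + e * e + g * g)" "s > 0" using *[OF assms(2)] by blast
  have "(1 + (a * d + b * e + c * g))\<^sup>2 \<le> (t * s)\<^sup>2"
  proof -
    have "(t * s)\<^sup>2 = (1 + (a * a + b * b + c * c)) * (1 + (d * d + e * e + g * g))"
      unfolding x(2)[symmetric] y(2)[symmetric] by (simp add: power2_eq_square)
    also have "\<dots> = (1 + (a * d + b * e + c * g))\<^sup>2 + ((a - d)\<^sup>2 + (b - e)\<^sup>2 + (c - g)\<^sup>2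
      + (a * e - b * d)\<^sup>2 + (a * g - c * d)\<^sup>2 + (b * g - c * e)\<^sup>2)"
      by (simp add: power2_eq_square algebra_simps)
    finally show ?thesis by simp
  qed
  then have "1 + (a * d + b * e + c * g) \<le> t * s"
    by (rule power2_le_imp_le) (use x(3) y(3) in simp)
  then show ?thesis by (simp add: x(1) y(1) form_herm)
qed

lemma null_form_weights_unique:
  assumes "\<And>z. z \<in> punctured_sphere \<Longrightarrow> hopf \<alpha> z = hopf \<beta> z" "weighted_end \<alpha> k q" "weighted_end \<beta> k q'"
  shows "q = q'"
proof -
  have "((\<lambda>w. w\<^sup>2 * (deriv (chart k) w)\<^sup>2 * hopf \<beta> (chart k w)) \<longlongrightarrow> q) (at 0)"
  proof (rule Lim_transform_eventually)
    show "((\<lambda>w. w\<^sup>2 * (deriv (chart k) w)\<^sup>2 * hopf \<alpha> (chart k w)) \<longlongrightarrow> q) (at 0)"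
      using assms(2) by (simp add: weighted_end_def)
    show "\<forall>\<^sub>F w in at 0. w\<^sup>2 * (deriv (chart k) w)\<^sup>2 * hopf \<alpha> (chart k w) = w\<^sup>2 * (deriv (chart k) w)\<^sup>2 * hopf \<beta> (chart k w)"
      using eventually_chart_in_sphere[of k] by eventually_elim (simp add: assms(1))
  qed
  moreover have "((\<lambda>w. w\<^sup>2 * (deriv (chart k) w)\<^sup>2 * hopf \<beta> (chart k w)) \<longlongrightarrow> q') (at 0)"
    using assms(3) by (simp add: weighted_end_def)
  ultimately show ?thesis by (rule limit_at_0_unique)
qed

text \<open>
  A distance preserving map preserves the form (in the Euclidean case, on differences, by polarization). The image of
  a positive frame is positive with the same squared volume, hence with the same volume.
\<close>

lemma rigid_motion_hopf:
  assumes imm: "conformal_immersion X f" "conformal_immersion X f'"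
    and nc: "null_curve (null_form X f)" "null_curve (null_form X f')"
    and J: "rigid_motion X J" and f': "\<And>z. z \<in> punctured_sphere \<Longrightarrow> f' z = J (f z)"
    and z: "z \<in> punctured_sphere"
  shows "hopf (null_form X f) z = hopf (null_form X f') z"
proof (cases X)
  case Hyperbolic
  let ?S = "space_of Hyperbolic"
  have JS: "J x \<in> ?S" if "x \<in> ?S" for x
    using J that Hyperbolic by (auto simp: rigid_motion_def dest: bij_betw_apply)
  have Jform: "form (J x) (J y) = form x y" if "x \<in> ?S" "y \<in> ?S" for x y
  proof -
    have "arcosh (- form (J x) (J y)) = arcosh (- form x y)"
      using J that Hyperbolic by (auto simp: rigid_motion_def)
    then have "cosh (arcosh (- form (J x) (J y))) = cosh (arcosh (- form x y))" by simp
    then show ?thesis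
      using hyperbolic_form_bound[OF that] hyperbolic_form_bound[OF JS JS] that by simp
  qed
  \<comment> \<open>The squares of 5/4 and 3/4 differ by 1, so these are points of hyperbolic space.\<close>
  define b where "b = (vector [herm 1 0 0 0, herm (5/4) (3/4) 0 0, herm (5/4) 0 (3/4) 0, herm (5/4) 0 0 (3/4)] :: cmat^4)"
  have bS: "b$i \<in> ?S" for i
  proof -
    have "\<forall>i. b$i \<in> ?S"
      unfolding forall_4 b_def by (simp add: hermitian_def hermitian_herm det_2 trace_entry complex_eq_iff)
    then show ?thesis by blast
  qed
  define b' where "b' = (\<chi> i. J (b$i))"
  have b'S: "b'$i \<in> ?S" for i using JS[OF bS] by (simp add: b'_def)
  have herm: "ctransp (b$i) = b$i" "ctransp (b'$i) = b'$i" for i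
    using bS[of i] b'S[of i] by (auto simp: hermitian_def)
  have fS: "f w \<in> ?S" if "w \<in> punctured_sphere" for w
    using immersion_in_space[OF imm(1) that] Hyperbolic by simp
  have v: "vol4 (b$1) (b$2) (b$3) (b$4) > 0"
    by (simp add: b_def vol4_def pauli_coords_herm det_4)
  then have v': "vol4 (b'$1) (b'$2) (b'$3) (b'$4) > 0"
    using J bS Hyperbolic unfolding rigid_motion_def b'_def by auto
  have "vol4 (b$1) (b$2) (b$3) (b$4) * vol4 (b$1) (b$2) (b$3) (b$4) = vol4 (b'$1) (b'$2) (b'$3) (b'$4) * vol4 (b'$1) (b'$2) (b'$3) (b'$4)"
    by (rule vol4_gram[OF herm(1) herm(1) herm(2) herm(2)]) (use Jform[OF bS bS] in \<open>simp add: b'_def\<close>)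
  then have "(vol4 (b$1) (b$2) (b$3) (b$4))\<^sup>2 = (vol4 (b'$1) (b'$2) (b'$3) (b'$4))\<^sup>2" by (simp add: power2_eq_square)
  then have vol: "vol4 (b$1) (b$2) (b$3) (b$4) = vol4 (b'$1) (b'$2) (b'$3) (b'$4)"
    using v v' by (simp add: power2_eq_iff_nonneg)
  show ?thesis
  proof (rule hopf_congruent[where b = b and b' = b' and c = 0 and c' = 0, OF imm nc _ _ _ herm vol _ z])
    show "form (f z - 0) (f w - 0) = form (f' z - 0) (f' w - 0)" if "z \<in> punctured_sphere" "w \<in> punctured_sphere" for z w
      using Jform[OF fS[OF that(1)] fS[OF that(2)]] that by (simp add: f')
    show "form (f z - 0) (b$i) = form (f' z - 0) (b'$i)" if "z \<in> punctured_sphere" for z i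
      using Jform[OF fS[OF that] bS[of i]] that by (simp add: f' b'_def)
    then show "form (base X f z) (b$i) = form (base X f' z) (b'$i)" if "z \<in> punctured_sphere" for z i
      using that Hyperbolic by (simp add: base_def)
  qed (use v in simp)
next
  case Euclidean
  let ?S = "space_of Euclidean"
  have JS: "J x \<in> ?S" if "x \<in> ?S" for x
    using J that Euclidean by (auto simp: rigid_motion_def dest: bij_betw_apply)
  have J2: "form (J x - J y) (J x - J y) = form (x - y) (x - y)" if "x \<in> ?S" "y \<in> ?S" for x y
    using J that Euclidean by (auto simp: rigid_motion_def)
  have pol: "form (x - o') (y - o') = (form (x - o') (x - o') + form (y - o') (y - o') - form (x - y) (x - y)) / 2" for x y o'
    by (simp add: form_def cmat_expand field_simps)
  have Jform: "form (J x - J o') (J y - J o') = form (x - o') (y - o')" if "x \<in> ?S" "y \<in> ?S" "o' \<in> ?S" for x y o'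
    by (subst (1 2) pol) (simp only: J2 that)
  have tr1: "form (mat 1) (x - y) = 0" "form (x - y) (mat 1) = 0" if "x \<in> ?S" "y \<in> ?S" for x y
  proof -
    have "Re (trace x) = 0" "Re (trace y) = 0" using that by simp_all
    then show "form (mat 1) (x - y) = 0" "form (x - y) (mat 1) = 0"
      by (simp_all add: form_def trace_entry mult_entry)
  qed
  define d where "d = (vector [0, herm 0 1 0 0, herm 0 0 1 0, herm 0 0 0 1] :: cmat^4)"
  have dS: "d$i \<in> ?S" for i
  proof -
    have "\<forall>i. d$i \<in> ?S"
      unfolding forall_4 d_def by (simp add: hermitian_def hermitian_herm ctransp_linear trace_entry complex_eq_iff)
    then show ?thesis by blast
  qed
  define e where "e = (\<chi> i. J (d$i))"
  have eS: "e$i \<in> ?S" for i using JS[OF dS] by (simp add: e_def)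
  define b where "b = (vector [mat 1, d$2 - d$1, d$3 - d$1, d$4 - d$1] :: cmat^4)"
  define b' where "b' = (vector [mat 1, e$2 - e$1, e$3 - e$1, e$4 - e$1] :: cmat^4)"
  have "ctransp (d$i) = d$i" "ctransp (e$i) = e$i" for i
    using dS[of i] eS[of i] by (auto simp: hermitian_def)
  then have "\<forall>i. ctransp (b$i) = b$i" "\<forall>i. ctransp (b'$i) = b'$i"
    unfolding forall_4 b_def b'_def by (simp_all add: ctransp_linear)
  then have herm: "ctransp (b$i) = b$i" "ctransp (b'$i) = b'$i" for i by auto
  have fS: "f w \<in> ?S" if "w \<in> punctured_sphere" for w
    using immersion_in_space[OF imm(1) that] Euclidean by simp
  have one: "mat 1 = herm 1 0 0 0" by (simp add: cmat_eq_iff complex_eq_iff)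
  have v: "vol4 (b$1) (b$2) (b$3) (b$4) > 0"
    by (simp add: b_def d_def one vol4_def pauli_coords_herm det_4)
  have "positive_simplex Euclidean (d$1) (d$2) (d$3) (d$4)" using v by (simp add: b_def)
  then have "positive_simplex Euclidean (e$1) (e$2) (e$3) (e$4)"
    using J dS Euclidean unfolding rigid_motion_def e_def by auto
  then have v': "vol4 (b'$1) (b'$2) (b'$3) (b'$4) > 0" by (simp add: b'_def)
  have dd: "form (d$i - d$1) (d$j - d$1) = form (e$i - e$1) (e$j - e$1)" for i j
    using Jform[OF dS[of i] dS[of j] dS[of 1]] by (simp add: e_def)
  have trd: "form (mat 1) (d$i - d$j) = 0" "form (d$i - d$j) (mat 1) = 0"
    "form (mat 1) (e$i - e$j) = 0" "form (e$i - e$j) (mat 1) = 0" for i j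
    by (rule tr1[OF dS dS] tr1[OF eS eS])+
  have "\<forall>i. \<forall>j. form (b$i) (b$j) = form (b'$i) (b'$j)"
    unfolding forall_4 b_def b'_def by (simp add: dd trd)
  then have "vol4 (b$1) (b$2) (b$3) (b$4) * vol4 (b$1) (b$2) (b$3) (b$4) = vol4 (b'$1) (b'$2) (b'$3) (b'$4) * vol4 (b'$1) (b'$2) (b'$3) (b'$4)"
    by (intro vol4_gram[OF herm(1) herm(1) herm(2) herm(2)]) auto
  then have "(vol4 (b$1) (b$2) (b$3) (b$4))\<^sup>2 = (vol4 (b'$1) (b'$2) (b'$3) (b'$4))\<^sup>2" by (simp add: power2_eq_square)
  then have vol: "vol4 (b$1) (b$2) (b$3) (b$4) = vol4 (b'$1) (b'$2) (b'$3) (b'$4)"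
    using v v' by (simp add: power2_eq_iff_nonneg)
  show ?thesis
  proof (rule hopf_congruent[where b = b and b' = b' and c = "d$1" and c' = "e$1", OF imm nc _ _ _ herm vol _ z])
    show "form (f z - d$1) (f w - d$1) = form (f' z - e$1) (f' w - e$1)" if "z \<in> punctured_sphere" "w \<in> punctured_sphere" for z w
      using Jform[OF fS[OF that(1)] fS[OF that(2)] dS[of 1]] that by (simp add: f' e_def)
    have fd: "form (f z - d$1) (d$i - d$1) = form (f' z - e$1) (e$i - e$1)" if "z \<in> punctured_sphere" for z i
      using Jform[OF fS[OF that] dS[of i] dS[of 1]] that by (simp add: f' e_def)
    show "form (f z - d$1) (b$i) = form (f' z - e$1) (b'$i)" if "z \<in> punctured_sphere" for z i
    proof -
      have "f' z \<in> ?S" using JS[OF fS[OF that]] f'[OF that] by simp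
      then have trf: "form (f z - d$1) (mat 1) = 0" "form (f' z - e$1) (mat 1) = 0"
        using tr1(2)[OF fS[OF that] dS] tr1(2)[OF _ eS] by blast+
      have "\<forall>i. form (f z - d$1) (b$i) = form (f' z - e$1) (b'$i)"
        unfolding forall_4 b_def b'_def using that by (simp add: fd trf)
      then show ?thesis by blast
    qed
    show "form (base X f z) (b$i) = form (base X f' z) (b'$i)" if "z \<in> punctured_sphere" for z i
    proof -
      have "\<forall>i. form (mat 1) (b$i) = form (mat 1) (b'$i)"
        unfolding forall_4 b_def b'_def by (simp add: trd)
      then show ?thesis using Euclidean by (simp add: base_def)
    qed
  qed (use v in simp)
qed

theorem theorem7p10:
  fixes X :: ambient and f f' :: "complex \<Rightarrow> complex^2^2" and q q' :: "puncture \<Rightarrow> complex"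
  assumes "irreducible_trinoid X f q" and "irreducible_trinoid X f' q'"
  shows "same_up_to_rigid_motion X f f' \<longleftrightarrow> q = q'"
proof -
  obtain A B U p \<Phi> M where t: "trinoid_from X A B U p \<Phi> f q" "monodromy A B U p \<Phi> M" "irreducible_monodromy X 0 1 M"
    using assms(1) unfolding irreducible_trinoid_def by blast
  obtain A' B' U' p' \<Phi>' where t': "trinoid_from X A' B' U' p' \<Phi>' f' q'"
    using assms(2) unfolding irreducible_trinoid_def by blast
  interpret T: trinoid_frame A B U p \<Phi> X f q
    using t(1) by unfold_locales (auto simp: trinoid_from_def)
  interpret T': trinoid_frame A' B' U' p' \<Phi>' X f' q'
    using t' by unfold_locales (auto simp: trinoid_from_def)
  show ?thesis
  proof
    assume "same_up_to_rigid_motion X f f'"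
    then obtain J where J: "rigid_motion X J" "\<And>z. z \<in> punctured_sphere \<Longrightarrow> f' z = J (f z)"
      unfolding same_up_to_rigid_motion_def by blast
    have "hopf (null_form X f) z = hopf (null_form X f') z" if "z \<in> punctured_sphere" for z
      by (rule rigid_motion_hopf[OF T.immersion T'.immersion T.null_curve_null_form T'.null_curve_null_form J that])
    then have "q k = q' k" for k
      by (rule null_form_weights_unique[OF _ T.weighted_end_null_form T'.weighted_end_null_form])
    then show "q = q'" by blast
  next
    assume "q = q'"
    then show "same_up_to_rigid_motion X f f'"
      using equal_weights_congruent[OF t] t' by simp
  qed
qed

end
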